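(* Let $0<\zeta<\pi$ and let $N$ be an arbitrary non-negative integer. Let $\lambda$ and $\nu$ be complex numbers satisfying $0<\Re\lambda <N+1$ and $\Re \nu> -1$. Put $\delta _{\lambda ,\nu ,n} = (\nu + \lambda + n)\zeta - (\lambda - n)\tfrac{\pi}{2}$, and define $\widehat{R}_N^{(C)} (\zeta ,\lambda ,\nu )$ by $$C_\nu ^{(\lambda )} (\cos \zeta ) = \frac{2}{\Gamma (\lambda )(2\sin \zeta )^\lambda}\left( \sum_{n = 0}^{N - 1} a_n \left( \lambda - \tfrac{1}{2} \right)\frac{\Gamma (\nu + 2\lambda )}{\Gamma \left( \nu + \lambda + n + 1 \right)}\frac{\cos (\delta _{\lambda ,\nu ,n} )}{\sin ^n \zeta } + \widehat{R}_N^{(C)} (\zeta ,\lambda ,\nu ) \right).$$ Put $$G=\left| \frac{\sin (\pi \lambda )}{\sin (\pi \Re \lambda )} \right|\left| \frac{\Gamma (\Re \lambda )\Gamma (\Re \nu + 1)}{\Gamma (\lambda )\Gamma (\nu + 1)} \right|,\qquad s(\zeta)=\begin{cases} | \sec \zeta | & \text{if } 0 < \zeta \le \frac{\pi}{4} \text{ or } \frac{3\pi}{4} \le \zeta < \pi, \\ 2\sin \zeta & \text{if } \frac{\pi}{4} < \zeta < \frac{3\pi}{4}.\end{cases}$$ Then $$\left|\widehat{R}_N^{(C)}(\zeta,\lambda,\nu)\right| \le G \left| a_N \left( \Re \lambda - \tfrac{1}{2} \right) \right|\frac{\left| \Gamma (\nu + 2\lambda ) \right|}{\Gamma \left( \Re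 \nu + \Re \lambda + N + 1 \right)} \frac{\cosh (\Im (\delta _{\lambda ,\nu ,N} ))}{\sin ^N \zeta }\, s(\zeta)$$ and $$\begin{aligned}\left|\widehat{R}_N^{(C)}(\zeta,\lambda,\nu)\right| \le \; & G\left(\left| a_N \left( \Re \lambda - \tfrac{1}{2} \right) \right|\frac{\left| \Gamma (\nu + 2\lambda ) \right|}{\Gamma \left( \Re \nu + \Re \lambda + N + 1 \right)}\frac{|\cos (\delta _{\lambda ,\nu ,N} )|}{\sin ^N \zeta } \right.\\ & \left. + \left| a_{N+1} \left( \Re \lambda - \tfrac{1}{2} \right) \right|\frac{\left| \Gamma (\nu + 2\lambda ) \right|}{\Gamma \left( \Re \nu + \Re \lambda + N + 2 \right)}\frac{|\sin (\delta _{\lambda ,\nu ,N} )|}{\sin ^{N+1} \zeta }\right) s(\zeta).\end{aligned}$$ If $\Re\lambda $ is an integer, then the limiting values have to be taken in these bounds.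
   Context: The Gegenbauer function is defined for $-1<x<1$ by $$C_\nu ^{(\lambda )} (x) = \frac{\sqrt\pi\, \Gamma (\nu + 2\lambda )}{\Gamma (\lambda )\Gamma (\nu + 1)\left(2\sqrt{1-x^2}\right)^{\lambda - \frac{1}{2}} }\mathsf{P}_{\nu + \lambda - \frac{1}{2}}^{\frac{1}{2} - \lambda } (x),$$ where $\mathsf{P}_\nu ^\mu (x) = \left( \frac{1 + x}{1 - x} \right)^{\mu /2} \mathbf{F}\left(\nu+1,-\nu;1-\mu;\tfrac{1-x}{2}\right)$ is the Ferrers function of the first kind and $\mathbf{F}(a,b;c;w)=\sum_{n\ge 0}\frac{(a)_n(b)_n}{\Gamma(c+n)\,n!}w^n$ ($|w|<1$) is the regularised hypergeometric function. $a_n (\mu ) = \frac{(4\mu ^2 - 1^2 )(4\mu ^2 - 3^2 ) \cdots (4\mu ^2 - (2n - 1)^2 )}{8^n n!}$. If $\nu+2\lambda$ is a non-positive integer the function $C_\nu^{(\lambda)}$ is not defined by this formula and the statement is void. "Limiting value" means that $|a_k(\Re\lambda-\frac12)|/|\sin(\pi\Re\lambda)|$ is replaced by $\lim_{x\to\Re\lambda}|a_k(x-\frac12)|/|\sin(\pi x)|$. *)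

theory Defs
  imports "HOL-Analysis.Analysis"
begin

text \<open>Regularised hypergeometric function, for \<open>norm w < 1\<close>. The factor \<open>1 / \<Gamma>(c + n)\<close> is
  written with the entire function \<^const>\<open>rGamma\<close>, so it vanishes at the poles of \<open>\<Gamma>\<close>.\<close>

definition hypergeo_reg :: "complex \<Rightarrow> complex \<Rightarrow> complex \<Rightarrow> complex \<Rightarrow> complex" where
  "hypergeo_reg a b c w =
     (\<Sum>n. pochhammer a n * pochhammer b n * rGamma (c + of_nat n) / fact n * w ^ n)"

definition ferrers_P :: "complex \<Rightarrow> complex \<Rightarrow> real \<Rightarrow> complex" where
  "ferrers_P \<nu> \<mu> x =
     complex_of_real ((1 + x) / (1 - x)) powr (\<mu> / 2) *
     hypergeo_reg (\<nu> + 1) (- \<nu>) (1 - \<mu>) (complex_of_real ((1 - x) / 2))"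

definition gegenbauer_C :: "complex \<Rightarrow> complex \<Rightarrow> real \<Rightarrow> complex" where
  "gegenbauer_C \<nu> lam x =
     complex_of_real (sqrt pi) * Gamma (\<nu> + 2 * lam) /
     (Gamma lam * Gamma (\<nu> + 1) * complex_of_real (2 * sqrt (1 - x\<^sup>2)) powr (lam - 1 / 2)) *
     ferrers_P (\<nu> + lam - 1 / 2) (1 / 2 - lam) x"

definition a_coeff :: "nat \<Rightarrow> 'a :: field_char_0 \<Rightarrow> 'a" where
  "a_coeff n \<mu> = (\<Prod>j = 1..n. 4 * \<mu>\<^sup>2 - (of_nat (2 * j - 1))\<^sup>2) / (8 ^ n * fact n)"

definition phase_delta :: "real \<Rightarrow> complex \<Rightarrow> complex \<Rightarrow> nat \<Rightarrow> complex" where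
  "phase_delta \<zeta> lam \<nu> n =
     (\<nu> + lam + of_nat n) * complex_of_real \<zeta> - (lam - of_nat n) * complex_of_real (pi / 2)"

text \<open>The quotient \<open>|a\<^sub>k(r - 1/2)| / |sin(\<pi>r)|\<close>, replaced by its limiting value when \<open>r\<close> is an
  integer. For an integer \<open>r\<close> with \<open>1 \<le> r \<le> k\<close> the zero of \<open>sin(\<pi>x)\<close> at \<open>r\<close> is
  cancelled by the factor with \<open>j = r\<close> of \<open>a\<^sub>k(x - 1/2)\<close>, so that the limit exists.\<close>

definition a_sin_quot :: "nat \<Rightarrow> real \<Rightarrow> real" where
  "a_sin_quot k r =
     (if r \<in> \<int> then Lim (at r) (\<lambda>x. \<bar>a_coeff k (x - 1 / 2)\<bar> / \<bar>sin (pi * x)\<bar>)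
      else \<bar>a_coeff k (r - 1 / 2)\<bar> / \<bar>sin (pi * r)\<bar>)"

text \<open>The factor \<open>G\<close> of the error bounds without its denominator \<open>|sin(\<pi> Re \<lambda>)|\<close>, which is
  accounted for in \<^const>\<open>a_sin_quot\<close>.\<close>

definition G_factor :: "complex \<Rightarrow> complex \<Rightarrow> real" where
  "G_factor lam \<nu> =
     cmod (sin (complex_of_real pi * lam)) *
     cmod (complex_of_real (Gamma (Re lam) * Gamma (Re \<nu> + 1)) / (Gamma lam * Gamma (\<nu> + 1)))"

definition s_factor :: "real \<Rightarrow> real" where
  "s_factor \<zeta> =
     (if 0 < \<zeta> \<and> \<zeta> \<le> pi / 4 \<or> 3 * pi / 4 \<le> \<zeta> \<and> \<zeta> < pi then \<bar>1 / cos \<zeta>\<bar> else 2 * sin \<zeta>)"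

end

theory Submission
  imports Defs "HOL-Complex_Analysis.Complex_Analysis"
begin

text \<open>
  The Ferrers function is a Mehler--Dirichlet integral of
  \<open>e\<^sup>i\<^sup>(\<^sup>\<nu>\<^sup>+\<^sup>\<lambda>\<^sup>)\<^sup>\<theta> (2 cos \<theta> - 2 cos \<zeta>)\<^sup>\<lambda>\<^sup>-\<^sup>1\<close> over \<open>[-\<zeta>, \<zeta>]\<close>. This integrand is holomorphic in
  the half strip above that interval, so the path can be moved to the two vertical half lines
  through \<open>\<plusminus>\<zeta>\<close>. With \<open>t = 1 - e\<^sup>-\<^sup>y\<close> they become the Euler integrals of
  \<open>t\<^sup>\<lambda>\<^sup>-\<^sup>1 (1 - t)\<^sup>\<nu> (1 - w t)\<^sup>\<lambda>\<^sup>-\<^sup>1\<close> over \<open>[0, 1]\<close>, where \<open>w = (1 \<mp> i cot \<zeta>) / 2\<close>.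

  Expanding \<open>(1 - w t)\<^sup>\<lambda>\<^sup>-\<^sup>1\<close> in powers of \<open>w t\<close> gives the terms of the asymptotic series. The
  remainder after \<open>N\<close> terms is
  \<open>(w t)\<^sup>N (sin \<pi>\<lambda> / \<pi>) \<integral> u\<^sup>N\<^sup>-\<^sup>\<lambda> (1 - u)\<^sup>\<lambda>\<^sup>-\<^sup>1 / (1 - w t u) du\<close>, which converges exactly for
  \<open>0 < Re \<lambda> < N + 1\<close>. Adding the contributions of both points \<open>w\<close> leaves, for \<open>s = t u\<close>, the factor
  \<open>e\<^sup>i\<^sup>\<delta> / (1 - w s) + e\<^sup>-\<^sup>i\<^sup>\<delta> / (1 - w\<^sup>* s)\<close>. It is bounded on \<open>[0, 1]\<close> by means of
  \<open>|1 - w s|\<^sup>2 = 1 - s + s\<^sup>2 / (4 sin\<^sup>2 \<zeta>)\<close>; the remaining beta integrals combine to the stated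
  constants.
\<close>

section \<open>The complex beta integral\<close>

text \<open>On a positive base the imaginary part of an exponent is only a phase, so taking norms
  replaces \<open>lam\<close> and \<open>\<nu>\<close> by their real parts. The price is the factor
  G: |sin(pi lam)| is left over from the Stieltjes representation, Gamma(Re lam) Gamma(Re \<nu> + 1)
  comes from the real beta integrals, and the reflection formula turns what remains into a_N(Re lam
  - 1/2) / |sin(pi Re lam)|. This quotient is a product of two Gamma values, continuous for 0 < Re
  lam < N + 1, which is why limiting values at the integers make sense. The two bounds differ only
  in how the phase factor is estimated. The triangle inequality gives cosh. Writing the factor as
  one fraction gives the numerator (2 - s) cos \<delta> + s cot \<zeta> sin \<delta>; the extra s in
  its second part raises the parameters of both beta integrals and so produces the term with index N
  + 1. The number s(\<zeta>) is the maximum of 1 / |1 - w s| over [0, 1]. Branches are the recurring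
  obstacle. Powers of products are split only where the arguments add up inside (-pi, pi).\<close>

lemma absolutely_integrable_on_dominated:
  fixes f :: "real \<Rightarrow> 'a :: euclidean_space"
  assumes "open S" "continuous_on S f" "g integrable_on S" "\<And>x. x \<in> S \<Longrightarrow> norm (f x) \<le> g x"
  shows "f absolutely_integrable_on S"
proof (rule measurable_bounded_by_integrable_imp_absolutely_integrable)
  show "f \<in> borel_measurable (lebesgue_on S)"
    using assms(1,2) by (intro continuous_imp_measurable_on_sets_lebesgue) auto
qed (use assms in auto)

lemma absolutely_integrable_on_has_integral:
  fixes f :: "real \<Rightarrow> 'a :: euclidean_space"
  shows "f absolutely_integrable_on S \<Longrightarrow> (f has_integral integral S f) S"
  using set_lebesgue_integral_eq_integral(1) by blast

lemma Re_pos_not_nonpos_Ints: "Re z > 0 \<Longrightarrow> z \<notin> \<int>\<^sub>\<le>\<^sub>0"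
  by (auto elim!: nonpos_Ints_cases)

definition beta_kernel :: "complex \<Rightarrow> complex \<Rightarrow> real \<Rightarrow> complex" where
  "beta_kernel a b t = of_real t powr (a - 1) * of_real (1 - t) powr (b - 1)"

text \<open>Both bases are positive on the open interval, so only the real parts of the exponents
  survive. This is the source of the real parameters in the final bounds.\<close>

lemma norm_beta_kernel:
  assumes "t \<in> {0<..<1}"
  shows "norm (beta_kernel a b t) = t powr (Re a - 1) * (1 - t) powr (Re b - 1)"
proof -
  have "norm (of_real (1 - t) powr (b - 1)) = (1 - t) powr (Re b - 1)"
    using assms by (subst norm_powr_real_powr) auto
  moreover have "norm (of_real t powr (a - 1)) = t powr (Re a - 1)"
    using assms by (subst norm_powr_real_powr) auto
  ultimately show ?thesis unfolding beta_kernel_def by (simp only: norm_mult)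
qed

lemma continuous_on_beta_kernel: "continuous_on {0<..<1} (beta_kernel a b)"
  unfolding beta_kernel_def by (intro continuous_intros) (auto simp: complex_nonpos_Reals_iff)

lemma has_integral_norm_beta_kernel:
  assumes "Re a > 0" "Re b > 0"
  shows "((\<lambda>t. norm (beta_kernel a b t)) has_integral Beta (Re a) (Re b)) {0<..<1}"
  using has_integral_Beta_real[OF assms]
  by (subst has_integral_cong[OF norm_beta_kernel]) (simp_all add: has_integral_Icc_iff_Ioo)

lemma beta_kernel_absolutely_integrable:
  assumes "Re a > 0" "Re b > 0"
  shows "beta_kernel a b absolutely_integrable_on {0<..<1}"
  using has_integral_norm_beta_kernel[OF assms]
  by (intro absolutely_integrable_on_dominated[where g = "\<lambda>t. norm (beta_kernel a b t)"]
        continuous_on_beta_kernel) auto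

lemma beta_kernel_plus1_left:
  "t \<in> {0<..<1} \<Longrightarrow> beta_kernel (a + 1) b t = of_real t * beta_kernel a b t"
  by (simp add: beta_kernel_def powr_diff)

lemma beta_kernel_plus1_right:
  assumes "t \<in> {0<..<1}"
  shows "beta_kernel a (b + 1) t = of_real (1 - t) * beta_kernel a b t"
proof -
  have "of_real (1 - t) powr b = of_real (1 - t) * (of_real (1 - t) powr (b - 1) :: complex)"
    using assms by (simp only: powr_diff) auto
  thus ?thesis by (simp add: beta_kernel_def)
qed

lemma beta_kernel_plus_nat_left:
  "t \<in> {0<..<1} \<Longrightarrow> beta_kernel (a + of_nat n) b t = of_real t ^ n * beta_kernel a b t"
proof (induction n)
  case (Suc n)
  thus ?case using beta_kernel_plus1_left[of t "a + of_nat n" b] by (simp add: add_ac)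
qed auto

text \<open>The integrand is the derivative of t^a (1 - t)^b, which vanishes at both endpoints
  because the real parts of a and b are positive.\<close>

lemma beta_kernel_by_parts:
  assumes "Re a > 0" "Re b > 0"
  shows "((\<lambda>t. a * beta_kernel a (b + 1) t - b * beta_kernel (a + 1) b t) has_integral 0) {0<..<1}"
proof -
  define F where "F = (\<lambda>t. of_real t powr a * of_real (1 - t) powr b :: complex)"
  have c: "continuous_on {0..1} (\<lambda>t::real. of_real t powr c :: complex)" if "Re c > 0" for c
    using that by (intro continuous_on_powr_complex continuous_intros) (auto)
  have c': "continuous_on {0..1} (\<lambda>t::real. of_real (1 - t) powr c :: complex)" if "Re c > 0" for c
    by (rule continuous_on_compose2[OF c[OF that], of _ "\<lambda>t. 1 - t"]) (auto intro!:
        continuous_intros)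
  have "((\<lambda>t. a * beta_kernel a (b + 1) t - b * beta_kernel (a + 1) b t) has_integral
      (F 1 - F 0)) {0..1}"
  proof (rule fundamental_theorem_of_calculus_interior)
    show "continuous_on {0..1} F"
      unfolding F_def using c c' assms by (intro continuous_on_mult) auto
    fix x :: real assume x: "x \<in> {0<..<1}"
    have "((\<lambda>z. z powr a * (1 - z) powr b) has_field_derivative 
        (a * beta_kernel a (b + 1) x - b * beta_kernel (a + 1) b x)) (at (of_real x))"
      using x by (auto intro!: derivative_eq_intros simp: beta_kernel_def complex_nonpos_Reals_iff
          algebra_simps)
    from has_vector_derivative_real_field[OF this, of UNIV]
    show "(F has_vector_derivative (a * beta_kernel a (b + 1) x - b * beta_kernel (a +
        1) b x)) (at x)"
      by (simp add: F_def)
  qed auto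
  moreover have "F 1 - F 0 = 0" using assms by (auto simp: F_def)
  ultimately show ?thesis by (simp only: has_integral_Icc_iff_Ioo)
qed

text \<open>Integration by parts and the splitting 1 = t + (1 - t) are two linear relations between
  three integrals; eliminating the one with a + 1 leaves a recurrence in b.\<close>

lemma integral_beta_kernel_plus1_right:
  assumes "Re a > 0" "Re b > 0"
  shows "integral {0<..<1} (beta_kernel a b) = (a + b) / b * integral {0<..<1} (beta_kernel a (b +
      1))"
proof -
  let ?I = "\<lambda>a b. integral {0<..<1} (beta_kernel a b)"
  have int: "beta_kernel a b integrable_on {0<..<1}" if "Re a > 0" "Re b > 0" for a b
    using beta_kernel_absolutely_integrable[OF that] set_lebesgue_integral_eq_integral(1) by blast
  have "integral {0<..<1} (\<lambda>t. a * beta_kernel a (b + 1) t - b * beta_kernel (a + 1) b t) =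
    a * ?I a (b + 1) - b * ?I (a + 1) b"
    using assms by (subst integral_diff) (auto intro!: integrable_on_mult_right int)
  with beta_kernel_by_parts[OF assms] have 1: "a * ?I a (b + 1) = b * ?I (a + 1) b"
      by (simp add: integral_unique)
  have "?I a b = integral {0<..<1} (\<lambda>t. beta_kernel (a + 1) b t + beta_kernel a (b + 1) t)"
    by (intro integral_cong) (simp only: beta_kernel_plus1_left beta_kernel_plus1_right,
        simp add: ring_distribs)
  also have "\<dots> = ?I (a + 1) b + ?I a (b + 1)"
    using assms by (intro integral_add int) auto
  finally have 2: "?I a b = ?I (a + 1) b + ?I a (b + 1)" .
  have "b \<noteq> 0" using assms by auto
  thus ?thesis using 1 2 by (simp add: field_simps)
qed

lemma integral_beta_kernel_plus_nat_right:
  assumes "Re a > 0" "Re b > 0"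
  shows "integral {0<..<1} (beta_kernel a b) =
    pochhammer (a + b) n / pochhammer b n * integral {0<..<1} (beta_kernel a (b + of_nat n))"
proof (induction n)
  case (Suc n)
  have "b + of_nat n \<noteq> 0" using assms by (auto simp: complex_eq_iff)
  with integral_beta_kernel_plus1_right[of a "b + of_nat n"] assms show ?case
    by (subst Suc) (simp add: pochhammer_Suc add_ac)
qed auto

text \<open>Substitution t = s / n. Extension by zero to the half line gives all n the same domain,
  as dominated convergence requires.\<close>

lemma beta_kernel_scaled_has_integral:
  assumes "Re a > 0" "Re b > 1" "n > 0"
  shows "((\<lambda>s. if s < real n then of_real s powr (a - 1) * of_real (1 - s / n) powr (b +
      of_nat n - 1) else 0) has_integral
     (of_nat n powr a * integral {0<..<1} (beta_kernel a (b + of_nat n)))) {0<..}"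
proof -
  let ?g = "\<lambda>s. s / real n"
  have img: "?g ` {0<..<real n} = {0<..<1}" 
  proof -
    have "x \<in> ?g ` {0<..<real n}" if "x \<in> {0<..<1}" for x
      using that assms by (intro image_eqI[of _ _ "x * real n"]) auto
    thus ?thesis using assms by auto
  qed
  have cov: "(\<lambda>x. \<bar>1 / real n\<bar> *\<^sub>R beta_kernel a (b + of_nat n) (?g x)) absolutely_integrable_on
      {0<..<real n} \<and> integral {0<..<real n} (\<lambda>x. \<bar>1 / real n\<bar> *\<^sub>R beta_kernel a (b +
      of_nat n) (?g x)) = integral {0<..<1} (beta_kernel a (b + of_nat n))"
    using assms beta_kernel_absolutely_integrable[of a "b + of_nat n"]
    by (subst has_absolute_integral_change_of_variables_real) 
      (auto intro!: derivative_eq_intros inj_onI simp: img)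
  have "((\<lambda>x. \<bar>1 / real n\<bar> *\<^sub>R beta_kernel a (b + of_nat n) (?g x)) has_integral
      integral {0<..<1} (beta_kernel a (b + of_nat n))) {0<..<real n}"
    using absolutely_integrable_on_has_integral[OF conjunct1[OF cov]]
        by (simp only: conjunct2[OF cov])
  from has_integral_mult_right[OF this, of "of_nat n powr a"]
  have "((\<lambda>s. of_real s powr (a - 1) * of_real (1 - s / n) powr (b + of_nat n - 1)) has_integral
     (of_nat n powr a * integral {0<..<1} (beta_kernel a (b + of_nat n)))) {0<..<real n}"
  proof (rule has_integral_eq[rotated])
    fix s assume s: "s \<in> {0<..<real n}"
    have "(of_real (s / n) :: complex) powr (a - 1) = of_real s powr (a - 1) /
        of_nat n powr (a - 1)"
    proof -
      have "(of_real s :: complex) powr (a - 1) = (of_real (s / n) * of_real (real n)) powr (a - 1)"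
        using assms by simp
      also have "\<dots> = of_real (s / n) powr (a - 1) * of_real (real n) powr (a - 1)"
        using s by (intro powr_times_real) auto
      finally show ?thesis using assms by simp
    qed
    moreover have "(of_nat n :: complex) powr a = of_nat n * of_nat n powr (a - 1)"
      using assms by (simp add: powr_diff)
    ultimately show "of_nat n powr a * (\<bar>1 / real n\<bar> *\<^sub>R beta_kernel a (b + of_nat n) (s /
        real n)) = complex_of_real s powr (a - 1) * complex_of_real (1 - s / real n) powr (b +
        of_nat n - 1)"
      using assms by (simp add: beta_kernel_def scaleR_conv_of_real)
  qed
  hence "((\<lambda>s. if s \<in> {0<..<real n} then of_real s powr (a - 1) * of_real (1 - s / n) powr (b +
      of_nat n - 1) else 0) has_integral
     (of_nat n powr a * integral {0<..<1} (beta_kernel a (b + of_nat n)))) {0<..}"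
    by (subst has_integral_restrict) auto
  thus ?thesis by (rule has_integral_eq[rotated]) auto
qed

text \<open>After rescaling, (1 - s/n)^(b + n - 1) tends to exp(-s), which leaves Euler's integral
  for Gamma. The hypothesis Re b > 1 makes the exponent at least n, so that 1 - s/n \<le> exp(-s/n)
  gives a majorant independent of n.\<close>

lemma tendsto_beta_kernel_integral:
  assumes "Re a > 0" "Re b > 1"
  shows "(\<lambda>n. of_nat n powr a * integral {0<..<1} (beta_kernel a (b + of_nat n))) \<longlonglongrightarrow> Gamma a"
proof -
  define f where "f = (\<lambda>n s. if s < real n then of_real s powr (a - 1) * of_real (1 - s /
      n) powr (b + of_nat n - 1) else 0 :: complex)"
  define h where "h = (\<lambda>s::real. s powr (Re a - 1) / exp s)"
  define J where "J = (\<lambda>n. of_nat n powr a * integral {0<..<1} (beta_kernel a (b + of_nat n)))"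
  have f_int: "(f (Suc n) has_integral J (Suc n)) {0<..}" for n
    using beta_kernel_scaled_has_integral[OF assms, of "Suc n"] unfolding f_def J_def by simp
  have h_int: "h integrable_on {0<..}"
  proof -
    have "(h has_integral Gamma (Re a)) {0..}" using Gamma_integral_real[of "Re a"] assms
        by (simp add: h_def)
    hence "(h has_integral Gamma (Re a)) {0<..}"
      by (subst (asm) has_integral_spike_set_eq[of _ "{0<..}"]) (auto intro: negligible_subset[of
          "{0}"])
    thus ?thesis by blast
  qed
  have dom: "norm (f (Suc n) s) \<le> h s" if s: "s \<in> {0<..}" for n s
  proof (cases "s < real (Suc n)")
    case True
    define N where "N = Suc n"
    have q: "1 - s / N > 0" "1 - s / N \<le> 1" using True s by (auto simp: N_def field_simps)
    have "norm (of_real (1 - s / N) powr (b + of_nat N - 1) :: complex) = (1 - s / N) powr (Re b +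
        N - 1)"
      using q by (subst norm_powr_real_powr) auto
    also have "\<dots> \<le> (1 - s / N) powr N" using q assms by (intro powr_mono') auto
    also have "\<dots> \<le> exp (- s / N) powr N"
      using q exp_ge_add_one_self[of "- s / N"] by (intro powr_mono2) auto
    also have "\<dots> = exp (-s)" by (simp add: powr_def N_def)
    finally have "norm (of_real (1 - s / N) powr (b + of_nat N - 1) :: complex) \<le> exp (-s)" .
    moreover have "norm (of_real s powr (a - 1) :: complex) = s powr (Re a - 1)"
      using s by (subst norm_powr_real_powr) auto
    ultimately show ?thesis using True
      unfolding f_def h_def N_def[symmetric] divide_inverse[of "s powr _"] exp_minus[symmetric]
      by (simp only: if_True norm_mult mult_left_mono powr_ge_zero)
  next
    case False
    thus ?thesis by (simp add: f_def h_def)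
  qed
  have lim: "(\<lambda>n. f (Suc n) s) \<longlonglongrightarrow> of_real s powr (a - 1) / of_real (exp s)" if s: "s \<in> {0<..}" for s
  proof (rule filterlim_compose[OF _ filterlim_Suc])
    have 1: "eventually (\<lambda>n. real n > s) sequentially" by real_asymp
    have 2: "(\<lambda>n. (1 + (-s) / real n) ^ n) \<longlonglongrightarrow> exp (-s)" by (rule tendsto_exp_limit_sequentially)
    have 3: "(\<lambda>n. of_real (1 - s / real n) powr (b - 1) :: complex) \<longlonglongrightarrow> of_real 1 powr (b - 1)"
    proof (intro tendsto_intros)
      have "(\<lambda>n. 1 - s / real n) \<longlonglongrightarrow> 1" by real_asymp
      thus "(\<lambda>n. 1 - s / real n) \<longlonglongrightarrow> 1" .
    qed auto
    have "(\<lambda>n. of_real s powr (a - 1) * (of_real (1 - s / real n) powr (b - 1) * of_real ((1 +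
        (-s) / real n) ^ n)) :: complex)
        \<longlonglongrightarrow> of_real s powr (a - 1) * (of_real 1 powr (b - 1) * of_real (exp (-s)))"
      by (intro tendsto_intros 2 3)
    also have "of_real s powr (a - 1) * (of_real 1 powr (b - 1) * of_real (exp (-s))) =
        (of_real s powr (a - 1) / of_real (exp s) :: complex)"
      by (simp add: exp_minus divide_inverse)
    finally show "(\<lambda>n. f n s) \<longlonglongrightarrow> of_real s powr (a - 1) / of_real (exp s)"
    proof (rule Lim_transform_eventually)
      show "\<forall>\<^sub>F n in sequentially. of_real s powr (a - 1) * (of_real (1 - s /
          real n) powr (b - 1) * of_real ((1 + (-s) / real n) ^ n)) = f n s"
        using 1
      proof eventually_elim
        case (elim n)
        define q where "q = 1 - s / real n"
        have q: "q > 0" using elim s by (auto simp: q_def field_simps)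
        have "complex_of_real q powr (b + of_nat n - 1) = of_real q powr ((b - 1) + of_nat n)"
            by (simp add: algebra_simps)
        also have "\<dots> = of_real q powr (b - 1) * of_real q ^ n"
          using q by (simp add: powr_add powr_nat)
        finally have "of_real q powr (b - 1) * of_real (q ^ n) = complex_of_real q powr (b +
            of_nat n - 1)" by simp
        moreover have "1 + (-s) / real n = q" by (simp add: q_def)
        ultimately show ?case using elim unfolding f_def q_def[symmetric] by simp
      qed
    qed
  qed
  have fi: "f (Suc n) integrable_on {0<..}" for n using f_int by blast
  have "(\<lambda>n. integral {0<..} (f (Suc n))) \<longlonglongrightarrow> integral {0<..} (\<lambda>s. of_real s powr (a - 1) /
      of_real (exp s))"
    by (rule dominated_convergence(2)[OF fi h_int dom lim])
  also have "integral {0<..} (\<lambda>s. of_real s powr (a - 1) / of_real (exp s)) = Gamma a"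
    by (rule integral_unique[OF Gamma_integral_complex']) (use assms in auto)
  also have "(\<lambda>n. integral {0<..} (f (Suc n))) = (\<lambda>n. J (Suc n))"
    using f_int by (auto simp: integral_unique)
  finally show ?thesis unfolding J_def by (rule LIMSEQ_imp_Suc)
qed

text \<open>Iterating the recurrence n times expresses the fixed integral by a ratio of Pochhammer
  symbols times the integral with b + n. The ratio is a quotient of the sequences
  \<open>Gamma_series'\<close> up to n^a, and that power is what the shifted integral needs to
  converge to Gamma(a). A last step of the recurrence extends the range from Re b > 1 to Re b >
  0.\<close>

lemma integral_beta_kernel:
  assumes "Re a > 0" "Re b > 0"
  shows "integral {0<..<1} (beta_kernel a b) = Beta a b"
proof -
  have *: "integral {0<..<1} (beta_kernel a b) = Beta a b" if "Re a > 0" "Re b > 1" for a b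
  proof -
    let ?I = "integral {0<..<1} (beta_kernel a b)"
    have nz: "Gamma (a + b) \<noteq> 0" "a + b \<notin> \<int>\<^sub>\<le>\<^sub>0" "b \<notin> \<int>\<^sub>\<le>\<^sub>0"
      using that by (auto simp: Gamma_eq_zero_iff intro!: Re_pos_not_nonpos_Ints dest!:
          Re_pos_not_nonpos_Ints[of "a + b", rotated])
    have "(\<lambda>n. Gamma_series' b n / Gamma_series' (a + b) n * (of_nat n powr a *
        integral {0<..<1} (beta_kernel a (b + of_nat n))))
        \<longlonglongrightarrow> Gamma b / Gamma (a + b) * Gamma a"
      using that nz by (intro tendsto_intros Gamma_series'_LIMSEQ tendsto_beta_kernel_integral) auto
    moreover have "eventually (\<lambda>n. Gamma_series' b n / Gamma_series' (a + b) n *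
        (of_nat n powr a * integral {0<..<1} (beta_kernel a (b + of_nat n))) = ?I) sequentially"
      using eventually_gt_at_top[of 0]
    proof eventually_elim
      case (elim n)
      have "pochhammer b n \<noteq> 0" "pochhammer (a + b) n \<noteq> 0" using nz
          by (auto simp: pochhammer_eq_0_iff)
      moreover have "(of_nat n :: complex) powr a = exp (a * of_real (ln (of_nat n)))"
        using elim by (simp add: powr_def Ln_of_nat)
      ultimately have "Gamma_series' b n / Gamma_series' (a + b) n * of_nat n powr a =
          pochhammer (a + b) n / pochhammer b n"
        by (simp add: Gamma_series'_def field_simps exp_add)
      thus ?case using integral_beta_kernel_plus_nat_right[of a b n] that
          by (simp only: mult.assoc[symmetric])
    qed
    ultimately have "(\<lambda>n. ?I) \<longlonglongrightarrow> Gamma b / Gamma (a + b) * Gamma a"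
      by (rule Lim_transform_eventually)
    hence "?I = Gamma b / Gamma (a + b) * Gamma a" by (simp add: tendsto_const_iff)
    thus ?thesis by (simp add: Beta_def)
  qed
  have "b \<noteq> 0" using assms by auto
  have "b \<notin> \<int>\<^sub>\<le>\<^sub>0" using assms by (intro Re_pos_not_nonpos_Ints)
  hence "(a + b) * Beta a (b + 1) = b * Beta a b" by (rule Beta_plus1_right)
  hence "Beta a b = (a + b) / b * Beta a (b + 1)" using \<open>b \<noteq> 0\<close> by (simp add: field_simps)
  also have "Beta a (b + 1) = integral {0<..<1} (beta_kernel a (b + 1))" using assms
      by (intro *[symmetric]) auto
  finally show ?thesis using integral_beta_kernel_plus1_right[OF assms] by simp
qed

lemma has_integral_beta_kernel:
  assumes "Re a > 0" "Re b > 0"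
  shows "(beta_kernel a b has_integral Beta a b) {0<..<1}"
  using absolutely_integrable_on_has_integral[OF beta_kernel_absolutely_integrable[OF assms]]
  by (simp add: integral_beta_kernel[OF assms])

section \<open>Termwise integration against an integrable kernel\<close>

lemma absolutely_integrable_bounded_continuous_mult:
  fixes f g :: "real \<Rightarrow> complex"
  assumes "open S" "continuous_on S f" "\<And>x. x \<in> S \<Longrightarrow> norm (f x) \<le> C" "g absolutely_integrable_on S"
  shows "(\<lambda>x. f x * g x) absolutely_integrable_on S"
proof (rule absolutely_integrable_bounded_measurable_product[of "(*)"])
  show "f \<in> borel_measurable (lebesgue_on S)"
    using assms(1,2) by (intro continuous_imp_measurable_on_sets_lebesgue) auto
  show "bounded (f ` S)" using assms(3) by (auto simp: bounded_iff)
qed (use assms in \<open>auto simp: bilinear_times\<close>)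

text \<open>Dominated convergence with the majorant (\<Sum> |b n|) |k|. It serves both the geometric
  series of the Stieltjes kernel and the cosine series in the Mehler-Dirichlet integral.\<close>

lemma power_series_integral:
  fixes b :: "nat \<Rightarrow> complex"
  assumes k: "k absolutely_integrable_on {0<..<1}" and b: "summable (\<lambda>n. norm (b n))"
  shows "(\<lambda>u. (\<Sum>n. b n * of_real u ^ n) * k u) absolutely_integrable_on {0<..<1}"
    and "(\<lambda>n. b n * integral {0<..<1} (\<lambda>u. of_real u ^ n * k u)) sums
      integral {0<..<1} (\<lambda>u. (\<Sum>n. b n * of_real u ^ n) * k u)"
proof -
  let ?f = "\<lambda>m u. (\<Sum>n<m. b n * (of_real u ^ n * k u))"
  let ?g = "\<lambda>u. (\<Sum>n. b n * of_real u ^ n) * k u"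
  have im: "(\<lambda>u. of_real u ^ n * k u) integrable_on {0<..<1}" for n
    by (intro set_lebesgue_integral_eq_integral(1)
        absolutely_integrable_bounded_continuous_mult[where C = 1] k continuous_intros)
      (auto simp: norm_power power_le_one)
  have f: "?f m integrable_on {0<..<1}" for m
    by (intro integrable_sum integrable_on_mult_right im) auto
  have h: "(\<lambda>u. (\<Sum>n. norm (b n)) * norm (k u)) integrable_on {0<..<1}"
    using k by (intro integrable_on_mult_right) (simp add: absolutely_integrable_on_def)
  have eq: "?f m u = (\<Sum>n<m. b n * of_real u ^ n) * k u" for m u
    unfolding sum_distrib_right by (simp add: mult_ac)
  have t: "norm (b n * of_real u ^ n) \<le> norm (b n)" if "u \<in> {0<..<1}" for n u
    using that mult_left_mono[of "u ^ n" 1 "norm (b n)"]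
        by (simp add: norm_mult norm_power power_le_one)
  have sm: "summable (\<lambda>n. b n * of_real u ^ n)" if "u \<in> {0<..<1}" for u
    using t[OF that] by (intro summable_comparison_test'[OF b]) auto
  have le: "norm (?f m u) \<le> (\<Sum>n. norm (b n)) * norm (k u)" if u: "u \<in> {0<..<1}" for m u
  proof -
    have "norm (\<Sum>n<m. b n * of_real u ^ n) \<le> (\<Sum>n<m. norm (b n))"
      using t[OF u] by (intro sum_norm_le) auto
    also have "\<dots> \<le> (\<Sum>n. norm (b n))" by (intro sum_le_suminf b) auto
    finally show ?thesis unfolding eq norm_mult by (intro mult_right_mono) auto
  qed
  have lim: "(\<lambda>m. ?f m u) \<longlonglongrightarrow> ?g u" if "u \<in> {0<..<1}" for u
    unfolding eq using summable_LIMSEQ[OF sm[OF that]] by (intro tendsto_intros)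
  note dc = dominated_convergence[OF f h le lim]
  have "norm (?g u) \<le> (\<Sum>n. norm (b n)) * norm (k u)" if "u \<in> {0<..<1}" for u
    using le[OF that] by (intro Lim_bounded[OF tendsto_norm[OF lim[OF that]], of 0]) auto
  from absolutely_integrable_integrable_bound[OF this dc(1) h]
  show "?g absolutely_integrable_on {0<..<1}" .
  have "integral {0<..<1} (?f m) = (\<Sum>n<m. b n * integral {0<..<1} (\<lambda>u. of_real u ^ n * k u))" for m
    by (subst integral_sum) (auto intro!: integrable_on_mult_right im)
  with dc(2) show "(\<lambda>n. b n * integral {0<..<1} (\<lambda>u. of_real u ^ n * k u)) sums
      integral {0<..<1} ?g"
    by (simp add: sums_def)
qed

section \<open>The binomial remainder as a Stieltjes transform\<close>

text \<open>The plane slit along [1, \<infinity>). It is star-shaped about 0 and is the common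
  domain of the principal power of 1 - z and of Stieltjes transforms of kernels on the unit
  interval.\<close>

definition cut_plane :: "complex set" where
  "cut_plane = {z. 1 - z \<notin> \<real>\<^sub>\<le>\<^sub>0}"

lemma open_cut_plane: "open cut_plane"
proof -
  have "cut_plane = (\<lambda>z. 1 - z) -` (- \<real>\<^sub>\<le>\<^sub>0)" by (auto simp: cut_plane_def)
  moreover have "open ((\<lambda>z::complex. 1 - z) -` (- \<real>\<^sub>\<le>\<^sub>0))"
    by (intro open_vimage continuous_intros open_Compl) auto
  ultimately show ?thesis by simp
qed

lemma cut_plane_scale:
  assumes "z \<in> cut_plane" "u \<in> {0..1}"
  shows "of_real u * z \<in> cut_plane" "1 - z * of_real u \<noteq> 0"
proof -
  show *: "of_real u * z \<in> cut_plane"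
  proof (rule ccontr)
    assume "of_real u * z \<notin> cut_plane"
    hence *: "u * Im z = 0" "u * Re z \<ge> 1" by (auto simp: cut_plane_def complex_nonpos_Reals_iff)
    hence "u \<noteq> 0" by auto
    hence "u * Re z \<le> 1 * Re z" using * assms
        by (intro mult_right_mono) (auto simp: zero_le_mult_iff dest: order_trans[OF zero_le_one])
    with * \<open>u \<noteq> 0\<close> have "z \<notin> cut_plane" by (auto simp: cut_plane_def complex_nonpos_Reals_iff)
    with assms show False by simp
  qed
  show "1 - z * of_real u \<noteq> 0"
  proof
    assume "1 - z * of_real u = 0"
    with * show False by (simp add: cut_plane_def mult.commute)
  qed
qed

lemma connected_cut_plane: "connected cut_plane"
proof (rule starlike_imp_connected)
  have "closed_segment 0 z \<subseteq> cut_plane" if "z \<in> cut_plane" for z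
    using cut_plane_scale(1)[OF that] by (auto simp: in_segment scaleR_conv_of_real)
  moreover have "0 \<in> cut_plane" by (auto simp: cut_plane_def complex_nonpos_Reals_iff)
  ultimately show "starlike cut_plane" unfolding starlike_def by blast
qed

text \<open>One constant serves as radius and as lower bound: half the minimum of |1 - z0 u| over
  [0, 1]. Moving z by less than c changes 1 - z u by less than c, since u \<le> 1.\<close>

lemma cut_plane_away:
  assumes "z0 \<in> cut_plane"
  obtains c where "c > 0" "\<And>z u. norm (z - z0) < c \<Longrightarrow> u \<in> {0..1} \<Longrightarrow> norm (1 - z * of_real u) \<ge> c"
proof -
  have "\<exists>x\<in>{0..1::real}. \<forall>y\<in>{0..1}. norm (1 - z0 * of_real x) \<le> norm (1 - z0 * of_real y)"
    by (intro continuous_attains_inf continuous_intros) auto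
  then obtain x where x: "x \<in> {0..1::real}" "\<And>y. y \<in> {0..1} \<Longrightarrow> norm (1 - z0 * of_real x) \<le>
      norm (1 - z0 * of_real y)"
    by blast
  define c where "c = norm (1 - z0 * of_real x) / 2"
  have "c > 0" using cut_plane_scale(2)[OF assms x(1)] by (simp add: c_def)
  moreover have "norm (1 - z * of_real u) \<ge> c" if "norm (z - z0) < c" "u \<in> {0..1}" for z u
  proof -
    have "norm ((z - z0) * of_real u) \<le> norm (z - z0) * 1"
      using that unfolding norm_mult by (intro mult_left_mono) auto
    moreover have "norm (1 - z0 * of_real u) \<le> norm (1 - z * of_real u) + norm ((z - z0) *
        of_real u)"
      using norm_triangle_ineq[of "1 - z * of_real u" "(z - z0) * of_real u"]
          by (simp add: algebra_simps)
    ultimately show ?thesis using that x(2)[OF that(2)] unfolding c_def by linarith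
  qed
  ultimately show ?thesis using that by blast
qed

section \<open>Stieltjes transforms on the unit interval\<close>

definition stieltjes :: "(real \<Rightarrow> complex) \<Rightarrow> complex \<Rightarrow> complex" where
  "stieltjes k z = integral {0<..<1} (\<lambda>u. 1 / (1 - z * of_real u) * k u)"

lemma stieltjes_absolutely_integrable:
  assumes "k absolutely_integrable_on {0<..<1}" "z \<in> cut_plane"
  shows "(\<lambda>u. 1 / (1 - z * of_real u) * k u) absolutely_integrable_on {0<..<1}"
proof -
  obtain c where c: "c > 0" "\<And>u. u \<in> {0..1} \<Longrightarrow> norm (1 - z * of_real u) \<ge> c"
    using cut_plane_away[OF assms(2)] by (metis diff_self norm_zero)
  show ?thesis
  proof (rule absolutely_integrable_bounded_continuous_mult[OF _ _ _ assms(1)])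
    show "continuous_on {0<..<1} (\<lambda>x. 1 / (1 - z * complex_of_real x))"
      using cut_plane_scale(2)[OF assms(2)] by (intro continuous_intros) auto
    show "norm (1 / (1 - z * complex_of_real x)) \<le> 1 / c" if "x \<in> {0<..<1}" for x
      using c(1) c(2)[of x] that unfolding norm_divide by (intro frac_le) auto
  qed auto
qed

lemma has_integral_norm_bound_has_integral:
  fixes f :: "real \<Rightarrow> complex"
  assumes "(f has_integral I) S" "(g has_integral J) S" "\<And>x. x \<in> S \<Longrightarrow> norm (f x) \<le> g x"
  shows "norm I \<le> J"
  using integral_norm_bound_integral[of f S g] assms by (auto simp: has_integral_iff)

text \<open>Differentiation under the integral with an explicit error: the difference quotient of
  the kernel minus its derivative is u^2 (z - z0) / (p p0^2), where p and p0 are the denominators at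
  z and z0. Both are at least c in norm, so the error is linear in |z - z0|.\<close>

lemma stieltjes_holomorphic:
  assumes k: "k absolutely_integrable_on {0<..<1}"
  shows "stieltjes k holomorphic_on cut_plane"
proof -
  have "stieltjes k field_differentiable (at z0)" if z0: "z0 \<in> cut_plane" for z0
  proof -
    obtain c where c: "c > 0" "\<And>z u. norm (z - z0) < c \<Longrightarrow> u \<in> {0..1} \<Longrightarrow> norm (1 - z * of_real u) \<ge> c"
      using cut_plane_away[OF z0] by metis
    have nz: "1 - z * of_real u \<noteq> 0" if "norm (z - z0) < c" "u \<in> {0<..<1}" for z u
      using c(1) c(2)[OF that(1), of u] that by auto
    \<comment> \<open>A real z \<ge> 1 would make 1 - z u vanish at u = 1/z in [0, 1], contradicting
      the lower bound c.\<close>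
    have cp: "z \<in> cut_plane" if "norm (z - z0) < c" for z
    proof (rule ccontr)
      assume "z \<notin> cut_plane"
      hence z: "Im z = 0" "Re z \<ge> 1" by (auto simp: cut_plane_def complex_nonpos_Reals_iff)
      hence "1 - z * of_real (1 / Re z) = 0" by (auto simp: complex_eq_iff)
      hence "norm (1 - z * of_real (1 / Re z)) = 0" by (simp only: norm_zero)
      moreover have "1 / Re z \<in> {0..1}" using z by auto
      ultimately show False using c(2)[OF that, of "1 / Re z"] c(1) by linarith
    qed
    define D where "D = integral {0<..<1} (\<lambda>u. of_real u / (1 - z0 * of_real u)\<^sup>2 * k u)"
    define K where "K = integral {0<..<1} (\<lambda>u. norm (k u))"
    have ik: "(\<lambda>u. norm (k u)) integrable_on {0<..<1}"
      using k by (simp add: absolutely_integrable_on_def)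
    have iD: "(\<lambda>u. of_real u / (1 - z0 * of_real u)\<^sup>2 * k u) integrable_on {0<..<1}"
    proof (intro set_lebesgue_integral_eq_integral(1)
        absolutely_integrable_bounded_continuous_mult[OF _ _ _ k])
      show "continuous_on {0<..<1} (\<lambda>x. complex_of_real x / (1 - z0 * complex_of_real x)\<^sup>2)"
        using nz[of z0] c(1) by (intro continuous_intros) auto
      show "norm (complex_of_real x / (1 - z0 * complex_of_real x)\<^sup>2) \<le> 1 / c\<^sup>2"
          if "x \<in> {0<..<1}" for x
        using c(1) c(2)[of z0 x] that unfolding norm_divide norm_power
        by (intro frac_le power_mono) auto
    qed auto
    have iS: "(\<lambda>u. 1 / (1 - z * of_real u) * k u) integrable_on {0<..<1}"
        if "norm (z - z0) < c" for z
      using stieltjes_absolutely_integrable[OF k cp[OF that]] set_lebesgue_integral_eq_integral(1)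
          by blast
    have bound: "norm ((stieltjes k z - stieltjes k z0) / (z - z0) - D) \<le> norm (z - z0) / c ^ 3 * K"
      if z: "norm (z - z0) < c" "z \<noteq> z0" for z
    proof -
      let ?q = "\<lambda>u. (1 / (1 - z * of_real u) * k u - 1 / (1 - z0 * of_real u) * k u) /
          (z - z0) - of_real u / (1 - z0 * of_real u)\<^sup>2 * k u"
      have q: "(?q has_integral (stieltjes k z - stieltjes k z0) / (z - z0) - D) {0<..<1}"
        unfolding D_def stieltjes_def using iS[OF z(1)] iS[of z0] iD c(1)
        by (intro has_integral_diff has_integral_divide integrable_integral) auto
      have h: "((\<lambda>u. norm (z - z0) / c ^ 3 * norm (k u)) has_integral (norm (z - z0) / c ^ 3 *
          K)) {0<..<1}"
        unfolding K_def using ik by (intro has_integral_mult_right integrable_integral)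
      have "norm (?q u) \<le> norm (z - z0) / c ^ 3 * norm (k u)" if u: "u \<in> {0<..<1}" for u
      proof -
        define p where "p = 1 - z * of_real u"
        define p0 where "p0 = 1 - z0 * of_real u"
        have p: "p \<noteq> 0" "p0 \<noteq> 0" "norm p \<ge> c" "norm p0 \<ge> c"
          unfolding p_def p0_def using nz[OF z(1) u] nz[OF _ u,
              of z0] c(1) c(2)[of z u] c(2)[of z0 u] u z by auto
        have d: "p0 - p = (z - z0) * of_real u" by (simp add: p_def p0_def algebra_simps)
        have "(1 / p * k u - 1 / p0 * k u) = (p0 - p) / (p * p0) * k u"
          using p by (simp add: field_simps)
        also have "\<dots> / (z - z0) = of_real u / (p * p0) * k u" using z unfolding d by simp
        finally have "?q u = of_real u / (p * p0) * k u - of_real u / p0\<^sup>2 * k u"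
          unfolding p_def[symmetric] p0_def[symmetric] by simp
        also have "\<dots> = (of_real u * (p0 - p)) / (p * p0\<^sup>2) * k u"
          using p by (simp add: field_simps power2_eq_square)
        finally have "norm (?q u) = (u\<^sup>2 * norm (z - z0)) / (norm p * norm p0 ^ 2) * norm (k u)"
          using u unfolding d by (simp add: norm_mult norm_divide norm_power power2_eq_square)
        also have "\<dots> \<le> (1 * norm (z - z0)) / (c * c ^ 2) * norm (k u)"
          using u p c(1) by (intro mult_right_mono frac_le mult_mono power_mono) (auto simp:
              power_le_one)
        finally show ?thesis by (simp add: power3_eq_cube power2_eq_square)
      qed
      from has_integral_norm_bound_has_integral[OF q h this] show ?thesis .
    qed
    have "(stieltjes k has_field_derivative D) (at z0)"
      unfolding has_field_derivative_iff
    proof (rule Lim_transform[OF tendsto_const], rule Lim_null_comparison)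
      show "\<forall>\<^sub>F z in at z0. norm ((stieltjes k z - stieltjes k z0) / (z - z0) - D) \<le>
          norm (z - z0) / c ^ 3 * K"
        unfolding eventually_at using bound c(1) by (intro exI[of _ c]) (auto simp: dist_norm)
      have "((\<lambda>z. norm (z - z0) / c ^ 3 * K) \<longlongrightarrow> norm (z0 - z0) / c ^ 3 * K) (at z0)"
        using c(1) by (intro tendsto_intros) auto
      thus "((\<lambda>z. norm (z - z0) / c ^ 3 * K) \<longlongrightarrow> 0) (at z0)" by simp
    qed
    thus ?thesis using field_differentiable_def by blast
  qed
  thus ?thesis using open_cut_plane by (simp add: holomorphic_on_open field_differentiable_def)
qed

lemma unit_ball_cut_plane: "norm z < 1 \<Longrightarrow> z \<in> cut_plane"
  using complex_Re_le_cmod[of z] by (auto simp: cut_plane_def complex_nonpos_Reals_iff)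

lemma stieltjes_sums:
  assumes k: "k absolutely_integrable_on {0<..<1}" and z: "norm z < 1"
  shows "(\<lambda>n. z ^ n * integral {0<..<1} (\<lambda>u. of_real u ^ n * k u)) sums stieltjes k z"
proof -
  have "(\<lambda>n. z ^ n * integral {0<..<1} (\<lambda>u. of_real u ^ n * k u)) sums
      integral {0<..<1} (\<lambda>u. (\<Sum>n. z ^ n * of_real u ^ n) * k u)"
    using z by (intro power_series_integral(2) k) (auto simp: norm_power intro!: summable_geometric)
  also have "integral {0<..<1} (\<lambda>u. (\<Sum>n. z ^ n * of_real u ^ n) * k u) = stieltjes k z"
    unfolding stieltjes_def
  proof (rule integral_cong)
    fix u :: real assume u: "u \<in> {0<..<1}"
    have "norm (z * of_real u) \<le> norm z"
      using u mult_left_mono[of u 1 "norm z"] by (simp add: norm_mult)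
    hence "(\<Sum>n. (z * of_real u) ^ n) = 1 / (1 - z * of_real u)"
      using z by (intro suminf_geometric) auto
    thus "(\<Sum>n. z ^ n * of_real u ^ n) * k u = 1 / (1 - z * of_real u) * k u"
      by (simp add: power_mult_distrib)
  qed
  finally show ?thesis .
qed

text \<open>The reflection formula for \<open>lam\<close> combined with the shift from Gamma(1 -
  lam) to Gamma(m + 1 - lam). Working with \<open>rGamma\<close> keeps it valid at integers
  \<open>lam\<close>, where both sides vanish.\<close>

lemma sin_Beta_pochhammer:
  fixes lam :: complex
  assumes "0 < Re lam" "Re lam < real m + 1"
  shows "sin (of_real pi * lam) / of_real pi * Beta (of_nat m + 1 - lam) lam =
      pochhammer (1 - lam) m / fact m"
proof -
  have np: "lam \<notin> \<int>\<^sub>\<le>\<^sub>0" "of_nat m + 1 - lam \<notin> \<int>\<^sub>\<le>\<^sub>0" using assms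
      by (auto intro!: Re_pos_not_nonpos_Ints)
  have "rGamma (1 - lam) = pochhammer (1 - lam) m * rGamma (of_nat m + 1 - lam)"
    using pochhammer_rGamma[of "1 - lam" m] by (simp add: algebra_simps)
  hence "sin (of_real pi * lam) / of_real pi = rGamma lam * pochhammer (1 - lam) m *
      rGamma (of_nat m + 1 - lam)"
    using rGamma_reflection_complex[of lam] by (simp add: mult.assoc)
  moreover have "Beta (of_nat m + 1 - lam) lam = Gamma (of_nat m + 1 - lam) * Gamma lam / fact m"
    using Gamma_fact[of m, where ?'a = complex] by (simp add: Beta_def add_ac)
  moreover have "Gamma lam * rGamma lam = 1" "Gamma (of_nat m + 1 - lam) * rGamma (of_nat m +
      1 - lam) = 1"
    using np by (auto simp: rGamma_inverse_Gamma Gamma_eq_zero_iff)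
  moreover have "rl * p * rm * (gm * gl / F) = p * (gl * rl) * (gm * rm) / F"
      for rl p rm gm gl F :: complex
    by simp
  ultimately show ?thesis by (simp only: mult_1_right)
qed

text \<open>In the unit disc the tail of the binomial series is compared with the expansion of the
  Stieltjes transform: multiplying the kernel by u^n shifts its first parameter, so each moment is a
  Beta value and equals a binomial coefficient by \<open>sin_Beta_pochhammer\<close>. Both sides are
  holomorphic on the connected slit plane, so the identity extends to all of it.\<close>

lemma binomial_remainder_stieltjes:
  fixes lam :: complex
  assumes lam: "0 < Re lam" "Re lam < real N + 1" and z: "z \<in> cut_plane"
  shows "(1 - z) powr (lam - 1) = (\<Sum>n<N. pochhammer (1 - lam) n / fact n * z ^ n) +
    z ^ N * (sin (of_real pi * lam) / of_real pi * stieltjes (beta_kernel (of_nat N +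
        1 - lam) lam) z)"
    (is "?L z = ?R z")
proof (rule analytic_continuation_open[of "ball 0 1" cut_plane ?L ?R])
  let ?k = "beta_kernel (of_nat N + 1 - lam) lam"
  have k: "?k absolutely_integrable_on {0<..<1}"
    using lam by (intro beta_kernel_absolutely_integrable) auto
  show "?R holomorphic_on cut_plane"
    by (intro holomorphic_intros stieltjes_holomorphic k)
  show "?L holomorphic_on cut_plane"
    by (intro holomorphic_intros) (auto simp: cut_plane_def)
  fix z :: complex assume "z \<in> ball 0 1"
  hence z: "norm z < 1" by simp
  let ?c = "\<lambda>n. pochhammer (1 - lam) n / fact n"
  have "(\<lambda>n. ((lam - 1) gchoose n) * (-z) ^ n) sums (1 + (-z)) powr (lam - 1)"
    using z by (intro gen_binomial_complex) auto
  moreover have "((lam - 1) gchoose n) * (-z) ^ n = ?c n * z ^ n" for n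
  proof -
    have "(-1) ^ n * (-z) ^ n = z ^ n" by (simp flip: power_mult_distrib)
    moreover have "((lam - 1) gchoose n) = (-1) ^ n * ?c n" by (simp add: gbinomial_pochhammer)
    ultimately show ?thesis by (metis mult.assoc mult.commute)
  qed
  ultimately have "(\<lambda>n. ?c n * z ^ n) sums ?L z" by simp
  from sums_split_initial_segment[OF this, of N]
  have 1: "(\<lambda>n. ?c (n + N) * z ^ (n + N)) sums (?L z - (\<Sum>n<N. ?c n * z ^ n))" .
  have "(\<lambda>n. z ^ N * (sin (of_real pi * lam) / of_real pi * (z ^ n *
      integral {0<..<1} (\<lambda>u. of_real u ^ n * ?k u)))) sums
     (z ^ N * (sin (of_real pi * lam) / of_real pi * stieltjes ?k z))"
    by (intro sums_mult stieltjes_sums k z)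
  moreover have "z ^ N * (sin (of_real pi * lam) / of_real pi * (z ^ n *
      integral {0<..<1} (\<lambda>u. of_real u ^ n * ?k u))) = ?c (n + N) * z ^ (n + N)" for n
  proof -
    have "integral {0<..<1} (\<lambda>u. of_real u ^ n * ?k u) =
        integral {0<..<1} (beta_kernel (of_nat (n + N) + 1 - lam) lam)"
      by (intro integral_cong) (simp add: beta_kernel_plus_nat_left[symmetric] algebra_simps)
    also have "integral {0<..<1} (beta_kernel (of_nat (n + N) + 1 - lam) lam) = Beta (of_nat (n +
        N) + 1 - lam) lam" using lam by (intro integral_beta_kernel) auto
    finally have "integral {0<..<1} (\<lambda>u. of_real u ^ n * ?k u) = Beta (of_nat (n + N) +
        1 - lam) lam" .
    moreover have "sin (of_real pi * lam) / of_real pi * Beta (of_nat (n + N) + 1 - lam) lam =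
        ?c (n + N)"
      using lam by (intro sin_Beta_pochhammer) auto
    moreover have "zN * (sp * (zn * B)) = sp * B * (zn * zN)" for zN sp zn B :: complex by simp
    ultimately show ?thesis by (simp only: power_add)
  qed
  ultimately have "(\<lambda>n. ?c (n + N) * z ^ (n + N)) sums (z ^ N * (sin (of_real pi * lam) /
      of_real pi * stieltjes ?k z))"
    by simp
  from sums_unique2[OF 1 this] show "?L z = ?R z" by (simp add: algebra_simps)
qed (use z open_cut_plane connected_cut_plane unit_ball_cut_plane in auto)

section \<open>The cosine as a hypergeometric series\<close>

text \<open>Taylor coefficients of the Gauss function F(1/2 + \<mu>, 1/2 - \<mu>; 1/2; x).\<close>

definition cos_coeff_half :: "complex \<Rightarrow> nat \<Rightarrow> complex" where
  "cos_coeff_half \<mu> n = pochhammer (1/2 + \<mu>) n * pochhammer (1/2 - \<mu>) n / (pochhammer (1/2) n *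
      fact n)"

lemma pochhammer_half_nonzero: "pochhammer (1/2 :: complex) n \<noteq> 0"
proof
  assume "pochhammer (1/2 :: complex) n = 0"
  then obtain k where "(1/2 :: complex) = - of_nat k" by (auto simp: pochhammer_eq_0_iff)
  hence "Re (1/2 :: complex) = Re (- of_nat k)" by (rule arg_cong)
  thus False by simp
qed

lemma cos_coeff_half_Suc:
  "(of_nat n + 1) * (of_nat n + 1/2) * cos_coeff_half \<mu> (Suc n) = ((of_nat n + 1/2)\<^sup>2 - \<mu>\<^sup>2) *
      cos_coeff_half \<mu> n"
proof -
  have nz: "(of_nat n + 1 :: complex) \<noteq> 0" "(of_nat n + 1 / 2 :: complex) \<noteq> 0"
      by (auto simp: complex_eq_iff)
  have "cos_coeff_half \<mu> (Suc n) = cos_coeff_half \<mu> n * ((1/2 + \<mu> + of_nat n) * (1/2 - \<mu> +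
      of_nat n) / ((of_nat n + 1/2) * (of_nat n + 1)))"
    unfolding cos_coeff_half_def pochhammer_Suc fact_Suc times_divide_times_eq
    by (intro arg_cong2[where f = "(/)"]) (simp_all add: algebra_simps)
  moreover have "(1/2 + \<mu> + of_nat n) * (1/2 - \<mu> + of_nat n) = (of_nat n + 1/2)\<^sup>2 - \<mu>\<^sup>2"
    by (simp add: power2_eq_square algebra_simps)
  ultimately show ?thesis using nz by simp
qed

lemma cos_coeff_half_summable:
  assumes x: "norm x < 1"
  shows "summable (\<lambda>n. cos_coeff_half \<mu> n * x ^ n)"
proof -
  obtain r where r: "norm x < r" "r < 1" using dense[OF x] by blast
  define K where "K = (norm \<mu>)\<^sup>2"
  have "(\<lambda>n. ((real n + 1/2)\<^sup>2 + K) / ((real n + 1) * (real n + 1/2)) * norm x) \<longlonglongrightarrow> 1 * norm x"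
    by (intro tendsto_intros) real_asymp
  hence "eventually (\<lambda>n. ((real n + 1/2)\<^sup>2 + K) / ((real n + 1) * (real n + 1/2)) *
      norm x < r) sequentially"
    using r by (intro order_tendstoD) auto
  then obtain N where N: "\<And>n. n \<ge> N \<Longrightarrow> ((real n + 1/2)\<^sup>2 + K) / ((real n + 1) * (real n + 1/2)) *
      norm x < r"
    by (auto simp: eventually_at_top_linorder)
  show ?thesis
  proof (rule summable_ratio_test[OF r(2)])
    fix n assume n: "n \<ge> N"
    let ?c = "\<lambda>n. cos_coeff_half \<mu> n"
    have q: "(real n + 1) * (real n + 1/2) > 0" by simp
    have rn: "norm (of_nat n + 1 :: complex) = real n + 1" "norm (of_nat n + 1/2 :: complex) =
        real n + 1/2"
    proof -
      have "(of_nat n + 1 :: complex) = of_real (real n + 1)" "(of_nat n + 1/2 :: complex) =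
          of_real (real n + 1/2)" by simp_all
      thus "norm (of_nat n + 1 :: complex) = real n + 1" "norm (of_nat n + 1/2 :: complex) =
          real n + 1/2"
        by (simp_all only: norm_of_real)
    qed
    have "(real n + 1) * (real n + 1/2) * norm (?c (Suc n)) = norm ((of_nat n + 1/2)\<^sup>2 - \<mu>\<^sup>2) *
        norm (?c n)"
      using arg_cong[OF cos_coeff_half_Suc[of n \<mu>], of norm] by (simp only: norm_mult rn)
    also have "norm ((of_nat n + 1/2)\<^sup>2 - \<mu>\<^sup>2) \<le> (real n + 1/2)\<^sup>2 + K"
      using norm_triangle_ineq4[of "(of_nat n + 1/2)\<^sup>2" "\<mu>\<^sup>2"] by (simp only: norm_power rn K_def)
    finally have "(real n + 1) * (real n + 1/2) * norm (?c (Suc n)) \<le> ((real n + 1/2)\<^sup>2 + K) *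
        norm (?c n)"
      by (simp add: mult_right_mono)
    hence "norm (?c (Suc n)) \<le> ((real n + 1/2)\<^sup>2 + K) / ((real n + 1) * (real n + 1/2)) *
        norm (?c n)"
      using q by (simp add: pos_le_divide_eq mult_ac)
    from mult_right_mono[OF this norm_ge_zero[of x]] have "norm (?c (Suc n)) * norm x \<le>
        (((real n + 1/2)\<^sup>2 + K) / ((real n + 1) * (real n + 1/2)) * norm x) * norm (?c n)"
      by (simp only: mult.assoc mult.commute[of "norm (?c n)"])
    also have "\<dots> \<le> r * norm (?c n)" using N[OF n] by (intro mult_right_mono) auto
    finally have "norm (?c (Suc n)) * norm x \<le> r * norm (?c n)" .
    from mult_right_mono[OF this, of "norm x ^ n"]
    show "norm (?c (Suc n) * x ^ Suc n) \<le> r * norm (?c n * x ^ n)"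
      by (simp add: norm_mult norm_power mult_ac)
  qed
qed

text \<open>The hypergeometric equation with c = 1/2, a + b + 1 = 2 and ab = 1/4 - \<mu>^2. The
  \<mu>-term stands alone on the right so that the equation turns directly into Y'' = -\<mu>^2 Y
  under x = sin^2(t/2).\<close>

lemma cos_half_series_ode:
  fixes \<mu> :: complex
  defines "P \<equiv> \<lambda>x. \<Sum>n. cos_coeff_half \<mu> n * x ^ n"
  obtains D1 D2 where "\<And>x. norm x < 1 \<Longrightarrow> (P has_field_derivative D1 x) (at x)"
    "\<And>x. norm x < 1 \<Longrightarrow> (D1 has_field_derivative D2 x) (at x)"
    "\<And>x. norm x < 1 \<Longrightarrow> x * (1 - x) * D2 x + (1/2 - 2 * x) * D1 x - P x / 4 = - \<mu>\<^sup>2 * P x"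
proof -
  let ?c = "cos_coeff_half \<mu>"
  define D1 where "D1 = (\<lambda>x. \<Sum>n. diffs ?c n * x ^ n)"
  define D2 where "D2 = (\<lambda>x. \<Sum>n. diffs (diffs ?c) n * x ^ n)"
  note sm = cos_coeff_half_summable[of _ \<mu>]
  have sm1: "summable (\<lambda>n. diffs ?c n * x ^ n)" if "norm x < 1" for x
    by (rule termdiff_converges[OF that sm])
  have sm2: "summable (\<lambda>n. diffs (diffs ?c) n * x ^ n)" if "norm x < 1" for x
    by (rule termdiff_converges[OF that sm1])
  have d1: "(P has_field_derivative D1 x) (at x)" if "norm x < 1" for x
    unfolding P_def D1_def by (rule termdiffs_strong'[OF sm that])
  have d2: "(D1 has_field_derivative D2 x) (at x)" if "norm x < 1" for x
    unfolding D1_def D2_def by (rule termdiffs_strong'[OF sm1 that])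
  have "x * (1 - x) * D2 x + (1/2 - 2 * x) * D1 x - P x / 4 = - \<mu>\<^sup>2 * P x" if x: "norm x < 1" for x
  proof -
    have s0: "(\<lambda>n. ?c n * x ^ n) sums P x" unfolding P_def using sm[OF x] by (rule summable_sums)
    have s1: "(\<lambda>n. (of_nat n + 1) * ?c (Suc n) * x ^ n) sums D1 x"
      unfolding D1_def using summable_sums[OF sm1[OF x]] by (simp add: diffs_def add_ac)
    have s2: "(\<lambda>n. (of_nat n + 1) * (of_nat n + 2) * ?c (n + 2) * x ^ n) sums D2 x"
      unfolding D2_def using summable_sums[OF sm2[OF x]] by (simp add: diffs_def add_ac mult_ac)
    have s3: "(\<lambda>n. of_nat n * ?c n * x ^ n) sums (x * D1 x)"
      using sums_mult[OF s1, of x] sums_Suc_iff[of "\<lambda>n. of_nat n * ?c n * x ^ n"]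
          by (simp add: mult_ac add_ac)
    have s4: "(\<lambda>n. of_nat n * (of_nat n + 1) * ?c (Suc n) * x ^ n) sums (x * D2 x)"
      using sums_mult[OF s2, of x] sums_Suc_iff[of "\<lambda>n. of_nat n * (of_nat n + 1) * ?c (Suc n) *
          x ^ n"] by (simp add: mult_ac add_ac)
    have s5: "(\<lambda>n. of_nat n * (of_nat n - 1) * ?c n * x ^ n) sums (x * (x * D2 x))"
      using sums_mult[OF s4, of x] sums_Suc_iff[of "\<lambda>n. of_nat n * (of_nat n - 1) * ?c n * x ^ n"]
          by (simp add: mult_ac add_ac)
    \<comment> \<open>The terms of the equation are split into two groups by the index shift. Both
      have the coefficients ((n + 1/2)^2 - \<mu>^2) c_n: this group by the recurrence, the other one
      by expanding the square.\<close>
    have "(\<lambda>n. of_nat n * (of_nat n + 1) * ?c (Suc n) * x ^ n + 1/2 * ((of_nat n + 1) *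
        ?c (Suc n) * x ^ n)) sums (x * D2 x + 1/2 * D1 x)"
      by (intro sums_add sums_mult s1 s4)
    moreover have "of_nat n * (of_nat n + 1) * ?c (Suc n) * x ^ n + 1/2 * ((of_nat n + 1) *
        ?c (Suc n) * x ^ n) =
       ((of_nat n + 1/2)\<^sup>2 - \<mu>\<^sup>2) * ?c n * x ^ n" for n
      unfolding cos_coeff_half_Suc[symmetric] by (simp add: field_simps)
    ultimately have a: "(\<lambda>n. ((of_nat n + 1/2)\<^sup>2 - \<mu>\<^sup>2) * ?c n * x ^ n) sums (x * D2 x + 1/2 *
        D1 x)" by simp
    have "(\<lambda>n. of_nat n * (of_nat n - 1) * ?c n * x ^ n + 2 * (of_nat n * ?c n * x ^ n) +
        (1/4 - \<mu>\<^sup>2) * (?c n * x ^ n)) sums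
       (x * (x * D2 x) + 2 * (x * D1 x) + (1/4 - \<mu>\<^sup>2) * P x)"
      by (intro sums_add sums_mult s5 s3 s0)
    moreover have "of_nat n * (of_nat n - 1) * ?c n * x ^ n + 2 * (of_nat n * ?c n * x ^ n) +
        (1/4 - \<mu>\<^sup>2) * (?c n * x ^ n) =
       ((of_nat n + 1/2)\<^sup>2 - \<mu>\<^sup>2) * ?c n * x ^ n" for n
      by (simp add: algebra_simps power2_eq_square)
    ultimately have b: "(\<lambda>n. ((of_nat n + 1/2)\<^sup>2 - \<mu>\<^sup>2) * ?c n * x ^ n) sums (x * (x * D2 x) + 2 *
        (x * D1 x) + (1/4 - \<mu>\<^sup>2) * P x)" by simp
    show ?thesis using sums_unique2[OF a b] by (simp add: algebra_simps)
  qed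
  with d1 d2 that show ?thesis by blast
qed

text \<open>The right-hand side \<open>Y\<close> solves \<open>Y'' = - \<mu>\<^sup>2 Y\<close> with the initial values of the cosine. Comparing first
  \<open>Y' + i \<mu> Y\<close> and then \<open>Y\<close> itself also covers the degenerate case \<open>\<mu> = 0\<close>.\<close>

lemma cos_mult_half_series:
  fixes \<mu> :: complex and \<phi> :: real
  assumes \<phi>: "\<bar>\<phi>\<bar> < pi"
  shows "cos (\<mu> * of_real \<phi>) = of_real (cos (\<phi> / 2)) * (\<Sum>n. cos_coeff_half \<mu> n *
      (of_real (sin (\<phi> / 2) ^ 2)) ^ n)"
proof -
  define P where "P = (\<lambda>x. \<Sum>n. cos_coeff_half \<mu> n * x ^ n)"
  obtain D1 D2 where D: "\<And>x. norm x < 1 \<Longrightarrow> (P has_field_derivative D1 x) (at x)"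
    "\<And>x. norm x < 1 \<Longrightarrow> (D1 has_field_derivative D2 x) (at x)"
    "\<And>x. norm x < 1 \<Longrightarrow> x * (1 - x) * D2 x + (1/2 - 2 * x) * D1 x - P x / 4 = - \<mu>\<^sup>2 * P x"
    using cos_half_series_ode[of \<mu>] unfolding P_def by auto
  define Y where "Y = (\<lambda>t. cos (t / 2) * P (sin (t / 2) ^ 2))"
  define Y1 where "Y1 = (\<lambda>t. - 1/2 * sin (t / 2) * P (sin (t / 2) ^ 2) + sin (t / 2) * cos (t /
      2) ^ 2 * D1 (sin (t / 2) ^ 2))"
  have dY: "(Y has_field_derivative Y1 t) (at t)" if "norm (sin (t / 2) ^ 2) < 1" for t
    unfolding Y_def Y1_def
    by (rule derivative_eq_intros DERIV_chain2[where f = P and g = "\<lambda>t. sin (t / 2) ^ 2",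
        OF D(1)[OF that]] refl | simp)+
      (simp add: power2_eq_square field_simps)
  have dY1: "(Y1 has_field_derivative (- \<mu>\<^sup>2 * Y t)) (at t)" if "norm (sin (t / 2) ^ 2) < 1" for t
  proof -
    define s where "s = sin (t / 2)"
    define c where "c = cos (t / 2)"
    have sc: "c ^ 2 = 1 - s ^ 2" using sin_cos_squared_add[of "t / 2"]
        by (simp add: s_def c_def algebra_simps)
    have "(Y1 has_field_derivative (- 1/4 * c * P (s ^ 2) - 1/2 * s * (D1 (s ^ 2) * (s * c)) + 
        (1/2 * c ^ 3 - s * s * c) * D1 (s ^ 2) + s * c ^ 2 * (D2 (s ^ 2) * (s * c)))) (at t)"
      unfolding Y1_def s_def c_def
      by (rule derivative_eq_intros DERIV_chain2[where f = P and g = "\<lambda>t. sin (t / 2) ^ 2",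
          OF D(1)[OF that]] DERIV_chain2[where f = D1 and g = "\<lambda>t. sin (t / 2) ^ 2",
          OF D(2)[OF that]] refl | simp)+
        (simp add: power2_eq_square power3_eq_cube field_simps)
    also have "- 1/4 * c * P (s ^ 2) - 1/2 * s * (D1 (s ^ 2) * (s * c)) + 
        (1/2 * c ^ 3 - s * s * c) * D1 (s ^ 2) + s * c ^ 2 * (D2 (s ^ 2) * (s * c)) =
        c * (s ^ 2 * c ^ 2 * D2 (s ^ 2) + (1/2 * c ^ 2 - 3/2 * s ^ 2) * D1 (s ^ 2) - P (s ^ 2) / 4)"
      by (simp add: power2_eq_square power3_eq_cube algebra_simps)
    also have "\<dots> = c * (s ^ 2 * (1 - s ^ 2) * D2 (s ^ 2) + (1/2 - 2 * s ^ 2) *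
        D1 (s ^ 2) - P (s ^ 2) / 4)"
      unfolding sc by (simp add: algebra_simps)
    also have "\<dots> = - \<mu>\<^sup>2 * Y t"
      using D(3)[of "s ^ 2"] that by (simp add: Y_def s_def c_def)
    finally show ?thesis .
  qed
  have nm: "norm (sin (of_real t / 2 :: complex) ^ 2) < 1" if "t \<in> {-pi<..<pi}" for t :: real
  proof -
    have "cos (t / 2) > 0" using that by (intro cos_gt_zero_pi) auto
    hence "sin (t / 2) ^ 2 < 1" using sin_cos_squared_add[of "t / 2"]
        by (smt (verit) zero_less_power)
    moreover have "sin (of_real t / 2 :: complex) = of_real (sin (t / 2))"
        by (simp flip: sin_of_real)
    ultimately show ?thesis by (simp add: norm_power)
  qed
  have Pz: "P 0 = 1" unfolding P_def by (subst suminf_finite[of "{0}"]) (auto simp: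
      cos_coeff_half_def)
  have const: "f (of_real t) = f 0" if "\<And>t. t \<in> {-pi<..<pi} \<Longrightarrow> (f has_field_derivative 0) (at
      (of_real t))" "t \<in> {-pi<..<pi}"
    for f :: "complex \<Rightarrow> complex" and t :: real
  proof -
    have "((\<lambda>t. f (of_real t)) has_vector_derivative 0) (at x within {-pi<..<pi})"
        if "x \<in> {-pi<..<pi}" for x
      using that \<open>\<And>t. t \<in> {-pi<..<pi} \<Longrightarrow> (f has_field_derivative 0) (at (of_real t))\<close>
      by (intro has_vector_derivative_real_field) auto
    then obtain K where K: "\<And>x. x \<in> {-pi<..<pi} \<Longrightarrow> f (of_real x) = K"
      using has_vector_derivative_zero_constant[of "{-pi<..<pi}" "\<lambda>t. f (of_real t)"] by auto
    show ?thesis using K[of t] K[of 0] that(2) by simp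
  qed
  have e1: "(Y1 (of_real t) + \<i> * \<mu> * Y (of_real t)) * exp (- (\<i> * \<mu> * of_real t)) = \<i> * \<mu>"
      if "t \<in> {-pi<..<pi}" for t
  proof -
    have "((\<lambda>z. (Y1 z + \<i> * \<mu> * Y z) * exp (- (\<i> * \<mu> * z))) has_field_derivative 0) (at (of_real
        t))" if "t \<in> {-pi<..<pi}" for t
      by (rule derivative_eq_intros dY1[OF nm[OF that]] dY[OF nm[OF that]] refl | simp)+
         (simp add: algebra_simps power2_eq_square)
    from const[OF this that] show ?thesis by (simp add: Y1_def Y_def Pz)
  qed
  have e1': "Y1 (of_real t) + \<i> * \<mu> * Y (of_real t) = \<i> * \<mu> * exp (\<i> * \<mu> * of_real t)"
      if "t \<in> {-pi<..<pi}" for t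
    using e1[OF that] by (simp add: exp_minus field_simps)
  \<comment> \<open>The cosine satisfies the same first-order equation y' + i \<mu> y = i \<mu>
    exp(i \<mu> t) as Y does by \<open>e1'\<close>, and exp(i \<mu> t) is its integrating factor. So
    the weighted difference is constant, and it is zero at t = 0.\<close>
  have "(Y (of_real t) - cos (\<mu> * of_real t)) * exp (\<i> * \<mu> * of_real t) = 0"
      if "t \<in> {-pi<..<pi}" for t
  proof -
    have "((\<lambda>z. (Y z - cos (\<mu> * z)) * exp (\<i> * \<mu> * z)) has_field_derivative 0) (at (of_real t))"
        if "t \<in> {-pi<..<pi}" for t
    proof -
      have "((\<lambda>z. (Y z - cos (\<mu> * z)) * exp (\<i> * \<mu> * z)) has_field_derivative
         ((Y1 (of_real t) + \<i> * \<mu> * Y (of_real t)) + \<mu> * sin (\<mu> * of_real t) - \<i> * \<mu> * cos (\<mu> *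
             of_real t)) * exp (\<i> * \<mu> * of_real t)) (at (of_real t))"
        by (rule derivative_eq_intros dY[OF nm[OF that]] refl | simp)+ (simp add: algebra_simps)
      moreover have "exp (\<i> * \<mu> * of_real t) = cos (\<mu> * of_real t) + \<i> * sin (\<mu> * of_real t)"
        using exp_Euler[of "\<mu> * of_real t"] by (simp add: mult.assoc)
      ultimately show ?thesis unfolding e1'[OF that] by (simp add: algebra_simps)
    qed
    from const[OF this that] show ?thesis by (simp add: Y1_def Y_def Pz)
  qed
  from this[of \<phi>] \<phi> abs_less_iff[of \<phi> pi] have "Y (of_real \<phi>) = cos (\<mu> * of_real \<phi>)" by auto
  thus ?thesis unfolding Y_def P_def by (simp flip: sin_of_real cos_of_real)
qed

section \<open>The Mehler--Dirichlet integral\<close>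

text \<open>Integration against the beta kernel trades the lower parameter 1/2 for 1/2 + lam:
  Gamma(1/2 + n) cancels the symbol \<open>pochhammer (1/2) n\<close> up to sqrt pi, and the
  reciprocal Gamma factor of the regularised series takes its place.\<close>

lemma cos_coeff_half_Beta:
  assumes "Re lam > 0"
  shows "cos_coeff_half \<mu> n * Beta (1/2 + of_nat n) lam = 
    of_real (sqrt pi) * Gamma lam * (pochhammer (\<mu> + 1/2) n * pochhammer (1/2 - \<mu>) n *
        rGamma (1/2 + lam + of_nat n) / fact n)"
proof -
  have "pochhammer (1/2 :: complex) n = Gamma (1/2 + of_nat n) / Gamma (1/2)"
    by (rule pochhammer_Gamma) (auto intro!: Re_pos_not_nonpos_Ints)
  moreover have "Gamma (1/2 :: complex) = of_real (sqrt pi)"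
    using Gamma_one_half_complex by simp
  ultimately have "Gamma (1/2 + of_nat n) = pochhammer (1/2) n * complex_of_real (sqrt pi)"
    by simp
  hence "Beta (1/2 + of_nat n) lam = pochhammer (1/2) n * complex_of_real (sqrt pi) * Gamma lam *
      rGamma (1/2 + lam + of_nat n)"
    by (simp add: Beta_altdef add_ac)
  thus ?thesis using pochhammer_half_nonzero[of n] by (simp add: cos_coeff_half_def add_ac)
qed

text \<open>The substitution u = sin^2(\<phi>/2) / S maps (0, \<zeta>) onto (0, 1) and gives 2 cos
  \<phi> - 2 cos \<zeta> = 4 S (1 - u). The factor cos(\<phi>/2) in front of the cosine series is
  absorbed by the Jacobian, so a power series in S u is integrated against the kernel with
  parameters 1/2 and \<open>lam\<close>.\<close>

lemma mehler_dirichlet: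
  fixes \<mu> lam :: complex and \<zeta> :: real
  assumes z: "0 < \<zeta>" "\<zeta> < pi" and lam: "Re lam > 0"
  defines "S \<equiv> sin (\<zeta> / 2) ^ 2"
  defines "F \<equiv> \<lambda>\<phi>. cos (\<mu> * of_real \<phi>) * of_real (2 * cos \<phi> - 2 * cos \<zeta>) powr (lam - 1)"
  shows "F absolutely_integrable_on {0<..<\<zeta>}"
    and "integral {0<..<\<zeta>} F = of_real (4 * S) powr (lam - 1) * of_real (sqrt S) *
      (of_real (sqrt pi) * Gamma lam * hypergeo_reg (\<mu> + 1/2) (1/2 - \<mu>) (1/2 + lam) (of_real S))"
proof -
  define b where "b = (\<lambda>n. cos_coeff_half \<mu> n * of_real S ^ n)"
  define f where "f = (\<lambda>u. (\<Sum>n. b n * of_real u ^ n) * beta_kernel (1/2) lam u)"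
  have sin_pos: "sin (\<phi> / 2) > 0" if "\<phi> \<in> {0<..\<zeta>}" for \<phi> using that z by (intro sin_gt_zero) auto
  have cos_pos: "cos (\<phi> / 2) > 0" if "\<phi> \<in> {0..\<zeta>}" for \<phi> using that z by (intro cos_gt_zero_pi) auto
  have S: "S > 0" "S < 1"
  proof -
    show "S > 0" unfolding S_def using sin_pos[of \<zeta>] z by (intro zero_less_power) auto
    have "cos (\<zeta> / 2) ^ 2 > 0" using cos_pos[of \<zeta>] z by (intro zero_less_power) auto
    thus "S < 1" unfolding S_def using sin_cos_squared_add[of "\<zeta> / 2"] by linarith
  qed
  \<comment> \<open>Convergence of the cosine series at a larger point r < 1 yields absolute
    convergence at S.\<close>
  obtain r where r: "S < r" "r < 1" using dense[OF S(2)] by blast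
  have "summable (\<lambda>n. norm (b n))"
    unfolding b_def
    by (rule powser_insidea[of "cos_coeff_half \<mu>" "of_real r"])
      (use cos_coeff_half_summable[of "of_real r" \<mu>] r S in auto)
  note ps = power_series_integral[OF beta_kernel_absolutely_integrable[of "1/2" lam] this]
  have f_ai: "f absolutely_integrable_on {0<..<1}" unfolding f_def using lam by (intro ps(1)) auto
  have "(\<lambda>n. b n * integral {0<..<1} (\<lambda>u. of_real u ^ n * beta_kernel (1/2) lam u)) sums
      integral {0<..<1} f"
    unfolding f_def using lam by (intro ps(2)) auto
  moreover have "integral {0<..<1} (\<lambda>u. of_real u ^ n * beta_kernel (1/2) lam u) = Beta (1/2 +
      of_nat n) lam" for n
  proof -
    have "integral {0<..<1} (\<lambda>u. of_real u ^ n * beta_kernel (1/2) lam u) =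
        integral {0<..<1} (beta_kernel (1/2 + of_nat n) lam)"
      by (intro integral_cong) (simp add: beta_kernel_plus_nat_left)
    also have "\<dots> = Beta (1/2 + of_nat n) lam" using lam by (intro integral_beta_kernel) auto
    finally show ?thesis .
  qed
  ultimately have "(\<lambda>n. b n * Beta (1/2 + of_nat n) lam) sums integral {0<..<1} f" by simp
  moreover have "b n * Beta (1/2 + of_nat n) lam = of_real (sqrt pi) * Gamma lam * 
     (pochhammer (\<mu> + 1/2) n * pochhammer (1/2 - \<mu>) n * rGamma (1/2 + lam + of_nat n) / fact n *
         of_real S ^ n)" for n
    using arg_cong[OF cos_coeff_half_Beta[OF lam, of \<mu> n], of "\<lambda>x. x * of_real S ^ n"]
        unfolding b_def by (simp add: mult_ac)
  ultimately have sums: "(\<lambda>n. of_real (sqrt pi) * Gamma lam * 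
     (pochhammer (\<mu> + 1/2) n * pochhammer (1/2 - \<mu>) n * rGamma (1/2 + lam + of_nat n) / fact n *
         of_real S ^ n)) sums integral {0<..<1} f"
    by simp
  have "Gamma lam \<noteq> 0" using Re_pos_not_nonpos_Ints[OF lam] by (simp add: Gamma_eq_zero_iff)
  hence nz: "of_real (sqrt pi) * Gamma lam \<noteq> 0" by simp
  have f_int: "integral {0<..<1} f = of_real (sqrt pi) * Gamma lam * hypergeo_reg (\<mu> +
      1/2) (1/2 - \<mu>) (1/2 + lam) (of_real S)"
    unfolding sums_unique[OF sums] hypergeo_reg_def
    by (rule suminf_mult) (use sums_summable[OF sums] nz in \<open>simp only: summable_cmult_iff, simp\<close>)
  define g where "g = (\<lambda>\<phi>. sin (\<phi> / 2) ^ 2 / S)"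
  define h where "h = (\<lambda>\<phi>. sin (\<phi> / 2) * cos (\<phi> / 2) / S)"
  have der: "(g has_field_derivative h \<phi>) (at \<phi> within {0<..<\<zeta>})" for \<phi>
    unfolding g_def h_def using S by (auto intro!: derivative_eq_intros simp: field_simps)
  have gmono: "sin (x / 2) < sin (y / 2)" if "0 \<le> x" "x < y" "y \<le> \<zeta>" for x y
    using that z by (intro sin_monotone_2pi) auto
  have g_mono: "g x < g y" if "0 \<le> x" "x < y" "y \<le> \<zeta>" for x y
    unfolding g_def using S gmono[OF that] sin_ge_zero[of "x / 2"] that z
    by (intro divide_strict_right_mono power_strict_mono) auto
  have inj: "inj_on g {0<..<\<zeta>}"
    by (rule linorder_inj_onI') (metis g_mono greaterThanLessThan_iff less_le order_less_irrefl)
  have img: "g ` {0<..<\<zeta>} = {0<..<1}"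
  proof (intro equalityI subsetI)
    fix y assume "y \<in> g ` {0<..<\<zeta>}"
    then obtain x where x: "0 < x" "x < \<zeta>" "y = g x" by auto
    have "g 0 = 0" "g \<zeta> = 1" using S by (auto simp: g_def S_def)
    with g_mono[of 0 x] g_mono[of x \<zeta>] x show "y \<in> {0<..<1}" by auto
  next
    fix y :: real assume y: "y \<in> {0<..<1}"
    have g0: "g 0 = 0" "g \<zeta> = 1" using S by (auto simp: g_def S_def)
    have "continuous_on {0..\<zeta>} g" unfolding g_def using S by (intro continuous_intros) auto
    then obtain x where "0 \<le> x" "x \<le> \<zeta>" "g x = y" using IVT'[of g 0 y \<zeta>] g0 y z by auto
    moreover from this have "x \<noteq> 0" "x \<noteq> \<zeta>" using g0 y by auto
    ultimately show "y \<in> g ` {0<..<\<zeta>}" by auto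
  qed
  have cov: "(\<lambda>x. \<bar>h x\<bar> *\<^sub>R f (g x)) absolutely_integrable_on {0<..<\<zeta>} \<and>
     integral {0<..<\<zeta>} (\<lambda>x. \<bar>h x\<bar> *\<^sub>R f (g x)) = integral {0<..<1} f"
    by (subst has_absolute_integral_change_of_variables_real[OF _ der inj]) (auto simp: img f_ai)
  \<comment> \<open>The constant left by the substitution: the first factor comes from the power of
    4 S (1 - u), the root of S from u^(-1/2) together with the Jacobian.\<close>
  define K where "K = complex_of_real (4 * S) powr (lam - 1) * of_real (sqrt S)"
  have F_eq: "F \<phi> = K * (\<bar>h \<phi>\<bar> *\<^sub>R f (g \<phi>))" if \<phi>: "\<phi> \<in> {0<..<\<zeta>}" for \<phi>
  proof -
    define s where "s = sin (\<phi> / 2)"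
    define c where "c = cos (\<phi> / 2)"
    have sc: "s > 0" "c > 0" using sin_pos[of \<phi>] cos_pos[of \<phi>] \<phi> by (auto simp: s_def c_def)
    have gS: "g \<phi> = s ^ 2 / S" "S * g \<phi> = s ^ 2" using S by (auto simp: g_def s_def)
    have g01: "g \<phi> \<in> {0<..<1}" using img \<phi> by blast
    have "2 * cos \<phi> - 2 * cos \<zeta> = 4 * S * (1 - g \<phi>)"
    proof -
      have "cos \<phi> = 1 - 2 * s ^ 2" "cos \<zeta> = 1 - 2 * S"
        using cos_double_sin[of "\<phi> / 2"] cos_double_sin[of "\<zeta> / 2"] by (auto simp: s_def S_def)
      moreover have "4 * S * (1 - g \<phi>) = 4 * S - 4 * (S * g \<phi>)" by (simp add: algebra_simps)
      ultimately show ?thesis unfolding gS(2) by simp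
    qed
    hence "of_real (2 * cos \<phi> - 2 * cos \<zeta>) powr (lam - 1) = (complex_of_real (4 * S) *
        of_real (1 - g \<phi>)) powr (lam - 1)"
      by (simp only: of_real_mult)
    also have "\<dots> = complex_of_real (4 * S) powr (lam - 1) * of_real (1 - g \<phi>) powr (lam - 1)"
      using S g01 by (intro powr_times_real) auto
    finally have 1: "of_real (2 * cos \<phi> - 2 * cos \<zeta>) powr (lam - 1) = complex_of_real (4 *
        S) powr (lam - 1) * of_real (1 - g \<phi>) powr (lam - 1)" .
    have 2: "cos (\<mu> * of_real \<phi>) = of_real c * (\<Sum>n. b n * of_real (g \<phi>) ^ n)"
    proof -
      have "b n * of_real (g \<phi>) ^ n = cos_coeff_half \<mu> n * of_real (s ^ 2) ^ n" for n
        unfolding b_def gS(2)[symmetric] by (simp add: power_mult_distrib)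
      thus ?thesis using cos_mult_half_series[of \<phi> \<mu>] \<phi> z by (simp add: s_def c_def)
    qed
    have "complex_of_real (g \<phi>) powr (1/2 - 1) = of_real (g \<phi> powr (-1/2))"
      using g01 by (subst powr_of_real[symmetric]) auto
    also have "g \<phi> powr (-1/2) = sqrt S / s"
      using sc S g01 by (simp add: powr_minus powr_half_sqrt gS(1) real_sqrt_divide
          inverse_eq_divide)
    finally have 3: "complex_of_real (g \<phi>) powr (1/2 - 1) = of_real (sqrt S / s)" .
    have "sqrt S * (s * c / S * (sqrt S / s)) = c"
      using S sc by (simp add: field_simps)
    hence "complex_of_real (sqrt S * (s * c / S * (sqrt S / s))) = of_real c" by (simp only:)
    hence 4: "complex_of_real (sqrt S) * (of_real (s * c / S) * of_real (sqrt S / s)) = of_real c"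
      by (simp only: of_real_mult)
    have "\<bar>h \<phi>\<bar> = s * c / S" using sc S by (simp add: h_def s_def c_def)
    hence "K * (\<bar>h \<phi>\<bar> *\<^sub>R f (g \<phi>)) = K * (of_real (s * c / S) * ((\<Sum>n. b n * of_real (g \<phi>) ^ n) *
        (of_real (sqrt S / s) * of_real (1 - g \<phi>) powr (lam - 1))))"
      unfolding f_def beta_kernel_def 3 by (simp only: scaleR_conv_of_real)
    also have "\<dots> = (complex_of_real (sqrt S) * (of_real (s * c / S) * of_real (sqrt S / s))) *
        (\<Sum>n. b n * of_real (g \<phi>) ^ n) * (complex_of_real (4 * S) powr (lam - 1) *
        of_real (1 - g \<phi>) powr (lam - 1))"
      unfolding K_def by (simp only: mult_ac)
    also have "\<dots> = F \<phi>" unfolding 4 F_def 1 2 by (simp only: mult_ac)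
    finally show ?thesis ..
  qed
  have "(\<lambda>\<phi>. K * (\<bar>h \<phi>\<bar> *\<^sub>R f (g \<phi>))) absolutely_integrable_on {0<..<\<zeta>}"
    using cov by (intro set_integrable_mult_right) auto
  thus "F absolutely_integrable_on {0<..<\<zeta>}"
    by (rule set_integrable_cong[THEN iffD1, rotated -1]) (auto simp: F_eq)
  have "integral {0<..<\<zeta>} F = integral {0<..<\<zeta>} (\<lambda>\<phi>. K * (\<bar>h \<phi>\<bar> *\<^sub>R f (g \<phi>)))"
    by (intro integral_cong F_eq)
  also have "\<dots> = K * integral {0<..<1} f" using conjunct2[OF cov]
      by (simp only: integral_mult_right)
  finally show "integral {0<..<\<zeta>} F = of_real (4 * S) powr (lam - 1) * of_real (sqrt S) *
      (of_real (sqrt pi) * Gamma lam * hypergeo_reg (\<mu> + 1/2) (1/2 - \<mu>) (1/2 + lam) (of_real S))"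
    unfolding K_def f_int .
qed

section \<open>From the Mehler--Dirichlet integral to Euler integrals\<close>

lemma norm_powr_bound:
  fixes x a :: complex
  shows "norm (x powr a) \<le> norm x powr Re a * exp (pi * \<bar>Im a\<bar>)"
proof -
  have "- Im a * Arg x \<le> \<bar>- Im a * Arg x\<bar>" by (rule abs_ge_self)
  also have "\<dots> = \<bar>Arg x\<bar> * \<bar>Im a\<bar>" by (simp add: abs_mult)
  also have "\<dots> \<le> pi * \<bar>Im a\<bar>"
    using Arg_bounded[of x] by (intro mult_right_mono) auto
  finally show ?thesis unfolding norm_powr_complex by (intro mult_left_mono) auto
qed

section \<open>Branch and size of the continued integrand in the half strip\<close>

definition mehler_fun :: "complex \<Rightarrow> complex \<Rightarrow> real \<Rightarrow> complex \<Rightarrow> complex" where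
  "mehler_fun \<mu> lam \<zeta> \<theta> = exp (\<i> * \<mu> * \<theta>) * (2 * cos \<theta> - 2 * of_real (cos \<zeta>)) powr (lam - 1)"

lemma exp_plus_exp_minus_ge_2: "exp x + exp (-x) \<ge> (2 :: real)"
proof -
  have "exp x * exp (-x) = 1" by (simp flip: exp_add)
  moreover have "(exp x + exp (-x))\<^sup>2 - 4 * (exp x * exp (-x)) = (exp x - exp (-x))\<^sup>2"
    by (simp add: power2_eq_square algebra_simps)
  ultimately have "4 \<le> (exp x + exp (-x))\<^sup>2" using zero_le_power2[of "exp x - exp (-x)"] by linarith
  thus ?thesis using power2_le_imp_le[of 2 "exp x + exp (-x)"] by (simp add: add_nonneg_nonneg)
qed

text \<open>This makes the limit \<open>\<epsilon> \<rightarrow> 0\<close> a case of dominated convergence although the limiting integrand is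
  singular at \<open>\<phi> = \<zeta>\<close>.\<close>

lemma norm_cos_diff_ge:
  fixes \<phi> \<epsilon> \<zeta> :: real
  shows "norm (2 * cos (Complex \<phi> \<epsilon>) - 2 * of_real (cos \<zeta>)) \<ge> \<bar>2 * cos \<phi> - 2 * cos \<zeta>\<bar>"
proof -
  define C where "C = exp \<epsilon> + exp (-\<epsilon>)"
  define D where "D = exp (-\<epsilon>) - exp \<epsilon>"
  have "exp \<epsilon> * exp (-\<epsilon>) = 1" by (simp flip: exp_add)
  hence D: "D\<^sup>2 = C\<^sup>2 - 4" unfolding C_def D_def by (simp add: power2_eq_square algebra_simps)
  have C: "C \<ge> 2" unfolding C_def by (rule exp_plus_exp_minus_ge_2)
  have "cos \<phi> * cos \<zeta> \<le> \<bar>cos \<phi>\<bar> * \<bar>cos \<zeta>\<bar>" by (metis abs_ge_self abs_mult)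
  also have "\<dots> \<le> 1 * 1" by (intro mult_mono) auto
  finally have le1: "cos \<phi> * cos \<zeta> \<le> 1" by simp
  have "(norm (2 * cos (Complex \<phi> \<epsilon>) - 2 * of_real (cos \<zeta>)))\<^sup>2 = (cos \<phi> * C - 2 * cos \<zeta>)\<^sup>2 +
      (sin \<phi> * D)\<^sup>2"
    by (simp add: cmod_power2 Re_cos Im_cos C_def D_def)
  also have "\<dots> = (cos \<phi> * C - 2 * cos \<zeta>)\<^sup>2 + (1 - (cos \<phi>)\<^sup>2) * (C\<^sup>2 - 4)"
    by (simp add: power_mult_distrib D sin_squared_eq)
  \<comment> \<open>With C = 2 cosh \<epsilon>, the excess over the value at \<epsilon> = 0 is a
    product of two nonnegative factors, by C \<ge> 2 and cos \<phi> cos \<zeta> \<le> 1.\<close>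
  also have "\<dots> = (2 * cos \<phi> - 2 * cos \<zeta>)\<^sup>2 + (C - 2) * (C + 2 - 4 * (cos \<phi> * cos \<zeta>))"
    by (simp add: power2_eq_square algebra_simps)
  also have "\<dots> \<ge> (2 * cos \<phi> - 2 * cos \<zeta>)\<^sup>2"
    using C le1 by (simp add: mult_nonneg_nonneg)
  finally show ?thesis using power2_le_imp_le[of "\<bar>2 * cos \<phi> - 2 * cos \<zeta>\<bar>"] by simp
qed

lemma norm_cos_diff_le:
  fixes \<phi> \<epsilon> \<zeta> :: real
  assumes "\<epsilon> \<ge> 0"
  shows "norm (2 * cos (Complex \<phi> \<epsilon>) - 2 * of_real (cos \<zeta>)) \<le> 4 * exp \<epsilon>"
proof -
  have "2 * cos (Complex \<phi> \<epsilon>) = exp (\<i> * Complex \<phi> \<epsilon>) + exp (- (\<i> * Complex \<phi> \<epsilon>))"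
    by (simp add: cos_exp_eq)
  hence "norm (2 * cos (Complex \<phi> \<epsilon>)) \<le> exp (- \<epsilon>) + exp \<epsilon>"
    using norm_triangle_ineq[of "exp (\<i> * Complex \<phi> \<epsilon>)" "exp (- (\<i> * Complex \<phi> \<epsilon>))"] by simp
  moreover have "norm (2 * of_real (cos \<zeta>) :: complex) \<le> 2" by (simp add: norm_mult)
  moreover have "exp (-\<epsilon>) \<le> exp \<epsilon>" "1 \<le> exp \<epsilon>" using assms by auto
  ultimately show ?thesis
    using norm_triangle_ineq4[of "2 * cos (Complex \<phi> \<epsilon>)" "2 * of_real (cos \<zeta>)"] by linarith
qed

text \<open>The dominant exponential leaves at least exp \<epsilon> - 3, and exp \<epsilon> \<ge> 4
  makes this at least exp \<epsilon> / 4. A lower bound is needed beside the upper one because the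
  exponent Re lam - 1 may be negative.\<close>

lemma norm_cos_diff_ge_exp:
  fixes \<phi> \<epsilon> \<zeta> :: real
  assumes "\<epsilon> \<ge> 2"
  shows "norm (2 * cos (Complex \<phi> \<epsilon>) - 2 * of_real (cos \<zeta>)) \<ge> exp \<epsilon> / 4"
proof -
  have "2 * cos (Complex \<phi> \<epsilon>) = exp (- (\<i> * Complex \<phi> \<epsilon>)) + exp (\<i> * Complex \<phi> \<epsilon>)"
    by (simp add: cos_exp_eq)
  hence "norm (2 * cos (Complex \<phi> \<epsilon>)) \<ge> exp \<epsilon> - exp (- \<epsilon>)"
    using norm_diff_ineq[of "exp (- (\<i> * Complex \<phi> \<epsilon>))" "exp (\<i> * Complex \<phi> \<epsilon>)"] by simp
  moreover have "norm (2 * of_real (cos \<zeta>) :: complex) \<le> 2" by (simp add: norm_mult)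
  moreover have "exp (-\<epsilon>) \<le> 1" using assms by simp
  moreover have "exp \<epsilon> \<ge> 4"
  proof -
    have "(2::real) \<le> exp 1" using exp_ge_add_one_self[of 1] by simp
    hence "2 * 2 \<le> exp 1 * exp (1::real)" by (intro mult_mono) auto
    also have "\<dots> = exp 2" by (simp flip: exp_add)
    also have "\<dots> \<le> exp \<epsilon>" using assms by simp
    finally show ?thesis by simp
  qed
  ultimately show ?thesis
    using norm_triangle_ineq2[of "2 * cos (Complex \<phi> \<epsilon>)" "2 * of_real (cos \<zeta>)"] by linarith
qed

text \<open>The imaginary part vanishes only on the line Re \<theta> = 0. There 2 cos \<theta> = 2
  cosh(Im \<theta>) \<ge> 2 > 2 cos \<zeta>, so the value is positive and the principal power is
  holomorphic in the whole half strip.\<close>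

lemma cos_diff_not_nonpos:
  assumes z: "0 < \<zeta>" "\<zeta> < pi" and t: "\<bar>Re \<theta>\<bar> < pi" "Im \<theta> > 0"
  shows "2 * cos \<theta> - 2 * complex_of_real (cos \<zeta>) \<notin> \<real>\<^sub>\<le>\<^sub>0"
proof
  assume *: "2 * cos \<theta> - 2 * complex_of_real (cos \<zeta>) \<in> \<real>\<^sub>\<le>\<^sub>0"
  hence "sin (Re \<theta>) * (exp (- Im \<theta>) - exp (Im \<theta>)) = 0"
      by (simp add: complex_nonpos_Reals_iff Im_cos)
  moreover have "exp (- Im \<theta>) \<noteq> exp (Im \<theta>)" using t by simp
  ultimately have "sin (Re \<theta>) = 0" by simp
  hence "Re \<theta> = 0" using t sin_gt_zero[of "Re \<theta>"] sin_gt_zero[of "- Re \<theta>"]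
      by (cases "Re \<theta>" "0 :: real" rule: linorder_cases) auto
  with * have "exp (Im \<theta>) + exp (- Im \<theta>) \<le> 2 * cos \<zeta>" by (simp add: complex_nonpos_Reals_iff Re_cos)
  moreover have "cos \<zeta> < 1" using cos_monotone_0_pi[of 0 \<zeta>] z by simp
  ultimately show False using exp_plus_exp_minus_ge_2[of "Im \<theta>"] by linarith
qed

lemma norm_mehler_fun_le:
  "norm (mehler_fun \<mu> lam \<zeta> (Complex \<phi> y)) \<le> exp (\<bar>Im \<mu>\<bar> * \<bar>\<phi>\<bar>) * exp (- Re \<mu> * y) *
     (norm (2 * cos (Complex \<phi> y) - 2 * of_real (cos \<zeta>)) powr (Re lam - 1) * exp (pi * \<bar>Im lam\<bar>))"
proof -
  have "- (Im \<mu> * \<phi>) \<le> \<bar>Im \<mu>\<bar> * \<bar>\<phi>\<bar>" by (metis abs_ge_minus_self abs_mult)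
  hence "norm (exp (\<i> * \<mu> * Complex \<phi> y)) \<le> exp (\<bar>Im \<mu>\<bar> * \<bar>\<phi>\<bar>) * exp (- Re \<mu> * y)"
    by (simp flip: exp_add)
  moreover have "norm ((2 * cos (Complex \<phi> y) - 2 * of_real (cos \<zeta>)) powr (lam - 1)) \<le> 
     norm (2 * cos (Complex \<phi> y) - 2 * of_real (cos \<zeta>)) powr (Re lam - 1) * exp (pi * \<bar>Im lam\<bar>)"
    using norm_powr_bound[of "2 * cos (Complex \<phi> y) - 2 * of_real (cos \<zeta>)" "lam - 1"] by simp
  ultimately show ?thesis unfolding mehler_fun_def norm_mult by (intro mult_mono) auto
qed

text \<open>A power is monotone on [a, b], so its maximum is at an endpoint. The sum of the two
  endpoint values covers both signs of q in one formula.\<close>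

lemma powr_between_le:
  fixes a b q x :: real
  assumes "0 < a" "a \<le> x" "x \<le> b"
  shows "x powr q \<le> a powr q + b powr q"
proof (cases "q \<ge> 0")
  case True
  hence "x powr q \<le> b powr q" using assms by (intro powr_mono2) auto
  thus ?thesis by (simp add: add_increasing)
next
  case False
  hence "x powr q \<le> a powr q" using assms by (intro powr_mono2') auto
  thus ?thesis by (simp add: add_increasing2)
qed

text \<open>Euler's integral for the Gauss function: the value is
  \<open>Beta lam (\<nu> + 1)\<close> times F(1 - lam, lam; \<nu> + lam + 1; w).\<close>

definition euler_integral :: "complex \<Rightarrow> complex \<Rightarrow> complex \<Rightarrow> complex" where
  "euler_integral \<nu> lam w = integral {0<..<1} (\<lambda>t. (1 - w * of_real t) powr (lam - 1) *
      beta_kernel lam (\<nu> + 1) t)"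

text \<open>The segment from 0 to w is a compact part of the slit plane, so G is bounded on it. The
  lemma is used for the power of 1 - z and again for the Stieltjes transform in the
  remainder.\<close>

lemma cut_plane_ray_absolutely_integrable:
  assumes g: "g absolutely_integrable_on {0<..<1}" and w: "w \<in> cut_plane" and
      G: "G holomorphic_on cut_plane"
  shows "(\<lambda>t. G (w * of_real t) * g t) absolutely_integrable_on {0<..<1}"
proof -
  have c: "continuous_on {0..1} (\<lambda>t. G (w * of_real t))"
    using cut_plane_scale(1)[OF w]
    by (intro continuous_on_compose2[OF holomorphic_on_imp_continuous_on[OF G]] continuous_intros)
        (auto simp: mult.commute)
  hence "bounded ((\<lambda>t. G (w * of_real t)) ` {0..1})"
    by (intro compact_imp_bounded compact_continuous_image) auto
  then obtain C where C: "\<And>t. t \<in> {0..1} \<Longrightarrow> norm (G (w * of_real t)) \<le> C"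
    unfolding bounded_iff by (metis imageI)
  show ?thesis
  proof (rule absolutely_integrable_bounded_continuous_mult[of _ _ C])
    show "continuous_on {0<..<1} (\<lambda>t. G (w * complex_of_real t))"
      using c by (rule continuous_on_subset) auto
    show "norm (G (w * of_real t)) \<le> C" if "t \<in> {0<..<1}" for t using C[of t] that by auto
  qed (auto intro: g)
qed

lemma euler_integrand_absolutely_integrable:
  assumes "Re lam > 0" "Re \<nu> > -1" "w \<in> cut_plane"
  shows "(\<lambda>t. (1 - w * of_real t) powr (lam - 1) * beta_kernel lam (\<nu> +
      1) t) absolutely_integrable_on {0<..<1}"
proof -
  have "(\<lambda>z. (1 - z) powr (lam - 1)) holomorphic_on cut_plane"
    by (intro holomorphic_intros) (auto simp: cut_plane_def)
  thus ?thesis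
    using assms by (intro cut_plane_ray_absolutely_integrable[where G =
        "\<lambda>z. (1 - z) powr (lam - 1)"] beta_kernel_absolutely_integrable) auto
qed

text \<open>The power series variable \<open>(1 - \<sigma> i cot \<zeta>) / 2 = - e\<^sup>i\<^sup>\<sigma>\<^sup>(\<^sup>\<zeta>\<^sup>+\<^sup>\<pi>\<^sup>/\<^sup>2\<^sup>) / (2 sin \<zeta>)\<close>, where \<open>\<sigma> = \<plusminus> 1\<close>.\<close>

definition w_point :: "real \<Rightarrow> real \<Rightarrow> complex" where
  "w_point \<sigma> \<zeta> = Complex (1/2) (- \<sigma> * cot \<zeta> / 2)"

lemma Re_w_point [simp]: "Re (w_point \<sigma> \<zeta>) = 1/2"
  and Im_w_point [simp]: "Im (w_point \<sigma> \<zeta>) = - \<sigma> * cot \<zeta> / 2"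
  by (simp_all add: w_point_def)

lemma w_point_cut_plane: "w_point \<sigma> \<zeta> \<in> cut_plane"
  by (auto simp: cut_plane_def complex_nonpos_Reals_iff)

text \<open>The factorisation is arranged for principal logarithms: a positive real number, the
  constant -i \<sigma> of argument -\<sigma> pi/2, and 1 - w t, whose real part 1 - t/2 is
  positive.\<close>

lemma cos_diff_vertical:
  assumes z: "0 < \<zeta>" "\<zeta> < pi" and y: "y > 0" and \<sigma>: "\<sigma> = 1 \<or> \<sigma> = -1"
  defines "t \<equiv> 1 - exp (-y)"
  shows "2 * cos (Complex (\<sigma> * \<zeta>) y) - 2 * of_real (cos \<zeta>) =
    of_real (2 * sin \<zeta> * t * exp y) * (- (\<i> * of_real \<sigma>) * (1 - w_point \<sigma> \<zeta> * of_real t))"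
proof -
  have s: "sin \<zeta> > 0" using z by (intro sin_gt_zero)
  have e: "exp y * exp (-y) = 1" by (simp flip: exp_add)
  have t1: "t * exp y = exp y - 1" using e by (simp add: t_def algebra_simps)
  have cs: "cos (\<sigma> * \<zeta>) = cos \<zeta>" "sin (\<sigma> * \<zeta>) = \<sigma> * sin \<zeta>" "\<sigma> * \<sigma> = 1" using \<sigma> by auto
  have "t * exp y * t = exp y + exp (-y) - 2" 
    unfolding t1 using e by (simp add: t_def algebra_simps)
  moreover have "cos \<zeta> * (exp y + exp (-y)) - 2 * cos \<zeta> = cos \<zeta> * (exp y + exp (-y) - 2)"
      by (simp add: algebra_simps)
  ultimately have "cos \<zeta> * (exp y + exp (-y)) - 2 * cos \<zeta> = cos \<zeta> * (t * exp y * t)" by simp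
  moreover have "sin \<zeta> * cot \<zeta> = cos \<zeta>" using s by (simp add: cot_def)
  moreover have "exp (-y) - exp y = - (t * exp y) * (2 - t)" unfolding t1 using e
      by (simp add: t_def algebra_simps)
  ultimately show ?thesis
    using s cs by (simp add: complex_eq_iff Re_cos Im_cos) (simp add: algebra_simps)
qed

text \<open>The argument of 1 - w t stays below pi/2 in absolute value, so adding -\<sigma> pi/2
  does not leave (-pi, pi) and the logarithm of the product is the sum of the logarithms. The factor
  exp(-y) is kept apart as the Jacobian of t = 1 - exp(-y).\<close>

lemma mehler_fun_vertical:
  assumes z: "0 < \<zeta>" "\<zeta> < pi" and y: "y > 0" and \<sigma>: "\<sigma> = 1 \<or> \<sigma> = -1"
  defines "t \<equiv> 1 - exp (-y)"
  shows "mehler_fun (\<nu> + lam) lam \<zeta> (Complex (\<sigma> * \<zeta>) y) =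
    exp (\<i> * of_real \<sigma> * (\<nu> + lam) * of_real \<zeta>) * of_real (2 * sin \<zeta>) powr (lam - 1) * exp (- (\<i> *
        of_real \<sigma> * of_real pi / 2) * (lam - 1)) *
      (exp (-y) *\<^sub>R ((1 - w_point \<sigma> \<zeta> * of_real t) powr (lam - 1) * beta_kernel lam (\<nu> + 1) t))"
proof -
  have s: "sin \<zeta> > 0" using z by (intro sin_gt_zero)
  have t: "0 < t" "t < 1" using y by (auto simp: t_def)
  define W where "W = 1 - w_point \<sigma> \<zeta> * of_real t"
  have ReW: "Re W > 0" using t by (simp add: W_def)
  hence W0: "W \<noteq> 0" by auto
  have ImW: "\<bar>Im (Ln W)\<bar> < pi / 2" using ReW W0 by (subst Re_Ln_pos_lt) auto
  have LX: "Ln (- (\<i> * of_real \<sigma>) * W) = - (\<i> * of_real \<sigma> * of_real pi / 2) + Ln W"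
    using \<sigma>
  proof
    assume "\<sigma> = 1"
    thus ?thesis using ImW W0 by (subst Ln_times_simple) auto
  next
    assume "\<sigma> = -1"
    thus ?thesis using ImW W0 by (subst Ln_times_simple) auto
  qed
  have X0: "- (\<i> * of_real \<sigma>) * W \<noteq> 0" using \<sigma> W0 by auto
  have pos: "2 * sin \<zeta> * t * exp y > 0" using s t by simp
  have "ln (2 * sin \<zeta> * t * exp y) = ln (2 * sin \<zeta>) + ln t + y"
    using s t by (simp add: ln_mult_pos)
  hence L: "Ln (of_real (2 * sin \<zeta> * t * exp y) * (- (\<i> * of_real \<sigma>) * W)) =
     of_real (ln (2 * sin \<zeta>) + ln t + y) + (- (\<i> * of_real \<sigma> * of_real pi / 2) + Ln W)"
    by (simp only: Ln_times_of_real[OF pos X0] LX Ln_of_real[OF pos])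
  have nz: "of_real (2 * sin \<zeta> * t * exp y) * (- (\<i> * of_real \<sigma>) * W) \<noteq> 0"
    using s t X0 by auto
  have c: "Complex (\<sigma> * \<zeta>) y = of_real \<sigma> * of_real \<zeta> + \<i> * of_real y" by (simp add: complex_eq_iff)
  have "(2 * cos (Complex (\<sigma> * \<zeta>) y) - 2 * of_real (cos \<zeta>)) powr (lam - 1) =
     exp ((lam - 1) * (of_real (ln (2 * sin \<zeta>) + ln t + y) + (- (\<i> * of_real \<sigma> * of_real pi / 2) +
         Ln W)))"
    unfolding cos_diff_vertical[OF z y \<sigma>] t_def[symmetric] W_def[symmetric]
    using nz L by (simp only: powr_def if_False)
  hence "mehler_fun (\<nu> + lam) lam \<zeta> (Complex (\<sigma> * \<zeta>) y) = exp (\<i> * (\<nu> + lam) * (of_real \<sigma> *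
      of_real \<zeta> + \<i> * of_real y)) *
     exp ((lam - 1) * (of_real (ln (2 * sin \<zeta>) + ln t + y) + (- (\<i> * of_real \<sigma> * of_real pi / 2) +
         Ln W)))"
    unfolding mehler_fun_def by (simp only: c)
  \<comment> \<open>The oscillating exponential contributes -(\<nu> + lam) y and the power of exp y
    contributes (lam - 1) y. Their sum -(\<nu> + 1) y splits into the Jacobian and (1 -
    t)^\<nu>.\<close>
  also have "\<dots> = exp (\<i> * of_real \<sigma> * (\<nu> + lam) * of_real \<zeta> + (lam - 1) * of_real (ln (2 *
      sin \<zeta>)) + (- (\<i> * of_real \<sigma> * of_real pi / 2) * (lam - 1)) + 
     (of_real (-y) + ((lam - 1) * Ln W + ((lam - 1) * of_real (ln t) + \<nu> * of_real (-y)))))"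
    unfolding exp_add[symmetric] by (intro arg_cong[where f = exp]) (simp add: algebra_simps)
  also have "\<dots> = exp (\<i> * of_real \<sigma> * (\<nu> + lam) * of_real \<zeta>) * of_real (2 *
      sin \<zeta>) powr (lam - 1) * exp (- (\<i> * of_real \<sigma> * of_real pi / 2) * (lam - 1)) *
      (exp (-y) *\<^sub>R (W powr (lam - 1) * beta_kernel lam (\<nu> + 1) t))"
  proof -
    have "complex_of_real (2 * sin \<zeta>) powr (lam - 1) = exp ((lam - 1) * of_real (ln (2 * sin \<zeta>)))"
      using s by (subst powr_def) (simp only: Ln_of_real, auto)
    moreover have "W powr (lam - 1) = exp ((lam - 1) * Ln W)" using W0 by (simp add: powr_def)
    moreover have "beta_kernel lam (\<nu> + 1) t = exp ((lam - 1) * of_real (ln t)) * exp (\<nu> *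
        of_real (-y))"
    proof -
      have "1 - t = exp (-y)" by (simp add: t_def)
      hence "of_real (1 - t) powr (\<nu> + 1 - 1) = exp (\<nu> * complex_of_real (-y))"
        by (simp only: powr_def) (simp add: Ln_of_real flip: exp_of_real)
      moreover have "complex_of_real t powr (lam - 1) = exp ((lam - 1) * of_real (ln t))"
        using t by (simp add: powr_def Ln_of_real)
      ultimately show ?thesis by (simp only: beta_kernel_def)
    qed
    moreover have "complex_of_real (exp (-y)) = exp (of_real (-y))" by (simp only: exp_of_real)
    ultimately show ?thesis by (simp only: exp_add scaleR_conv_of_real)
  qed
  finally show ?thesis unfolding W_def .
qed

lemma mehler_fun_vertical_integral:
  assumes z: "0 < \<zeta>" "\<zeta> < pi" and \<sigma>: "\<sigma> = 1 \<or> \<sigma> = -1" and lam: "Re lam > 0" and nu: "Re \<nu> > -1"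
  defines "V \<equiv> \<lambda>y. mehler_fun (\<nu> + lam) lam \<zeta> (Complex (\<sigma> * \<zeta>) y)"
  shows "V absolutely_integrable_on {0<..}"
    and "integral {0<..} V = exp (\<i> * of_real \<sigma> * (\<nu> + lam) * of_real \<zeta>) * of_real (2 *
        sin \<zeta>) powr (lam - 1) * 
        exp (- (\<i> * of_real \<sigma> * of_real pi / 2) * (lam - 1)) * euler_integral \<nu> lam (w_point \<sigma> \<zeta>)"
proof -
  define A where "A = exp (\<i> * of_real \<sigma> * (\<nu> + lam) * of_real \<zeta>) * of_real (2 *
      sin \<zeta>) powr (lam - 1) * exp (- (\<i> * of_real \<sigma> * of_real pi / 2) * (lam - 1))"
  define f where "f = (\<lambda>t. (1 - w_point \<sigma> \<zeta> * of_real t) powr (lam - 1) * beta_kernel lam (\<nu> +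
      1) t)"
  define g where "g = (\<lambda>y::real. 1 - exp (-y))"
  have der: "(g has_field_derivative exp (-y)) (at y within {0<..})" for y
    unfolding g_def by (auto intro!: derivative_eq_intros)
  have inj: "inj_on g {0<..}" by (auto simp: g_def inj_on_def)
  have img: "g ` {0<..} = {0<..<1}"
  proof (intro equalityI subsetI)
    fix t :: real assume t: "t \<in> {0<..<1}"
    hence "t = g (- ln (1 - t))" "- ln (1 - t) > 0" by (auto simp: g_def)
    thus "t \<in> g ` {0<..}" by blast
  qed (auto simp: g_def)
  have cov: "(\<lambda>y. \<bar>exp (-y)\<bar> *\<^sub>R f (g y)) absolutely_integrable_on {0<..} \<and>
     integral {0<..} (\<lambda>y. \<bar>exp (-y)\<bar> *\<^sub>R f (g y)) = euler_integral \<nu> lam (w_point \<sigma> \<zeta>)"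
    using euler_integrand_absolutely_integrable[OF lam nu w_point_cut_plane[of \<sigma> \<zeta>]]
    by (subst has_absolute_integral_change_of_variables_real[OF _ der inj]) (auto simp: img f_def
        euler_integral_def)
  have eq: "V y = A * (\<bar>exp (-y)\<bar> *\<^sub>R f (g y))" if "y \<in> {0<..}" for y
    using mehler_fun_vertical[OF z _ \<sigma>, of y \<nu> lam] that unfolding V_def A_def f_def g_def by simp
  have "(\<lambda>y. A * (\<bar>exp (-y)\<bar> *\<^sub>R f (g y))) absolutely_integrable_on {0<..}"
    using cov by (intro set_integrable_mult_right) auto
  thus "V absolutely_integrable_on {0<..}"
    by (rule set_integrable_cong[THEN iffD1, rotated -1]) (auto simp: eq)
  have "integral {0<..} V = integral {0<..} (\<lambda>y. A * (\<bar>exp (-y)\<bar> *\<^sub>R f (g y)))"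
    by (intro integral_cong eq)
  also have "\<dots> = A * euler_integral \<nu> lam (w_point \<sigma> \<zeta>)" using conjunct2[OF cov]
      by (simp only: integral_mult_right)
  finally show "integral {0<..} V = exp (\<i> * of_real \<sigma> * (\<nu> + lam) * of_real \<zeta>) * of_real (2 *
      sin \<zeta>) powr (lam - 1) * 
        exp (- (\<i> * of_real \<sigma> * of_real pi / 2) * (lam - 1)) * euler_integral \<nu> lam (w_point \<sigma> \<zeta>)"
    unfolding A_def .
qed

section \<open>Cauchy's theorem on the rectangle\<close>

lemma mehler_fun_holomorphic:
  assumes z: "0 < \<zeta>" "\<zeta> < pi"
  shows "mehler_fun \<mu> lam \<zeta> holomorphic_on {\<theta>. \<bar>Re \<theta>\<bar> < pi \<and> Im \<theta> > 0}"
  unfolding mehler_fun_def using cos_diff_not_nonpos[OF z] by (intro holomorphic_intros) auto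

text \<open>For \<mu> = \<nu> + lam the decay rate in Y is Re \<nu> + 1. This is where Re \<nu> > -1
  makes the top side of the rectangle disappear.\<close>

lemma mehler_fun_top_bound:
  fixes \<mu> lam :: complex and \<zeta> :: real
  assumes "\<bar>\<phi>\<bar> \<le> \<zeta>" "Y \<ge> 2"
  shows "norm (mehler_fun \<mu> lam \<zeta> (Complex \<phi> Y)) \<le>
     exp (\<bar>Im \<mu>\<bar> * \<zeta>) * exp (pi * \<bar>Im lam\<bar>) * ((1/4) powr (Re lam - 1) + 4 powr (Re lam - 1)) *
         exp (- (Re \<mu> - Re lam + 1) * Y)"
proof -
  define x where "x = norm (2 * cos (Complex \<phi> Y) - 2 * of_real (cos \<zeta>))"
  define q where "q = Re lam - 1"
  have "x powr q \<le> (exp Y / 4) powr q + (4 * exp Y) powr q"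
    unfolding x_def using assms by (intro powr_between_le norm_cos_diff_ge_exp norm_cos_diff_le)
        auto
  also have "\<dots> = ((1/4) powr q + 4 powr q) * exp (q * Y)"
  proof -
    have "(exp Y / 4) powr q = (1/4) powr q * exp Y powr q"
      using powr_mult[of "1/4" "exp Y" q] by simp
    moreover have "(4 * exp Y) powr q = 4 powr q * exp Y powr q" by (rule powr_mult)
    moreover have "exp Y powr q = exp (q * Y)" by (simp add: powr_def)
    ultimately show ?thesis by (simp only: distrib_right)
  qed
  finally have x: "x powr q \<le> ((1/4) powr q + 4 powr q) * exp (q * Y)" .
  have "norm (mehler_fun \<mu> lam \<zeta> (Complex \<phi> Y)) \<le> exp (\<bar>Im \<mu>\<bar> * \<bar>\<phi>\<bar>) * exp (- Re \<mu> * Y) *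
      (x powr q * exp (pi * \<bar>Im lam\<bar>))"
    unfolding x_def q_def by (rule norm_mehler_fun_le)
  also have "\<dots> \<le> exp (\<bar>Im \<mu>\<bar> * \<zeta>) * exp (- Re \<mu> * Y) * ((((1/4) powr q + 4 powr q) * exp (q *
      Y)) * exp (pi * \<bar>Im lam\<bar>))"
    using assms by (intro mult_mono x) (auto intro!: mult_left_mono)
  also have "\<dots> = exp (\<bar>Im \<mu>\<bar> * \<zeta>) * exp (pi * \<bar>Im lam\<bar>) * ((1/4) powr q + 4 powr q) *
      (exp (- Re \<mu> * Y) * exp (q * Y))"
    by (simp only: mult_ac)
  also have "exp (- Re \<mu> * Y) * exp (q * Y) = exp (- (Re \<mu> - Re lam + 1) * Y)"
    by (simp add: q_def algebra_simps flip: exp_add)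
  finally show ?thesis unfolding q_def .
qed

text \<open>The majorant is uniform in the height y. Its only singular part is the real power of 2
  cos \<phi> - 2 cos \<zeta>, available because leaving the real axis does not decrease the norm of
  the base.\<close>

lemma mehler_fun_bottom_bound:
  fixes \<mu> lam :: complex and \<zeta> :: real
  assumes z: "0 < \<zeta>" "\<zeta> < pi" and "\<bar>\<phi>\<bar> < \<zeta>" "0 < y" "y \<le> 1"
  shows "norm (mehler_fun \<mu> lam \<zeta> (Complex \<phi> y)) \<le>
     exp (\<bar>Im \<mu>\<bar> * \<zeta>) * exp \<bar>Re \<mu>\<bar> * (((2 * cos \<phi> - 2 * cos \<zeta>) powr (Re lam - 1) + (4 *
         exp 1) powr (Re lam - 1)) * exp (pi * \<bar>Im lam\<bar>))"
proof -
  define x where "x = norm (2 * cos (Complex \<phi> y) - 2 * of_real (cos \<zeta>))"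
  define q where "q = Re lam - 1"
  have "cos \<bar>\<phi>\<bar> > cos \<zeta>" using assms by (intro cos_monotone_0_pi) auto
  hence pos: "2 * cos \<phi> - 2 * cos \<zeta> > 0" by simp
  have "x \<le> 4 * exp y" unfolding x_def using assms by (intro norm_cos_diff_le) auto
  also have "\<dots> \<le> 4 * exp 1" using assms by simp
  finally have "x \<le> 4 * exp 1" .
  moreover have "2 * cos \<phi> - 2 * cos \<zeta> \<le> x" using norm_cos_diff_ge[of \<phi> \<zeta> y] by (simp add: x_def)
  ultimately have x: "x powr q \<le> (2 * cos \<phi> - 2 * cos \<zeta>) powr q + (4 * exp 1) powr q"
    using pos by (intro powr_between_le) auto
  have "- Re \<mu> * y \<le> \<bar>Re \<mu>\<bar> * y" using assms by (intro mult_right_mono) auto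
  also have "\<dots> \<le> \<bar>Re \<mu>\<bar> * 1" using assms by (intro mult_left_mono) auto
  finally have e: "exp (- Re \<mu> * y) \<le> exp \<bar>Re \<mu>\<bar>" by simp
  have "norm (mehler_fun \<mu> lam \<zeta> (Complex \<phi> y)) \<le> exp (\<bar>Im \<mu>\<bar> * \<bar>\<phi>\<bar>) * exp (- Re \<mu> * y) *
      (x powr q * exp (pi * \<bar>Im lam\<bar>))"
    unfolding x_def q_def by (rule norm_mehler_fun_le)
  also have "\<dots> \<le> exp (\<bar>Im \<mu>\<bar> * \<zeta>) * exp \<bar>Re \<mu>\<bar> * (((2 * cos \<phi> - 2 * cos \<zeta>) powr q + (4 *
      exp 1) powr q) * exp (pi * \<bar>Im lam\<bar>))"
    using assms by (intro mult_mono x e) (auto intro!: mult_left_mono)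
  finally show ?thesis unfolding q_def .
qed

text \<open>The case \<mu> = 0 of \<open>mehler_dirichlet\<close>: its cosine factor is 1, and its
  absolute integrability is the claim.\<close>

lemma cos_diff_powr_integrable:
  assumes z: "0 < \<zeta>" "\<zeta> < pi" and q: "q > 0"
  shows "(\<lambda>\<phi>. (2 * cos \<phi> - 2 * cos \<zeta>) powr (q - 1)) integrable_on {0<..<\<zeta>}"
proof -
  have "(\<lambda>\<phi>. cos (0 * of_real \<phi>) * complex_of_real (2 * cos \<phi> - 2 *
      cos \<zeta>) powr (of_real q - 1)) absolutely_integrable_on {0<..<\<zeta>}"
    using q by (intro mehler_dirichlet(1) z) auto
  hence "(\<lambda>\<phi>. norm (cos (0 * of_real \<phi>) * complex_of_real (2 * cos \<phi> - 2 *
      cos \<zeta>) powr (of_real q - 1))) integrable_on {0<..<\<zeta>}"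
    by (simp only: absolutely_integrable_on_def)
  thus ?thesis
  proof (rule integrable_eq)
    fix \<phi> assume \<phi>: "\<phi> \<in> {0<..<\<zeta>}"
    have "cos \<phi> > cos \<zeta>" using \<phi> z by (intro cos_monotone_0_pi) auto
    hence "norm (complex_of_real (2 * cos \<phi> - 2 * cos \<zeta>) powr (of_real q - 1)) = (2 * cos \<phi> - 2 *
        cos \<zeta>) powr (q - 1)"
      by (subst norm_powr_real_powr) auto
    thus "norm (cos (0 * of_real \<phi>) * complex_of_real (2 * cos \<phi> - 2 *
        cos \<zeta>) powr (of_real q - 1)) = (2 * cos \<phi> - 2 * cos \<zeta>) powr (q - 1)"
      by (simp only: norm_mult) simp
  qed
qed

text \<open>Cauchy's theorem for the rectangle with vertices \<open>\<plusminus> \<zeta> + i \<epsilon>\<close> and \<open>\<plusminus> \<zeta> + i Y\<close>, as \<open>\<epsilon> \<rightarrow> 0\<close> and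
  \<open>Y \<rightarrow> \<infinity>\<close>. The primitive \<open>P\<close> takes the place of the contour integral.\<close>

lemma mehler_euler_connection:
  fixes \<nu> lam :: complex and \<zeta> :: real
  assumes z: "0 < \<zeta>" "\<zeta> < pi" and lam: "Re lam > 0" and nu: "Re \<nu> > -1"
  defines "\<delta> \<equiv> (\<nu> + lam) * of_real \<zeta> - lam * of_real (pi / 2)"
  shows "2 * integral {0<..<\<zeta>} (\<lambda>\<phi>. cos ((\<nu> + lam) * of_real \<phi>) * of_real (2 * cos \<phi> - 2 *
      cos \<zeta>) powr (lam - 1)) =
    of_real (2 * sin \<zeta>) powr (lam - 1) * (exp (\<i> * \<delta>) * euler_integral \<nu> lam (w_point 1 \<zeta>) +
        exp (- (\<i> * \<delta>)) * euler_integral \<nu> lam (w_point (-1) \<zeta>))"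
proof -
  define \<mu> where "\<mu> = \<nu> + lam"
  define f where "f = mehler_fun \<mu> lam \<zeta>"
  define U where "U = {\<theta>. \<bar>Re \<theta>\<bar> < pi \<and> Im \<theta> > 0}"
  have U_eq: "U = {\<theta>. Re \<theta> < pi} \<inter> {\<theta>. Re \<theta> > - pi} \<inter> {\<theta>. Im \<theta> > 0}"
      by (auto simp: U_def abs_less_iff)
  have opn: "open U" unfolding U_eq by (intro open_Int open_halfspace_Re_lt open_halfspace_Re_gt
      open_halfspace_Im_gt)
  have cvx: "convex U" unfolding U_eq by (intro convex_Int convex_halfspace_Re_lt
      convex_halfspace_Re_gt convex_halfspace_Im_gt)
  have hol: "f holomorphic_on U" unfolding f_def U_def by (rule mehler_fun_holomorphic[OF z])
  obtain P where P0: "\<And>x. x \<in> U \<Longrightarrow> (P has_field_derivative f x) (at x within U)"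
    by (rule holomorphic_convex_primitive'[OF cvx opn hol]) (rule that)
  have P: "(P has_field_derivative f x) (at x)" if "x \<in> U" for x
    using P0[OF that] by (simp add: at_within_open[OF that opn])
  have Ceq: "Complex a b = of_real a + \<i> * of_real b" for a b by (simp add: complex_eq_iff)
  have dh: "((\<lambda>x. P (Complex (s * x) y)) has_vector_derivative (of_real s * f (Complex (s *
      x) y))) (at x)"
    if "Complex (s * x) y \<in> U" for s x y
  proof -
    have "((\<lambda>x. Complex (s * x) y) has_vector_derivative of_real s) (at x)"
      unfolding Ceq by (auto intro!: derivative_eq_intros simp: scaleR_conv_of_real)
    from field_vector_diff_chain_at[OF this P[OF that]] show ?thesis by (simp add: o_def)
  qed
  have dv: "((\<lambda>y. P (Complex x y)) has_vector_derivative (\<i> * f (Complex x y))) (at y)"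
    if "Complex x y \<in> U" for x y
  proof -
    have "((\<lambda>y. Complex x y) has_vector_derivative \<i>) (at y)"
      unfolding Ceq by (auto intro!: derivative_eq_intros)
    from field_vector_diff_chain_at[OF this P[OF that]] show ?thesis by (simp add: o_def)
  qed
  \<comment> \<open>The side is folded at its midpoint, with the primitive P(x + i y) - P(-x + i y),
    which vanishes at x = 0. In the limit y = 0 the folded exponentials add up to twice the
    cosine.\<close>
  have horiz: "((\<lambda>\<phi>. f (Complex \<phi> y) + f (Complex (-\<phi>) y)) has_integral
      (P (Complex \<zeta> y) - P (Complex (-\<zeta>) y))) {0<..<\<zeta>}"
    if "y > 0" for y
  proof -
    have "((\<lambda>\<phi>. f (Complex \<phi> y) + f (Complex (-\<phi>) y)) has_integral 
       ((P (Complex \<zeta> y) - P (Complex (-\<zeta>) y)) - (P (Complex 0 y) - P (Complex (-0) y)))) {0..\<zeta>}"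
    proof (rule fundamental_theorem_of_calculus)
      fix x assume x: "x \<in> {0..\<zeta>}"
      have "((\<lambda>x. P (Complex (1 * x) y) - P (Complex ((-1) *
          x) y)) has_vector_derivative (of_real 1 * f (Complex (1 * x) y) - of_real (-1) *
          f (Complex ((-1) * x) y))) (at x)"
        using x z that by (intro has_vector_derivative_diff dh) (auto simp: U_def)
      hence "((\<lambda>x. P (Complex x y) - P (Complex (-x) y)) has_vector_derivative (f (Complex x y) +
          f (Complex (-x) y))) (at x)"
        by simp
      thus "((\<lambda>x. P (Complex x y) - P (Complex (-x) y)) has_vector_derivative (f (Complex x y) +
          f (Complex (-x) y))) (at x within {0..\<zeta>})"
        by (rule has_vector_derivative_at_within)
    qed (use z in auto)
    thus ?thesis by (simp add: has_integral_Icc_iff_Ioo)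
  qed
  have vert: "((\<lambda>y. \<i> * f (Complex x y)) has_integral (P (Complex x b) - P (Complex x a))) {a..b}"
    if "0 < a" "a \<le> b" "\<bar>x\<bar> < pi" for x a b
    using that by (intro fundamental_theorem_of_calculus has_vector_derivative_at_within[OF dv])
        (auto simp: U_def)
  \<comment> \<open>The shift by 2 gives \<epsilon> \<le> 1 for the bottom bound, Y \<ge> 2 for the
    top bound and \<epsilon> \<le> Y for the vertical sides, for every k.\<close>
  define \<epsilon> where "\<epsilon> = (\<lambda>k::nat. 1 / (real k + 2))"
  define Y where "Y = (\<lambda>k::nat. real k + 2)"
  have eY: "0 < \<epsilon> k" "\<epsilon> k \<le> 1" "\<epsilon> k \<le> Y k" "2 \<le> Y k" for k
    by (auto simp: \<epsilon>_def Y_def field_simps)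
  have \<epsilon>_lim: "\<epsilon> \<longlonglongrightarrow> 0" unfolding \<epsilon>_def by real_asymp
  have Y_lim: "filterlim Y at_top sequentially" unfolding Y_def by real_asymp
  define M where "M = integral {0<..<\<zeta>} (\<lambda>\<phi>. cos (\<mu> * of_real \<phi>) * of_real (2 * cos \<phi> - 2 *
      cos \<zeta>) powr (lam - 1))"

  have bottom: "(\<lambda>k. P (Complex \<zeta> (\<epsilon> k)) - P (Complex (-\<zeta>) (\<epsilon> k))) \<longlonglongrightarrow> 2 * M"
  proof -
    define H where "H = (\<lambda>\<phi>. 2 * (exp (\<bar>Im \<mu>\<bar> * \<zeta>) * exp \<bar>Re \<mu>\<bar> * (((2 * cos \<phi> - 2 *
        cos \<zeta>) powr (Re lam - 1) + (4 * exp 1) powr (Re lam - 1)) * exp (pi * \<bar>Im lam\<bar>))))"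
    have H_int: "H integrable_on {0<..<\<zeta>}"
      unfolding H_def
      by (intro integrable_on_mult_right integrable_on_mult_left integrable_add
          cos_diff_powr_integrable z lam)
         (simp only: integrable_on_open_interval_real integrable_const_ivl)
    have le: "norm (f (Complex \<phi> (\<epsilon> k)) + f (Complex (-\<phi>) (\<epsilon> k))) \<le> H \<phi>" if "\<phi> \<in> {0<..<\<zeta>}" for k \<phi>
    proof -
      have "norm (f (Complex \<phi> (\<epsilon> k))) \<le> H \<phi> / 2" "norm (f (Complex (-\<phi>) (\<epsilon> k))) \<le> H \<phi> / 2"
        unfolding f_def H_def using mehler_fun_bottom_bound[OF z, of \<phi> "\<epsilon> k" \<mu> lam] 
          mehler_fun_bottom_bound[OF z, of "-\<phi>" "\<epsilon> k" \<mu> lam] eY that by auto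
      thus ?thesis using norm_triangle_ineq[of "f (Complex \<phi> (\<epsilon> k))" "f (Complex (-\<phi>) (\<epsilon> k))"]
          by linarith
    qed
    have lim: "(\<lambda>k. f (Complex \<phi> (\<epsilon> k)) + f (Complex (-\<phi>) (\<epsilon> k))) \<longlonglongrightarrow>
       2 * (cos (\<mu> * of_real \<phi>) * of_real (2 * cos \<phi> - 2 * cos \<zeta>) powr (lam - 1))"
           if \<phi>: "\<phi> \<in> {0<..<\<zeta>}" for \<phi>
    proof -
      have pos: "cos \<phi> > cos \<zeta>" using \<phi> z by (intro cos_monotone_0_pi) auto
      have L: "(\<lambda>k. f (Complex s (\<epsilon> k))) \<longlonglongrightarrow> f (of_real s)" if "cos s = cos \<phi>" for s
      proof -
        have m: "2 * cos (complex_of_real s) - 2 * of_real (cos \<zeta>) \<notin> \<real>\<^sub>\<le>\<^sub>0"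
        proof -
          have "2 * cos (complex_of_real s) - 2 * of_real (cos \<zeta>) = of_real (2 * cos s - 2 * cos \<zeta>)"
            by (simp add: cos_of_real)
          thus ?thesis using that pos by (simp only: complex_nonpos_Reals_iff Re_complex_of_real
              Im_complex_of_real) linarith
        qed
        hence "isCont f (of_real s)"
          unfolding f_def mehler_fun_def by (intro continuous_intros) auto
        moreover have "(\<lambda>k. Complex s (\<epsilon> k)) \<longlonglongrightarrow> of_real s"
          unfolding Ceq by (rule tendsto_eq_intros refl \<epsilon>_lim | simp)+
        ultimately show ?thesis by (rule isCont_tendsto_compose)
      qed
      have val: "f (of_real s) = exp (\<i> * \<mu> * of_real s) * of_real (2 * cos \<phi> - 2 *
          cos \<zeta>) powr (lam - 1)" if "cos s = cos \<phi>" for s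
      proof -
        have "2 * cos (complex_of_real s) - 2 * of_real (cos \<zeta>) = of_real (2 * cos \<phi> - 2 * cos \<zeta>)"
          using that by (simp add: cos_of_real)
        thus ?thesis unfolding f_def mehler_fun_def by (simp only:)
      qed
      have "(\<lambda>k. f (Complex \<phi> (\<epsilon> k)) + f (Complex (-\<phi>) (\<epsilon> k))) \<longlonglongrightarrow> f (of_real \<phi>) + f (of_real (-\<phi>))"
        by (intro tendsto_add L) auto
      also have "f (of_real \<phi>) + f (of_real (-\<phi>)) = (exp (\<i> * \<mu> * of_real \<phi>) + exp (\<i> * \<mu> *
          of_real (-\<phi>))) * of_real (2 * cos \<phi> - 2 * cos \<zeta>) powr (lam - 1)"
        by (subst val, simp, subst val, simp, simp only: distrib_right)
      also have "exp (\<i> * \<mu> * of_real \<phi>) + exp (\<i> * \<mu> * of_real (-\<phi>)) = 2 * cos (\<mu> * of_real \<phi>)"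
        by (simp add: cos_exp_eq mult_ac)
      finally show ?thesis by (simp only: mult.assoc)
    qed
    have "(\<lambda>k. integral {0<..<\<zeta>} (\<lambda>\<phi>. f (Complex \<phi> (\<epsilon> k)) + f (Complex (-\<phi>) (\<epsilon> k)))) \<longlonglongrightarrow>
       integral {0<..<\<zeta>} (\<lambda>\<phi>. 2 * (cos (\<mu> * of_real \<phi>) * of_real (2 * cos \<phi> - 2 *
           cos \<zeta>) powr (lam - 1)))"
      using horiz[OF eY(1)] by (intro dominated_convergence(2)[OF _ H_int le lim]) auto
    thus ?thesis using integral_unique[OF horiz[OF eY(1)]] by (simp add: M_def)
  qed

  have top: "(\<lambda>k. P (Complex \<zeta> (Y k)) - P (Complex (-\<zeta>) (Y k))) \<longlonglongrightarrow> 0"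
  proof -
    define C where "C = exp (\<bar>Im \<mu>\<bar> * \<zeta>) * exp (pi * \<bar>Im lam\<bar>) * ((1/4) powr (Re lam - 1) +
        4 powr (Re lam - 1))"
    define a where "a = Re \<nu> + 1"
    have a: "a > 0" using nu by (simp add: a_def)
    have le: "norm (P (Complex \<zeta> (Y k)) - P (Complex (-\<zeta>) (Y k))) \<le> 2 * C * \<zeta> * exp (- a *
        Y k)" for k
    proof -
      have "((\<lambda>\<phi>. 2 * C * exp (- a * Y k)) has_integral (2 * C * exp (- a * Y k) * \<zeta>)) {0<..<\<zeta>}"
        using has_integral_const_real[of "2 * C * exp (- a * Y k)" 0 \<zeta>] z
            by (simp add: has_integral_Icc_iff_Ioo mult_ac)
      moreover have "norm (f (Complex \<phi> (Y k)) + f (Complex (-\<phi>) (Y k))) \<le> 2 * C * exp (- a *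
          Y k)" if "\<phi> \<in> {0<..<\<zeta>}" for \<phi>
      proof -
        have "norm (f (Complex \<phi> (Y k))) \<le> C * exp (- a * Y k)" "norm (f (Complex (-\<phi>) (Y k))) \<le>
            C * exp (- a * Y k)"
          using mehler_fun_top_bound[of \<phi> \<zeta> "Y k" \<mu> lam] mehler_fun_top_bound[of "-\<phi>" \<zeta> "Y k" \<mu>
              lam] that eY
          by (auto simp: f_def C_def a_def \<mu>_def)
        thus ?thesis using norm_triangle_ineq[of "f (Complex \<phi> (Y k))" "f (Complex (-\<phi>) (Y k))"]
            by linarith
      qed
      ultimately have "norm (P (Complex \<zeta> (Y k)) - P (Complex (-\<zeta>) (Y k))) \<le> 2 * C * exp (- a *
          Y k) * \<zeta>"
        using eY(4)[of k] by (intro has_integral_norm_bound_has_integral[OF horiz]) auto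
      thus ?thesis by (simp add: mult_ac)
    qed
    have "(\<lambda>k. 2 * C * \<zeta> * exp (- a * Y k)) \<longlonglongrightarrow> 2 * C * \<zeta> * 0"
      unfolding Y_def using a by (intro tendsto_intros) real_asymp
    hence "(\<lambda>k. 2 * C * \<zeta> * exp (- a * Y k)) \<longlonglongrightarrow> 0" by simp
    from Lim_null_comparison[OF always_eventually[OF allI[OF le]] this] show ?thesis .
  qed

  have vlim: "(\<lambda>k. P (Complex (\<sigma> * \<zeta>) (Y k)) - P (Complex (\<sigma> * \<zeta>) (\<epsilon> k))) \<longlonglongrightarrow>
      \<i> * integral {0<..} (\<lambda>y. f (Complex (\<sigma> * \<zeta>) y))" if \<sigma>: "\<sigma> = 1 \<or> \<sigma> = -1" for \<sigma>
  proof -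
    let ?V = "\<lambda>y. f (Complex (\<sigma> * \<zeta>) y)"
    have ai: "?V absolutely_integrable_on {0<..}"
      unfolding f_def \<mu>_def by (rule mehler_fun_vertical_integral(1)[OF z \<sigma> lam nu])
    have "\<bar>\<sigma> * \<zeta>\<bar> < pi" using \<sigma> z by auto
    note v = vert[OF eY(1) eY(3) this]
    let ?F = "\<lambda>k y. if y \<in> {\<epsilon> k..Y k} then \<i> * ?V y else 0"
    have sub: "{\<epsilon> k..Y k} \<subseteq> {0<..}" for k using eY(1)[of k] by auto
    have F: "(?F k has_integral (P (Complex (\<sigma> * \<zeta>) (Y k)) - P (Complex (\<sigma> *
        \<zeta>) (\<epsilon> k)))) {0<..}" for k
      unfolding has_integral_restrict[OF sub] by (rule v)
    have h: "(\<lambda>y. norm (?V y)) integrable_on {0<..}" using ai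
        by (simp only: absolutely_integrable_on_def)
    have lim: "(\<lambda>k. ?F k y) \<longlonglongrightarrow> \<i> * ?V y" if "y \<in> {0<..}" for y
    proof (rule tendsto_eventually)
      have "eventually (\<lambda>k. \<epsilon> k < y) sequentially" using \<epsilon>_lim that by (intro order_tendstoD) auto
      moreover have "eventually (\<lambda>k. y \<le> Y k) sequentially" using Y_lim
          by (simp add: filterlim_at_top)
      ultimately show "eventually (\<lambda>k. ?F k y = \<i> * ?V y) sequentially" by eventually_elim auto
    qed
    have "(\<lambda>k. integral {0<..} (?F k)) \<longlonglongrightarrow> integral {0<..} (\<lambda>y. \<i> * ?V y)"
      using F by (intro dominated_convergence(2)[OF _ h _ lim]) (auto simp: norm_mult)
    thus ?thesis using integral_unique[OF F] by simp
  qed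
  let ?Vp = "integral {0<..} (\<lambda>y. f (Complex (1 * \<zeta>) y))" and ?Vm =
      "integral {0<..} (\<lambda>y. f (Complex ((-1) * \<zeta>) y))"
  \<comment> \<open>Top minus right side plus left side: the values of P at the upper corners cancel
    and the bottom side remains.\<close>
  have "(\<lambda>k. (P (Complex \<zeta> (Y k)) - P (Complex (-\<zeta>) (Y k))) - (P (Complex (1 *
      \<zeta>) (Y k)) - P (Complex (1 * \<zeta>) (\<epsilon> k)))
      + (P (Complex ((-1) * \<zeta>) (Y k)) - P (Complex ((-1) * \<zeta>) (\<epsilon> k)))) \<longlonglongrightarrow> 0 - \<i> * ?Vp + \<i> * ?Vm"
    by (intro tendsto_add tendsto_diff top vlim) auto
  hence "(\<lambda>k. P (Complex \<zeta> (\<epsilon> k)) - P (Complex (-\<zeta>) (\<epsilon> k))) \<longlonglongrightarrow> - \<i> * ?Vp + \<i> * ?Vm" by simp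
  from LIMSEQ_unique[OF bottom this] have eq: "2 * M = - \<i> * ?Vp + \<i> * ?Vm" .
  have Vp: "?Vp = exp (\<i> * of_real 1 * (\<nu> + lam) * of_real \<zeta>) * of_real (2 *
      sin \<zeta>) powr (lam - 1) * 
        exp (- (\<i> * of_real 1 * of_real pi / 2) * (lam - 1)) * euler_integral \<nu> lam (w_point 1 \<zeta>)"
    unfolding f_def \<mu>_def by (rule mehler_fun_vertical_integral(2)[OF z _ lam nu]) auto
  have Vm: "?Vm = exp (\<i> * of_real (-1) * (\<nu> + lam) * of_real \<zeta>) * of_real (2 *
      sin \<zeta>) powr (lam - 1) * 
        exp (- (\<i> * of_real (-1) * of_real pi / 2) * (lam - 1)) *
            euler_integral \<nu> lam (w_point (-1) \<zeta>)"
    unfolding f_def \<mu>_def by (rule mehler_fun_vertical_integral(2)[OF z _ lam nu]) auto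
  have expi: "exp (\<i> * of_real pi / 2) = \<i>" "exp (- (\<i> * of_real pi / 2)) = - \<i>"
    using exp_Euler[of "of_real pi / 2"] by (simp_all add: exp_minus)
  \<comment> \<open>The exponent -(i pi/2)(lam - 1) contains the surplus i pi/2, hence a factor i.
    It cancels the -i that the direction of the vertical path puts in front of this integral;
    \<open>em\<close> is the mirror image.\<close>
  have ep: "exp (\<i> * of_real 1 * (\<nu> + lam) * of_real \<zeta>) * exp (- (\<i> * of_real 1 * of_real pi /
      2) * (lam - 1)) = \<i> * exp (\<i> * \<delta>)"
  proof -
    have "exp (\<i> * of_real 1 * (\<nu> + lam) * of_real \<zeta>) * exp (- (\<i> * of_real 1 * of_real pi / 2) *
        (lam - 1)) = exp (\<i> * of_real pi / 2) * exp (\<i> * \<delta>)"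
      unfolding exp_add[symmetric] by (rule arg_cong[where f = exp]) (simp add: \<delta>_def field_simps)
    thus ?thesis by (simp only: expi)
  qed
  have em: "exp (\<i> * of_real (-1) * (\<nu> + lam) * of_real \<zeta>) * exp (- (\<i> * of_real (-1) *
      of_real pi / 2) * (lam - 1)) = - \<i> * exp (- (\<i> * \<delta>))"
  proof -
    have "exp (\<i> * of_real (-1) * (\<nu> + lam) * of_real \<zeta>) * exp (- (\<i> * of_real (-1) * of_real pi /
        2) * (lam - 1)) = exp (- (\<i> * of_real pi / 2)) * exp (- (\<i> * \<delta>))"
      unfolding exp_add[symmetric] by (rule arg_cong[where f = exp]) (simp add: \<delta>_def field_simps)
    thus ?thesis by (simp only: expi)
  qed
  define s where "s = complex_of_real (2 * sin \<zeta>) powr (lam - 1)"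
  have re: "a * s * b * J = a * b * (s * J)" for a b J by (simp only: mult_ac)
  have "?Vp = \<i> * exp (\<i> * \<delta>) * (s * euler_integral \<nu> lam (w_point 1 \<zeta>))"
    unfolding Vp s_def[symmetric] re ep ..
  moreover have "?Vm = - \<i> * exp (- (\<i> * \<delta>)) * (s * euler_integral \<nu> lam (w_point (-1) \<zeta>))"
    unfolding Vm s_def[symmetric] re em ..
  ultimately have "2 * M = s * (exp (\<i> * \<delta>) * euler_integral \<nu> lam (w_point 1 \<zeta>) + exp (- (\<i> *
      \<delta>)) * euler_integral \<nu> lam (w_point (-1) \<zeta>))"
    unfolding eq by (simp add: algebra_simps)
  thus ?thesis unfolding M_def \<mu>_def s_def .
qed

section \<open>The Gegenbauer function and its coefficients\<close>

text \<open>In terms of s = sin(\<zeta>/2) and c = cos(\<zeta>/2) every base is a positive monomial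
  in 2, s and c. All powers become exponentials of combinations of the three logarithms, and
  matching the prefactors is a linear identity in them.\<close>

lemma gegenbauer_C_euler:
  fixes \<nu> lam :: complex and \<zeta> :: real
  assumes z: "0 < \<zeta>" "\<zeta> < pi" and lam: "Re lam > 0" and nu: "Re \<nu> > -1"
  defines "\<delta> \<equiv> (\<nu> + lam) * of_real \<zeta> - lam * of_real (pi / 2)"
  shows "gegenbauer_C \<nu> lam (cos \<zeta>) = Gamma (\<nu> + 2 * lam) / (Gamma lam * of_real (2 *
      sin \<zeta>) powr lam) *
    ((exp (\<i> * \<delta>) * euler_integral \<nu> lam (w_point 1 \<zeta>) + exp (- (\<i> * \<delta>)) *
        euler_integral \<nu> lam (w_point (-1) \<zeta>)) / (Gamma lam * Gamma (\<nu> + 1)))"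
proof -
  define s where "s = sin (\<zeta> / 2)"
  define c where "c = cos (\<zeta> / 2)"
  have sc: "s > 0" "c > 0" using z by (auto simp: s_def c_def intro!: sin_gt_zero cos_gt_zero_pi)
  have sn: "sin \<zeta> = 2 * s * c" and cs: "1 - cos \<zeta> = 2 * s ^ 2" "1 + cos \<zeta> = 2 * c ^ 2"
    using sin_double[of "\<zeta> / 2"] cos_double_sin[of "\<zeta> / 2"] cos_double_cos[of "\<zeta> / 2"]
        by (auto simp: s_def c_def)
  have sz: "sin \<zeta> > 0" using z by (intro sin_gt_zero)
  have sq: "sqrt (1 - (cos \<zeta>)\<^sup>2) = sin \<zeta>" using sz by (simp add: sin_squared_eq[symmetric])
  define E where "E = exp (\<i> * \<delta>) * euler_integral \<nu> lam (w_point 1 \<zeta>) + exp (- (\<i> * \<delta>)) *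
      euler_integral \<nu> lam (w_point (-1) \<zeta>)"
  define F where "F = hypergeo_reg (\<nu> + lam + 1/2) (1/2 - (\<nu> + lam)) (1/2 + lam) (of_real (s\<^sup>2))"
  have FE: "2 * (of_real (4 * s\<^sup>2) powr (lam - 1) * of_real s * (of_real (sqrt pi) * Gamma lam *
      F)) = of_real (2 * sin \<zeta>) powr (lam - 1) * E"
    using mehler_euler_connection[OF z lam nu] mehler_dirichlet(2)[OF z lam, of "\<nu> + lam"] sc
    unfolding E_def F_def s_def \<delta>_def by simp
  define p1 where "p1 = complex_of_real (2 * sin \<zeta>) powr (lam - 1/2)"
  define p2 where "p2 = complex_of_real ((1 + cos \<zeta>) / (1 - cos \<zeta>)) powr ((1/2 - lam) / 2)"
  define p3 where "p3 = complex_of_real (4 * s\<^sup>2) powr (lam - 1)"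
  define p4 where "p4 = complex_of_real (2 * sin \<zeta>) powr (lam - 1)"
  define pl where "pl = complex_of_real (2 * sin \<zeta>) powr lam"
  define l2 where "l2 = complex_of_real (ln 2)"
  define ls where "ls = complex_of_real (ln s)"
  define lc where "lc = complex_of_real (ln c)"
  have pw: "complex_of_real x powr a = exp (a * of_real (ln x))" if "x > 0" for x a
    using that by (simp add: powr_def Ln_of_real)
  have L1: "complex_of_real (ln (2 * sin \<zeta>)) = 2 * l2 + ls + lc"
  proof -
    have "ln (2 * sin \<zeta>) = ln (2 * 2 * s * c)" by (simp add: sn mult.assoc)
    also have "\<dots> = 2 * ln 2 + ln s + ln c" using sc
        by (simp only: ln_mult_pos mult_pos_pos zero_less_numeral)
    finally show ?thesis by (simp add: l2_def ls_def lc_def)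
  qed
  have L2: "complex_of_real (ln ((1 + cos \<zeta>) / (1 - cos \<zeta>))) = 2 * lc - 2 * ls"
  proof -
    have "ln ((1 + cos \<zeta>) / (1 - cos \<zeta>)) = ln (c ^ 2 / s ^ 2)" by (simp add: cs)
    also have "\<dots> = 2 * ln c - 2 * ln s" using sc by (simp add: ln_div ln_realpow)
    finally show ?thesis by (simp add: ls_def lc_def)
  qed
  have L3: "complex_of_real (ln (4 * s\<^sup>2)) = 2 * l2 + 2 * ls"
  proof -
    have "ln (4 * s\<^sup>2) = ln (2 ^ 2 * s ^ 2)" by simp
    also have "\<dots> = 2 * ln 2 + 2 * ln s" using sc
        by (simp only: ln_mult_pos zero_less_power zero_less_numeral ln_realpow of_nat_numeral)
    finally show ?thesis by (simp add: l2_def ls_def)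
  qed
  have es: "complex_of_real s = exp ls" and e2: "2 = exp l2" using sc
      by (simp_all add: ls_def l2_def exp_of_real)
  have pos: "2 * sin \<zeta> > 0" "(1 + cos \<zeta>) / (1 - cos \<zeta>) > 0" "4 * s\<^sup>2 > 0" using sz sc
      by (auto simp: cs)
  have pe: "p1 = exp ((lam - 1/2) * (2 * l2 + ls + lc))" "p2 = exp ((1/2 - lam) / 2 * (2 *
      lc - 2 * ls))"
     "p3 = exp ((lam - 1) * (2 * l2 + 2 * ls))" "p4 = exp ((lam - 1) * (2 * l2 + ls + lc))" "pl =
         exp (lam * (2 * l2 + ls + lc))"
    unfolding p1_def p2_def p3_def p4_def pl_def pw[OF pos(1)] pw[OF pos(2)] pw[OF pos(3)] L1 L2
        L3 by (rule refl)+
  have key: "p2 * p4 * pl = exp l2 * p1 * p3 * of_real s"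
    unfolding pe es exp_add[symmetric] by (rule arg_cong[where f = exp]) (simp add: field_simps)
  have nz: "p1 \<noteq> 0" "p3 \<noteq> 0" "p4 \<noteq> 0" "pl \<noteq> 0" unfolding pe by auto
  have "lam \<notin> \<int>\<^sub>\<le>\<^sub>0" "\<nu> + 1 \<notin> \<int>\<^sub>\<le>\<^sub>0" using lam nu by (auto intro!: Re_pos_not_nonpos_Ints)
  hence gz: "Gamma lam \<noteq> 0" "Gamma (\<nu> + 1) \<noteq> 0" by (auto simp: Gamma_eq_zero_iff)
  have "hypergeo_reg ((\<nu> + lam - 1/2) + 1) (- (\<nu> + lam - 1/2)) (1 - (1/2 - lam)) (of_real ((1 -
      cos \<zeta>) / 2)) = F"
    unfolding F_def by (simp add: cs algebra_simps)
  hence "gegenbauer_C \<nu> lam (cos \<zeta>) = of_real (sqrt pi) * Gamma (\<nu> + 2 * lam) / (Gamma lam *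
      Gamma (\<nu> + 1) * p1) * (p2 * F)"
    unfolding gegenbauer_C_def ferrers_P_def sq p1_def p2_def by (simp only:)
  also have "\<dots> = Gamma (\<nu> + 2 * lam) / (Gamma lam * pl) * (E / (Gamma lam * Gamma (\<nu> + 1)))"
  proof -
    have E: "E = 2 * (p3 * of_real s * (of_real (sqrt pi) * Gamma lam * F)) / p4"
      using FE nz unfolding p3_def[symmetric] p4_def[symmetric] by simp
    have "of_real (sqrt pi) * (p2 * F) * (pl * Gamma lam) = E * p1"
    proof -
      have "of_real (sqrt pi) * (p2 * F) * (pl * Gamma lam) * p4 = (p2 * p4 * pl) *
          (of_real (sqrt pi) * F * Gamma lam)"
        by (simp only: mult_ac)
      also have "\<dots> = (2 * (p3 * of_real s * (of_real (sqrt pi) * Gamma lam * F))) * p1"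
        unfolding key e2[symmetric] by (simp only: mult_ac)
      also have "\<dots> = E * p1 * p4" unfolding E using nz by simp
      finally show ?thesis using nz by simp
    qed
    hence "of_real (sqrt pi) * (p2 * F) / p1 = E / (pl * Gamma lam)"
      using nz gz by (simp add: frac_eq_eq)
    moreover have "of_real (sqrt pi) * Gamma (\<nu> + 2 * lam) / (Gamma lam * Gamma (\<nu> + 1) * p1) *
        (p2 * F) = 
       (of_real (sqrt pi) * (p2 * F) / p1) * (Gamma (\<nu> + 2 * lam) / (Gamma lam * Gamma (\<nu> + 1)))"
      by (simp add: mult_ac)
    ultimately show ?thesis by (simp add: mult_ac)
  qed
  finally show ?thesis unfolding E_def pl_def .
qed

section \<open>The asymptotic coefficients and their limiting values\<close>

lemma a_coeff_pochhammer:
  fixes x :: "'a :: field_char_0"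
  shows "a_coeff n (x - 1/2) = (-1) ^ n * pochhammer x n * pochhammer (1 - x) n / (2 ^ n * fact n)"
proof -
  have "(\<Prod>j=1..n. 4 * (x - 1/2)\<^sup>2 - (of_nat (2 * j - 1))\<^sup>2) = (-4) ^ n * (pochhammer x n *
      pochhammer (1 - x) n)"
  proof (induction n)
    case (Suc n)
    \<comment> \<open>Difference of the squares of 2x - 1 and 2n + 1; the two linear factors extend
      the two Pochhammer symbols by one factor each.\<close>
    have "4 * (x - 1/2)\<^sup>2 - (of_nat (2 * Suc n - 1))\<^sup>2 = (-4) * ((x + of_nat n) * (1 - x +
        of_nat n))"
      by (simp add: power2_eq_square algebra_simps)
    moreover have "(\<Prod>j=1..Suc n. 4 * (x - 1/2)\<^sup>2 - (of_nat (2 * j - 1))\<^sup>2) =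
        (\<Prod>j=1..n. 4 * (x - 1/2)\<^sup>2 - (of_nat (2 * j - 1))\<^sup>2) * (4 * (x - 1/2)\<^sup>2 - (of_nat (2 *
            Suc n - 1))\<^sup>2)"
      by (subst prod.nat_ivl_Suc') (auto simp: mult.commute)
    ultimately have "(\<Prod>j=1..Suc n. 4 * (x - 1/2)\<^sup>2 - (of_nat (2 * j - 1))\<^sup>2) =
        ((-4) ^ n * (pochhammer x n * pochhammer (1 - x) n)) * ((-4) * ((x + of_nat n) * (1 - x +
            of_nat n)))"
      using Suc by (simp only:)
    thus ?case unfolding pochhammer_Suc power_Suc by (simp only: mult_ac)
  qed auto
  moreover have "(-4 :: 'a) ^ n / 8 ^ n = (-1) ^ n / 2 ^ n"
    by (simp flip: power_divide)
  ultimately show ?thesis unfolding a_coeff_def by (simp add: field_simps)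
qed

text \<open>The real case of \<open>sin_Beta_pochhammer\<close>. On 0 < x < k + 1 the Gamma values
  are positive, so the absolute value falls on the sine alone.\<close>

lemma abs_pochhammer_reflection:
  fixes x :: real
  assumes "0 < x" "x < real k + 1"
  shows "\<bar>pochhammer (1 - x) k\<bar> = \<bar>sin (pi * x)\<bar> / pi * (Gamma (real k + 1 - x) * Gamma x)"
proof -
  have "sin (of_real pi * of_real x) / of_real pi * Beta (of_nat k + 1 - of_real x) (of_real x) =
      pochhammer (1 - complex_of_real x) k / fact k"
    using assms by (intro sin_Beta_pochhammer) auto
  moreover have "of_nat k + 1 - of_real x = complex_of_real (real k + 1 - x)" by simp
  moreover have "pochhammer (1 - complex_of_real x) k = of_real (pochhammer (1 - x) k)"
    by (simp flip: pochhammer_of_real)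
  ultimately have "complex_of_real (sin (pi * x) / pi * Beta (real k + 1 - x) x) =
      of_real (pochhammer (1 - x) k / fact k)"
    by (simp only: Beta_complex_of_real) (simp flip: sin_of_real)
  hence "sin (pi * x) / pi * Beta (real k + 1 - x) x = pochhammer (1 - x) k / fact k"
      by (simp only: of_real_eq_iff)
  moreover have "Beta (real k + 1 - x) x = Gamma (real k + 1 - x) * Gamma x / fact k"
    using Gamma_fact[of k, where ?'a = real] by (simp add: Beta_def add_ac)
  ultimately have "sin (pi * x) / pi * (Gamma (real k + 1 - x) * Gamma x / fact k) =
      pochhammer (1 - x) k / fact k"
    by (simp only:)
  hence "pochhammer (1 - x) k = sin (pi * x) / pi * (Gamma (real k + 1 - x) * Gamma x)"
      by (simp add: field_simps)
  moreover have "Gamma (real k + 1 - x) * Gamma x > 0" using assms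
      by (intro mult_pos_pos Gamma_real_pos) auto
  ultimately show ?thesis by (simp only: abs_mult[of "sin (pi * x) / pi"]) simp
qed

lemma a_coeff_div_sin:
  fixes x :: real
  assumes x: "0 < x" "x < real k + 1" and ni: "x \<notin> \<int>"
  shows "\<bar>a_coeff k (x - 1/2)\<bar> / \<bar>sin (pi * x)\<bar> = Gamma (x + real k) * Gamma (real k + 1 - x) /
      (pi * 2 ^ k * fact k)"
proof -
  have "sin (pi * x) \<noteq> 0"
  proof
    assume "sin (pi * x) = 0"
    then obtain i :: int where "pi * x = of_int i * pi" using sin_zero_iff_int2 by blast
    hence "x = of_int i" by simp
    with ni show False by simp
  qed
  hence s: "\<bar>sin (pi * x)\<bar> > 0" by simp
  have "x \<notin> \<int>\<^sub>\<le>\<^sub>0" using x by (auto elim!: nonpos_Ints_cases)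
  hence g: "pochhammer x k = Gamma (x + real k) / Gamma x" by (rule pochhammer_Gamma)
  have gp: "Gamma x > 0" "Gamma (x + real k) > 0" using x by (auto intro!: Gamma_real_pos)
  have "\<bar>a_coeff k (x - 1/2)\<bar> = pochhammer x k * \<bar>pochhammer (1 - x) k\<bar> / (2 ^ k * fact k)"
    unfolding a_coeff_pochhammer g using gp by (simp add: abs_mult)
  thus ?thesis unfolding abs_pochhammer_reflection[OF x] g using s gp by (simp add: field_simps)
qed

text \<open>Off the integers the sine cancels by reflection. The right-hand side is continuous at r
  even when r is an integer, so it is also the limiting value there, and one closed form covers both
  branches of the definition.\<close>

lemma a_sin_quot_Gamma:
  assumes r: "0 < r" "r < real k + 1"
  shows "a_sin_quot k r = Gamma (r + real k) * Gamma (real k + 1 - r) / (pi * 2 ^ k * fact k)"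
proof (cases "r \<in> \<int>")
  case False
  thus ?thesis using a_coeff_div_sin[OF r False] by (simp add: a_sin_quot_def)
next
  case True
  let ?h = "\<lambda>x. Gamma (x + real k) * Gamma (real k + 1 - x) / (pi * 2 ^ k * fact k)"
  have np: "r + real k \<notin> \<int>\<^sub>\<le>\<^sub>0" "real k + 1 - r \<notin> \<int>\<^sub>\<le>\<^sub>0" using r by (auto elim!: nonpos_Ints_cases)
  have "(?h \<longlongrightarrow> ?h r) (at r)" using np by (intro tendsto_intros) auto
  moreover have "eventually (\<lambda>x. ?h x = \<bar>a_coeff k (x - 1 / 2)\<bar> / \<bar>sin (pi * x)\<bar>) (at r)"
  proof -
    have "eventually (\<lambda>x. x \<in> {0<..<real k + 1}) (at r)"
      using r by (intro eventually_at_in_open') auto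
    \<comment> \<open>The punctured unit neighbourhood of the integer r contains no integer, so the
      quotient formula applies on it.\<close>
    moreover have "eventually (\<lambda>x. x \<in> {r - 1<..<r + 1} - {r}) (at r)"
      by (intro eventually_at_in_open) auto
    ultimately show ?thesis
    proof eventually_elim
      case (elim x)
      obtain i where i: "r = of_int i" using True by (auto elim: Ints_cases)
      have "x \<notin> \<int>"
      proof
        assume "x \<in> \<int>"
        then obtain j where "x = of_int j" by (auto elim: Ints_cases)
        with elim i have "real_of_int (i - 1) < real_of_int j" "real_of_int j < real_of_int (i +
            1)" "j \<noteq> i" by auto
        thus False by (simp only: of_int_less_iff)
      qed
      with elim show ?case by (intro a_coeff_div_sin[symmetric]) auto
    qed
  qed
  ultimately have "((\<lambda>x. \<bar>a_coeff k (x - 1 / 2)\<bar> / \<bar>sin (pi * x)\<bar>) \<longlongrightarrow> ?h r) (at r)"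
    by (rule Lim_transform_eventually)
  hence "Lim (at r) (\<lambda>x. \<bar>a_coeff k (x - 1 / 2)\<bar> / \<bar>sin (pi * x)\<bar>) = ?h r"
    by (intro tendsto_Lim) auto
  thus ?thesis using True by (simp add: a_sin_quot_def)
qed

section \<open>Error bounds\<close>

text \<open>D is |1 - w s|^2, a quadratic in s with minimum cos^2 \<zeta> at s = 2 sin^2 \<zeta>.
  That point lies in [0, 1] exactly in the two outer ranges of \<zeta>; in the middle range D
  decreases on [0, 1] and its minimum is the value 1 / (4 sin^2 \<zeta>) at s = 1. In all ranges
  \<open>s_factor\<close> is the reciprocal root of the minimum. The third inequality serves the
  cotangent term of the second bound.\<close>

lemma s_factor_bounds:
  fixes \<zeta> s :: real
  assumes z: "0 < \<zeta>" "\<zeta> < pi" and s: "0 \<le> s" "s \<le> 1"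
  defines "D \<equiv> 1 - s + s\<^sup>2 / (4 * (sin \<zeta>)\<^sup>2)"
  shows "s_factor \<zeta> > 0" "1 \<le> (s_factor \<zeta>)\<^sup>2 * D" "\<bar>cos \<zeta>\<bar> \<le> s_factor \<zeta> * D"
proof -
  have sz: "sin \<zeta> > 0" using z by (intro sin_gt_zero)
  have "s_factor \<zeta> > 0 \<and> 1 \<le> (s_factor \<zeta>)\<^sup>2 * D \<and> \<bar>cos \<zeta>\<bar> \<le> s_factor \<zeta> * D"
  proof (cases "\<zeta> \<le> pi / 4 \<or> 3 * pi / 4 \<le> \<zeta>")
    case True
    have sf: "s_factor \<zeta> = 1 / \<bar>cos \<zeta>\<bar>" using True z by (auto simp: s_factor_def)
    have c: "cos \<zeta> \<noteq> 0"
    proof (cases "\<zeta> \<le> pi / 4")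
      case True
      thus ?thesis using z cos_gt_zero[of \<zeta>] by auto
    next
      case False
      hence "cos (pi - \<zeta>) > 0" using z \<open>\<zeta> \<le> pi / 4 \<or> 3 * pi / 4 \<le> \<zeta>\<close> by (intro cos_gt_zero) auto
      thus ?thesis by simp
    qed
    have "1 - s + s\<^sup>2 / (4 * q\<^sup>2) - (1 - q\<^sup>2) = (s / (2 * q) - q)\<^sup>2" if "q > 0" for q :: real
      using that by (simp add: field_simps power2_eq_square)
    from this[OF sz] have "D - (cos \<zeta>)\<^sup>2 = (s / (2 * sin \<zeta>) - sin \<zeta>)\<^sup>2"
      unfolding D_def cos_squared_eq .
    hence D: "D \<ge> \<bar>cos \<zeta>\<bar>\<^sup>2" using zero_le_power2[of "s / (2 * sin \<zeta>) - sin \<zeta>"]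
        unfolding power2_abs by linarith
    define c where "c = \<bar>cos \<zeta>\<bar>"
    have "c > 0" using c by (simp add: c_def)
    thus ?thesis using D unfolding sf c_def[symmetric] by (auto simp: field_simps power2_eq_square)
  next
    case False
    have sf: "s_factor \<zeta> = 2 * sin \<zeta>" using False by (auto simp: s_factor_def)
    have "cos (2 * \<zeta> - pi) \<ge> 0" using False by (intro cos_ge_zero) auto
    hence "cos (2 * \<zeta>) \<le> 0" by (simp add: cos_diff)
    hence s2: "1 \<le> 2 * (sin \<zeta>)\<^sup>2" by (simp add: cos_double_sin)
    \<comment> \<open>The difference vanishes at s = 1, which gives the factor 1 - s. The other
      factor is nonnegative because 4 sin^2 \<zeta> \<ge> 2 \<ge> 1 + s in the middle range.\<close>
    have "4 * (sin \<zeta>)\<^sup>2 * D - 1 = (1 - s) * (4 * (sin \<zeta>)\<^sup>2 - (1 + s))"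
      using sz by (simp add: D_def field_simps power2_eq_square)
    also have "\<dots> \<ge> 0" using s s2 by (intro mult_nonneg_nonneg) auto
    finally have D: "1 \<le> 4 * (sin \<zeta>)\<^sup>2 * D" by simp
    have "2 * sin \<zeta> * \<bar>cos \<zeta>\<bar> = \<bar>sin (2 * \<zeta>)\<bar>" using sz by (simp add: sin_double abs_mult)
    also have "\<dots> \<le> 1" by simp
    also have "1 \<le> 2 * sin \<zeta> * (2 * sin \<zeta> * D)" using D by (simp add: power2_eq_square)
    finally have "\<bar>cos \<zeta>\<bar> \<le> 2 * sin \<zeta> * D" by (rule mult_left_le_imp_le) (use sz in simp)
    thus ?thesis unfolding sf using D sz by (simp add: power_mult_distrib)
  qed
  thus "s_factor \<zeta> > 0" "1 \<le> (s_factor \<zeta>)\<^sup>2 * D" "\<bar>cos \<zeta>\<bar> \<le> s_factor \<zeta> * D" by auto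
qed

lemma norm_w_denominator:
  assumes z: "0 < \<zeta>" "\<zeta> < pi" and \<sigma>: "\<sigma> = 1 \<or> \<sigma> = -1"
  shows "(norm (1 - w_point \<sigma> \<zeta> * of_real s))\<^sup>2 = 1 - s + s\<^sup>2 / (4 * (sin \<zeta>)\<^sup>2)"
proof -
  have sz: "sin \<zeta> > 0" using z by (intro sin_gt_zero)
  have "(norm (1 - w_point \<sigma> \<zeta> * of_real s))\<^sup>2 = (1 - s / 2)\<^sup>2 + (\<sigma> * cot \<zeta> / 2 * s)\<^sup>2"
    by (simp add: cmod_power2)
  also have "(\<sigma> * cot \<zeta> / 2 * s)\<^sup>2 = (1 - (sin \<zeta>)\<^sup>2) / (4 * (sin \<zeta>)\<^sup>2) * s\<^sup>2"
    using \<sigma> by (auto simp: cot_def power_mult_distrib power_divide cos_squared_eq)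
  finally show ?thesis using sz by (simp add: field_simps power2_eq_square)
qed

lemma norm_inverse_w_denominator_le:
  assumes z: "0 < \<zeta>" "\<zeta> < pi" and \<sigma>: "\<sigma> = 1 \<or> \<sigma> = -1" and s: "0 \<le> s" "s \<le> 1"
  shows "1 / norm (1 - w_point \<sigma> \<zeta> * of_real s) \<le> s_factor \<zeta>"
proof -
  define n where "n = norm (1 - w_point \<sigma> \<zeta> * of_real s)"
  have "1 \<le> (s_factor \<zeta> * n)\<^sup>2" using s_factor_bounds(2)[OF z s] norm_w_denominator[OF z \<sigma>, of s]
    by (simp add: n_def power_mult_distrib)
  moreover have "n \<ge> 0" by (simp add: n_def)
  ultimately have "1 \<le> s_factor \<zeta> * n" using s_factor_bounds(1)[OF z s] power2_le_imp_le[of 1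
      "s_factor \<zeta> * n"] by simp
  moreover from this have "n > 0" using \<open>n \<ge> 0\<close> by (cases "n = 0") auto
  ultimately show ?thesis unfolding n_def[symmetric] by (simp add: field_simps)
qed

section \<open>The phase factor under the remainder integral\<close>

definition phase_kernel :: "real \<Rightarrow> complex \<Rightarrow> real \<Rightarrow> complex" where
  "phase_kernel \<zeta> \<delta> s = exp (\<i> * \<delta>) * (1 / (1 - w_point 1 \<zeta> * of_real s)) + exp (- (\<i> * \<delta>)) * (1 /
      (1 - w_point (-1) \<zeta> * of_real s))"

lemma norm_phase_kernel_le_cosh:
  assumes z: "0 < \<zeta>" "\<zeta> < pi" and s: "0 \<le> s" "s \<le> 1"
  shows "norm (phase_kernel \<zeta> \<delta> s) \<le> 2 * cosh (Im \<delta>) * s_factor \<zeta>"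
proof -
  have "norm (phase_kernel \<zeta> \<delta> s) \<le> norm (exp (\<i> * \<delta>) * (1 / (1 - w_point 1 \<zeta> * of_real s))) +
      norm (exp (- (\<i> * \<delta>)) * (1 / (1 - w_point (-1) \<zeta> * of_real s)))"
    unfolding phase_kernel_def by (rule norm_triangle_ineq)
  also have "\<dots> = exp (- Im \<delta>) * (1 / norm (1 - w_point 1 \<zeta> * of_real s)) + exp (Im \<delta>) * (1 /
      norm (1 - w_point (-1) \<zeta> * of_real s))"
    by (simp add: norm_mult norm_divide)
  also have "\<dots> \<le> exp (- Im \<delta>) * s_factor \<zeta> + exp (Im \<delta>) * s_factor \<zeta>"
    by (intro add_mono mult_left_mono norm_inverse_w_denominator_le z s) auto
  also have "\<dots> = 2 * cosh (Im \<delta>) * s_factor \<zeta>" by (simp add: cosh_def algebra_simps)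
  finally show ?thesis .
qed

text \<open>The denominators are conjugate with product D, so the sum is one fraction with numerator
  (2 - s) cos \<delta> + s cot \<zeta> sin \<delta>. The factor s is kept in the second part: it
  carries that part to the next order of the expansion.\<close>

lemma norm_phase_kernel_le_cos_sin:
  assumes z: "0 < \<zeta>" "\<zeta> < pi" and s: "0 \<le> s" "s \<le> 1"
  shows "norm (phase_kernel \<zeta> \<delta> s) \<le> 2 * norm (cos \<delta>) * s_factor \<zeta> + norm (sin \<delta>) / sin \<zeta> *
      s_factor \<zeta> * s"
proof -
  define D where "D = 1 - s + s\<^sup>2 / (4 * (sin \<zeta>)\<^sup>2)"
  define p where "p = 1 - w_point 1 \<zeta> * of_real s"
  define p' where "p' = 1 - w_point (-1) \<zeta> * of_real s"
  have sz: "sin \<zeta> > 0" using z by (intro sin_gt_zero)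
  have nD: "(norm p)\<^sup>2 = D" "(norm p')\<^sup>2 = D" unfolding p_def p'_def D_def
      by (intro norm_w_denominator z; simp)+
  have "Re p > 0" "Re p' > 0" using s by (auto simp: p_def p'_def)
  hence p0: "p \<noteq> 0" "p' \<noteq> 0" by auto
  have Dpos: "D > 0" unfolding nD(1)[symmetric] using p0 by simp
  have cnj: "p' = cnj p" by (simp add: p_def p'_def complex_eq_iff)
  have pp: "p * p' = of_real D" unfolding cnj complex_norm_square[symmetric] nD ..
  have pe: "p = of_real (1 - s / 2) + \<i> * of_real (s * cot \<zeta> / 2)" "p' = of_real (1 - s / 2) - \<i> *
      of_real (s * cot \<zeta> / 2)"
    by (simp_all add: p_def p'_def complex_eq_iff)
  have cs: "exp (\<i> * \<delta>) + exp (- (\<i> * \<delta>)) = 2 * cos \<delta>" "exp (\<i> * \<delta>) - exp (- (\<i> * \<delta>)) = 2 * \<i> *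
      sin \<delta>"
    by (simp_all add: cos_exp_eq sin_exp_eq)
  have "phase_kernel \<zeta> \<delta> s = (exp (\<i> * \<delta>) * p' + exp (- (\<i> * \<delta>)) * p) / of_real D"
    unfolding phase_kernel_def p_def[symmetric] p'_def[symmetric] pp[symmetric] using p0
        by (simp add: field_simps)
  also have "exp (\<i> * \<delta>) * p' + exp (- (\<i> * \<delta>)) * p = of_real (1 - s / 2) * (exp (\<i> * \<delta>) +
      exp (- (\<i> * \<delta>))) - \<i> * of_real (s * cot \<zeta> / 2) * (exp (\<i> * \<delta>) - exp (- (\<i> * \<delta>)))"
  proof -
    have "e * (a - \<i> * b) + e' * (a + \<i> * b) = a * (e + e') - \<i> * b * (e - e')"
        for a b e e' :: complex
      by (simp add: algebra_simps)
    thus ?thesis unfolding pe .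
  qed
  also have "\<dots> = 2 * of_real (1 - s / 2) * cos \<delta> + of_real (s * cot \<zeta>) * sin \<delta>"
    unfolding cs by (simp add: algebra_simps)
  finally have "norm (phase_kernel \<zeta> \<delta> s) = norm (2 * of_real (1 - s / 2) * cos \<delta> + of_real (s *
      cot \<zeta>) * sin \<delta>) / D"
    using Dpos by (simp add: norm_divide)
  also have "\<dots> \<le> (2 * (1 - s / 2) * norm (cos \<delta>) + s * \<bar>cot \<zeta>\<bar> * norm (sin \<delta>)) / D"
  proof (intro divide_right_mono)
    have "norm (2 * of_real (1 - s / 2) * cos \<delta>) = 2 * (1 - s / 2) * norm (cos \<delta>)"
      using s by (simp only: norm_mult norm_of_real) simp
    moreover have "norm (of_real (s * cot \<zeta>) * sin \<delta>) = s * \<bar>cot \<zeta>\<bar> * norm (sin \<delta>)"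
      using s by (simp add: norm_mult abs_mult)
    ultimately show "norm (2 * of_real (1 - s / 2) * cos \<delta> + of_real (s * cot \<zeta>) * sin \<delta>) \<le> 2 *
        (1 - s / 2) * norm (cos \<delta>) + s * \<bar>cot \<zeta>\<bar> * norm (sin \<delta>)"
      using norm_triangle_ineq[of "2 * of_real (1 - s / 2) * cos \<delta>" "of_real (s * cot \<zeta>) * sin \<delta>"]
          by linarith
  qed (use Dpos in simp)
  also have "\<dots> = 2 * norm (cos \<delta>) * ((1 - s / 2) / D) + norm (sin \<delta>) * (\<bar>cot \<zeta>\<bar> / D) * s"
    by (simp add: add_divide_distrib mult_ac)
  also have "\<dots> \<le> 2 * norm (cos \<delta>) * s_factor \<zeta> + norm (sin \<delta>) * (s_factor \<zeta> / sin \<zeta>) * s"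
  proof -
    \<comment> \<open>This number is the real part of p, hence at most |p|, while D = |p|^2; the
      quotient is therefore at most 1 / |p|.\<close>
    have "1 - s / 2 = Re p" by (simp add: p_def)
    also have "\<dots> \<le> norm p" by (rule complex_Re_le_cmod)
    finally have "(1 - s / 2) / D \<le> norm p / D" using Dpos by (intro divide_right_mono) auto
    also have "\<dots> = 1 / norm p" unfolding nD(1)[symmetric] using p0 by (simp add: power2_eq_square)
    also have "\<dots> \<le> s_factor \<zeta>" unfolding p_def by (intro norm_inverse_w_denominator_le z s) auto
    finally have 1: "(1 - s / 2) / D \<le> s_factor \<zeta>" .
    have "\<bar>cot \<zeta>\<bar> / D = \<bar>cos \<zeta>\<bar> / D / sin \<zeta>" using sz by (simp add: cot_def)
    also have "\<dots> \<le> s_factor \<zeta> / sin \<zeta>"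
      using s_factor_bounds(3)[OF z s] sz Dpos unfolding D_def[symmetric]
          by (intro divide_right_mono) (simp_all add: pos_divide_le_eq)
    finally have 2: "\<bar>cot \<zeta>\<bar> / D \<le> s_factor \<zeta> / sin \<zeta>" .
    show ?thesis using s by (intro add_mono mult_left_mono mult_right_mono 1 2) auto
  qed
  finally show ?thesis by simp
qed

section \<open>Expansion and integral form of the remainder\<close>

lemma euler_integral_expansion:
  fixes \<nu> lam w :: complex
  assumes lam: "0 < Re lam" "Re lam < real N + 1" and nu: "Re \<nu> > -1" and w: "w \<in> cut_plane"
  defines "k \<equiv> beta_kernel (of_nat N + 1 - lam) lam"
  shows "euler_integral \<nu> lam w = (\<Sum>n<N. pochhammer (1 - lam) n / fact n * w ^ n * Beta (lam +
      of_nat n) (\<nu> + 1)) +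
    w ^ N * (sin (of_real pi * lam) / of_real pi) * integral {0<..<1} (\<lambda>t. stieltjes k (w *
        of_real t) * beta_kernel (lam + of_nat N) (\<nu> + 1) t)"
proof -
  define sp where "sp = sin (of_real pi * lam) / of_real pi"
  define h where "h = (\<lambda>t. stieltjes k (w * of_real t) * beta_kernel (lam + of_nat N) (\<nu> + 1) t)"
  have k: "k absolutely_integrable_on {0<..<1}" unfolding k_def using lam
      by (intro beta_kernel_absolutely_integrable) auto
  have "h absolutely_integrable_on {0<..<1}"
    unfolding h_def using lam nu
    by (intro cut_plane_ray_absolutely_integrable[where G =
        "stieltjes k"] w stieltjes_holomorphic k beta_kernel_absolutely_integrable) auto
  hence h: "(h has_integral integral {0<..<1} h) {0<..<1}"
      by (rule absolutely_integrable_on_has_integral)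
  have "((\<lambda>t. (\<Sum>n<N. pochhammer (1 - lam) n / fact n * w ^ n * beta_kernel (lam + of_nat n) (\<nu> +
      1) t) + w ^ N * sp * h t) has_integral
     ((\<Sum>n<N. pochhammer (1 - lam) n / fact n * w ^ n * Beta (lam + of_nat n) (\<nu> + 1)) + w ^ N *
         sp * integral {0<..<1} h)) {0<..<1}"
    using lam nu by (intro has_integral_add has_integral_sum has_integral_mult_right
        has_integral_beta_kernel h) auto
  hence "((\<lambda>t. (1 - w * of_real t) powr (lam - 1) * beta_kernel lam (\<nu> + 1) t) has_integral
     ((\<Sum>n<N. pochhammer (1 - lam) n / fact n * w ^ n * Beta (lam + of_nat n) (\<nu> + 1)) + w ^ N *
         sp * integral {0<..<1} h)) {0<..<1}"
  proof (rule has_integral_eq[rotated])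
    fix t :: real assume t: "t \<in> {0<..<1}"
    have wt: "w * of_real t \<in> cut_plane" using cut_plane_scale(1)[OF w, of t] t
        by (simp add: mult.commute)
    show "(\<Sum>n<N. pochhammer (1 - lam) n / fact n * w ^ n * beta_kernel (lam + of_nat n) (\<nu> +
        1) t) + w ^ N * sp * h t =
      (1 - w * of_real t) powr (lam - 1) * beta_kernel lam (\<nu> + 1) t"
      unfolding binomial_remainder_stieltjes[OF lam wt] k_def[symmetric] sp_def[symmetric] h_def
          beta_kernel_plus_nat_left[OF t]
        distrib_right sum_distrib_right power_mult_distrib
      by (simp only: mult_ac)
  qed
  thus ?thesis unfolding euler_integral_def h_def sp_def by (rule integral_unique)
qed

lemma phase_delta_conv: "phase_delta \<zeta> lam \<nu> n = phase_delta \<zeta> lam \<nu> 0 + of_nat n * of_real (\<zeta> +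
    pi / 2)"
  by (simp add: phase_delta_def field_simps)

text \<open>The point w has argument \<sigma> (\<zeta> + pi/2) up to a negative real factor, and
  \<zeta> + pi/2 is the increment of the phases. Multiplying by w^n thus moves the phase from index
  0 to index n at the cost of a real factor.\<close>

lemma exp_phase_w_power:
  assumes z: "0 < \<zeta>" "\<zeta> < pi" and \<sigma>: "\<sigma> = 1 \<or> \<sigma> = -1"
  shows "exp (of_real \<sigma> * (\<i> * phase_delta \<zeta> lam \<nu> 0)) * w_point \<sigma> \<zeta> ^ n =
     of_real ((-1 / (2 * sin \<zeta>)) ^ n) * exp (of_real \<sigma> * (\<i> * phase_delta \<zeta> lam \<nu> n))"
proof -
  have sz: "sin \<zeta> > 0" using z by (intro sin_gt_zero)
  have "exp (of_real \<sigma> * (\<i> * of_real (\<zeta> + pi / 2))) = cis (\<sigma> * (\<zeta> + pi / 2))"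
    by (simp add: cis_conv_exp mult_ac)
  also have "\<dots> = Complex (- sin \<zeta>) (\<sigma> * cos \<zeta>)"
    using \<sigma> by (auto simp: complex_eq_iff cos_add sin_add cos_diff sin_diff algebra_simps)
  finally have w: "w_point \<sigma> \<zeta> = of_real (-1 / (2 * sin \<zeta>)) * exp (of_real \<sigma> * (\<i> * of_real (\<zeta> +
      pi / 2)))"
    using sz by (simp add: complex_eq_iff cot_def)
  have "exp (of_real \<sigma> * (\<i> * phase_delta \<zeta> lam \<nu> 0)) * exp (of_real \<sigma> * (\<i> * of_real (\<zeta> + pi /
      2))) ^ n = exp (of_real \<sigma> * (\<i> * phase_delta \<zeta> lam \<nu> n))"
    unfolding phase_delta_conv[of \<zeta> lam \<nu> n] exp_of_nat_mult[symmetric] exp_add[symmetric] 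
    by (rule arg_cong[where f = exp]) (simp add: algebra_simps)
  from this[symmetric] show ?thesis unfolding w power_mult_distrib of_real_power
    by (simp only: mult.left_commute[of "exp (of_real \<sigma> * (\<i> * phase_delta \<zeta> lam \<nu> 0))"])
qed

text \<open>The sign and the power of 2 in (-1 / (2 S))^n are those in
  \<open>a_coeff_pochhammer\<close>. The first of its two Pochhammer symbols comes from Gamma(lam +
  n) in the Beta value, the second from the binomial coefficient.\<close>

lemma a_coeff_Beta:
  fixes lam \<nu> :: complex
  assumes lam: "Re lam > 0" and nu: "Re \<nu> > -1"
  shows "pochhammer (1 - lam) n / fact n * Beta (lam + of_nat n) (\<nu> + 1) / (Gamma lam * Gamma (\<nu> +
      1)) * (-1 / (2 * S)) ^ n =
    a_coeff n (lam - 1/2) / (Gamma (\<nu> + lam + of_nat n + 1) * S ^ n)"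
proof -
  have np: "lam \<notin> \<int>\<^sub>\<le>\<^sub>0" "\<nu> + 1 \<notin> \<int>\<^sub>\<le>\<^sub>0" using lam nu by (auto intro!: Re_pos_not_nonpos_Ints)
  hence gz: "Gamma lam \<noteq> 0" "Gamma (\<nu> + 1) \<noteq> 0" by (auto simp: Gamma_eq_zero_iff)
  have "Gamma (lam + of_nat n) = pochhammer lam n * Gamma lam"
      using pochhammer_Gamma[OF np(1), of n] gz by simp
  hence "Beta (lam + of_nat n) (\<nu> + 1) / (Gamma lam * Gamma (\<nu> + 1)) = pochhammer lam n /
      Gamma (\<nu> + lam + of_nat n + 1)"
    using gz by (simp add: Beta_def add_ac)
  hence "pochhammer (1 - lam) n / fact n * (Beta (lam + of_nat n) (\<nu> + 1) / (Gamma lam *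
      Gamma (\<nu> + 1))) * (-1 / (2 * S)) ^ n = 
    pochhammer (1 - lam) n / fact n * (pochhammer lam n / Gamma (\<nu> + lam + of_nat n + 1)) * (-1 /
        (2 * S)) ^ n" by (simp only:)
  also have "\<dots> = a_coeff n (lam - 1/2) / (Gamma (\<nu> + lam + of_nat n + 1) * S ^ n)"
    unfolding a_coeff_pochhammer power_divide power_mult_distrib by (simp add: mult_ac)
  finally show ?thesis by (simp only: times_divide_eq_right)
qed

text \<open>R is given only implicitly by its defining equation. The common prefactor is nonzero and
  can be cancelled; the terms with n < N then match on both sides, and R is the contribution of the
  two Stieltjes integrals.\<close>

lemma remainder_integral:
  fixes \<zeta> :: real and N :: nat and lam \<nu> R :: complex
  assumes z: "0 < \<zeta>" "\<zeta> < pi" and lam: "0 < Re lam" "Re lam < real N + 1" and nu: "Re \<nu> > -1"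
    and R_def: "gegenbauer_C \<nu> lam (cos \<zeta>) =
      2 / (Gamma lam * complex_of_real (2 * sin \<zeta>) powr lam) *
      ((\<Sum>n<N. a_coeff n (lam - 1 / 2) *
                (Gamma (\<nu> + 2 * lam) / Gamma (\<nu> + lam + of_nat n + 1)) *
                (cos (phase_delta \<zeta> lam \<nu> n) / complex_of_real (sin \<zeta> ^ n))) + R)"
  defines "k \<equiv> beta_kernel (of_nat N + 1 - lam) lam" and "\<delta> \<equiv> phase_delta \<zeta> lam \<nu> N"
  shows "R = Gamma (\<nu> + 2 * lam) / 2 * (sin (of_real pi * lam) / of_real pi) / (Gamma lam *
      Gamma (\<nu> + 1)) *
     of_real ((-1 / (2 * sin \<zeta>)) ^ N) * integral {0<..<1} (\<lambda>t. (exp (\<i> * \<delta>) *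
         stieltjes k (w_point 1 \<zeta> * of_real t) +
        exp (- (\<i> * \<delta>)) * stieltjes k (w_point (-1) \<zeta> * of_real t)) * beta_kernel (lam +
            of_nat N) (\<nu> + 1) t)"
proof -
  define sp where "sp = sin (of_real pi * lam) / of_real pi"
  define G where "G = Gamma (\<nu> + 2 * lam)"
  define g where "g = Gamma lam * Gamma (\<nu> + 1)"
  define b where "b = beta_kernel (lam + of_nat N) (\<nu> + 1)"
  define S where "S = (\<lambda>\<sigma>. integral {0<..<1} (\<lambda>t. stieltjes k (w_point \<sigma> \<zeta> * of_real t) * b t))"
  define d where "d = phase_delta \<zeta> lam \<nu>"
  define x where "x = complex_of_real (-1 / (2 * sin \<zeta>))"
  define c where "c = (\<lambda>n. pochhammer (1 - lam) n / fact n * Beta (lam + of_nat n) (\<nu> + 1))"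
  have sz: "sin \<zeta> > 0" using z by (intro sin_gt_zero)
  have np: "lam \<notin> \<int>\<^sub>\<le>\<^sub>0" "\<nu> + 1 \<notin> \<int>\<^sub>\<le>\<^sub>0" using lam nu by (auto intro!: Re_pos_not_nonpos_Ints)
  hence gz: "Gamma lam \<noteq> 0" "Gamma (\<nu> + 1) \<noteq> 0" by (auto simp: Gamma_eq_zero_iff)
  have k: "k absolutely_integrable_on {0<..<1}" unfolding k_def using lam
      by (intro beta_kernel_absolutely_integrable) auto
  have bi: "b absolutely_integrable_on {0<..<1}" unfolding b_def using lam nu
      by (intro beta_kernel_absolutely_integrable) auto
  have int: "((\<lambda>t. stieltjes k (w_point \<sigma> \<zeta> * of_real t) * b t) has_integral S \<sigma>) {0<..<1}" for \<sigma>
    unfolding S_def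
    by (intro absolutely_integrable_on_has_integral cut_plane_ray_absolutely_integrable[where G =
        "stieltjes k"] w_point_cut_plane stieltjes_holomorphic k bi)
  have pw: "exp (\<i> * d 0) * w_point 1 \<zeta> ^ n = x ^ n * exp (\<i> * d n)" "exp (- (\<i> * d 0)) *
      w_point (-1) \<zeta> ^ n = x ^ n * exp (- (\<i> * d n))" for n
    using exp_phase_w_power[OF z, of 1 lam \<nu> n] exp_phase_w_power[OF z, of "-1" lam \<nu> n]
        by (simp_all add: d_def x_def)
  have J: "euler_integral \<nu> lam (w_point \<sigma> \<zeta>) = (\<Sum>n<N. c n * w_point \<sigma> \<zeta> ^ n) + sp * S \<sigma> *
      w_point \<sigma> \<zeta> ^ N" for \<sigma>
    using euler_integral_expansion[OF lam nu w_point_cut_plane[of \<sigma> \<zeta>]]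
    unfolding k_def[symmetric] sp_def[symmetric] b_def[symmetric] S_def c_def
        by (simp only: mult_ac)
  define E where "E = exp (\<i> * d 0) * euler_integral \<nu> lam (w_point 1 \<zeta>) + exp (- (\<i> * d 0)) *
      euler_integral \<nu> lam (w_point (-1) \<zeta>)"
  have J1: "exp e * euler_integral \<nu> lam (w_point \<sigma> \<zeta>) = (\<Sum>n<N. c n * (exp e * w_point \<sigma> \<zeta> ^ n)) +
      sp * S \<sigma> * (exp e * w_point \<sigma> \<zeta> ^ N)" for \<sigma> e
    unfolding J distrib_left sum_distrib_left by (simp only: mult_ac)
  have "E = (\<Sum>n<N. c n * (x ^ n * exp (\<i> * d n)) + c n * (x ^ n * exp (- (\<i> * d n)))) + 
      (sp * S 1 * (x ^ N * exp (\<i> * d N)) + sp * S (-1) * (x ^ N * exp (- (\<i> * d N))))"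
    unfolding E_def J1 pw sum.distrib by (simp only: add_ac)
  also have "(\<Sum>n<N. c n * (x ^ n * exp (\<i> * d n)) + c n * (x ^ n * exp (- (\<i> * d n)))) =
      (\<Sum>n<N. 2 * (c n * x ^ n) * cos (d n))"
    by (intro sum.cong refl) (simp add: cos_exp_eq algebra_simps)
  also have "sp * S 1 * (x ^ N * exp (\<i> * d N)) + sp * S (-1) * (x ^ N * exp (- (\<i> * d N))) = sp *
      x ^ N * (exp (\<i> * d N) * S 1 + exp (- (\<i> * d N)) * S (-1))"
    by (simp add: algebra_simps)
  finally have E: "E = (\<Sum>n<N. 2 * (c n * x ^ n) * cos (d n)) + sp * x ^ N * (exp (\<i> * d N) * S 1 +
      exp (- (\<i> * d N)) * S (-1))" .
  have I: "integral {0<..<1} (\<lambda>t. (exp (\<i> * \<delta>) * stieltjes k (w_point 1 \<zeta> * of_real t) +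
        exp (- (\<i> * \<delta>)) * stieltjes k (w_point (-1) \<zeta> * of_real t)) * b t) = exp (\<i> * d N) * S 1 +
            exp (- (\<i> * d N)) * S (-1)"
  proof -
    have "((\<lambda>t. exp (\<i> * \<delta>) * (stieltjes k (w_point 1 \<zeta> * of_real t) * b t) +
        exp (- (\<i> * \<delta>)) * (stieltjes k (w_point (-1) \<zeta> * of_real t) * b t)) has_integral (exp (\<i> *
            \<delta>) * S 1 + exp (- (\<i> * \<delta>)) * S (-1))) {0<..<1}"
      by (intro has_integral_add has_integral_mult_right int)
    from integral_unique[OF this] show ?thesis unfolding d_def \<delta>_def
        by (simp only: distrib_right mult.assoc)
  qed
  have "gegenbauer_C \<nu> lam (cos \<zeta>) = G / (Gamma lam * of_real (2 * sin \<zeta>) powr lam) * (E / g)"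
    using gegenbauer_C_euler[OF z lam(1) nu] unfolding E_def G_def g_def d_def phase_delta_def
        by simp
  also have "\<dots> = 2 / (Gamma lam * of_real (2 * sin \<zeta>) powr lam) * (G / 2 * (E / g))" by simp
  finally have "2 / (Gamma lam * of_real (2 * sin \<zeta>) powr lam) * ((\<Sum>n<N. a_coeff n (lam - 1 / 2) *
                (G / Gamma (\<nu> + lam + of_nat n + 1)) * (cos (d n) /
                    complex_of_real (sin \<zeta> ^ n))) + R) = 
     2 / (Gamma lam * of_real (2 * sin \<zeta>) powr lam) * (G / 2 * (E / g))"
    unfolding R_def G_def d_def .
  moreover have "2 / (Gamma lam * complex_of_real (2 * sin \<zeta>) powr lam) \<noteq> 0" using gz sz
      by (simp add: powr_def)
  ultimately have eq: "(\<Sum>n<N. a_coeff n (lam - 1 / 2) *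
                (G / Gamma (\<nu> + lam + of_nat n + 1)) * (cos (d n) /
                    complex_of_real (sin \<zeta> ^ n))) + R = G / 2 * (E / g)"
    by (simp only: mult_cancel_left) simp
  have "G / 2 * (E / g) = (\<Sum>n<N. G * (c n / g * x ^ n) * cos (d n)) + G / 2 * sp / g * x ^ N *
      (exp (\<i> * d N) * S 1 + exp (- (\<i> * d N)) * S (-1))"
  proof -
    have "(\<Sum>n<N. 2 * (c n * x ^ n) * cos (d n)) * (G / 2 / g) = (\<Sum>n<N. G * (c n / g * x ^ n) *
        cos (d n))"
      unfolding sum_distrib_right by (intro sum.cong refl) simp
    moreover have "G / 2 * (E / g) = E * (G / 2 / g)" by simp
    moreover have "sp * x ^ N * T * (G / 2 / g) = G / 2 * sp / g * x ^ N * T" for T by simp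
    ultimately show ?thesis unfolding E by (simp only: distrib_right)
  qed
  moreover have "G * (c n / g * x ^ n) * cos (d n) = a_coeff n (lam - 1 / 2) *
                (G / Gamma (\<nu> + lam + of_nat n + 1)) * (cos (d n) /
                    complex_of_real (sin \<zeta> ^ n))" for n
  proof -
    have "c n / g * x ^ n = a_coeff n (lam - 1/2) / (Gamma (\<nu> + lam + of_nat n + 1) *
        of_real (sin \<zeta>) ^ n)"
      using a_coeff_Beta[OF lam(1) nu, of n "of_real (sin \<zeta>)"] unfolding c_def g_def x_def by simp
    thus ?thesis by simp
  qed
  ultimately have "R = G / 2 * sp / g * x ^ N * (exp (\<i> * d N) * S 1 + exp (- (\<i> * d N)) * S (-1))"
    using eq by simp
  thus ?thesis unfolding b_def[symmetric] I G_def sp_def g_def x_def by (simp only: of_real_power)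
qed

text \<open>The bound A + B s is used at s = t u, where it separates the variables. Estimating the
  inner and then the outer integral leaves products of two beta integrals, and in the B-term the
  factors t and u raise the first parameter of each by one.\<close>

lemma remainder_integral_norm_le:
  fixes \<zeta> A B :: real and N :: nat and lam \<nu> \<delta> :: complex
  assumes lam: "0 < Re lam" "Re lam < real N + 1" and nu: "Re \<nu> > -1"
    and le: "\<And>s. 0 \<le> s \<Longrightarrow> s \<le> 1 \<Longrightarrow> norm (phase_kernel \<zeta> \<delta> s) \<le> A + B * s"
  defines "k \<equiv> beta_kernel (of_nat N + 1 - lam) lam"
  shows "norm (integral {0<..<1} (\<lambda>t. (exp (\<i> * \<delta>) * stieltjes k (w_point 1 \<zeta> * of_real t) +
        exp (- (\<i> * \<delta>)) * stieltjes k (w_point (-1) \<zeta> * of_real t)) * beta_kernel (lam +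
            of_nat N) (\<nu> + 1) t)) \<le>
    A * Beta (real N + 1 - Re lam) (Re lam) * Beta (Re lam + real N) (Re \<nu> + 1) +
    B * Beta (real N + 2 - Re lam) (Re lam) * Beta (Re lam + real N + 1) (Re \<nu> + 1)"
proof -
  define b where "b = beta_kernel (lam + of_nat N) (\<nu> + 1)"
  define B1 where "B1 = Beta (real N + 1 - Re lam) (Re lam)"
  define B2 where "B2 = Beta (real N + 2 - Re lam) (Re lam)"
  define Q where "Q = (\<lambda>t. exp (\<i> * \<delta>) * stieltjes k (w_point 1 \<zeta> * of_real t) + exp (- (\<i> * \<delta>)) *
      stieltjes k (w_point (-1) \<zeta> * of_real t))"
  have k: "k absolutely_integrable_on {0<..<1}" unfolding k_def using lam
      by (intro beta_kernel_absolutely_integrable) auto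
  have bi: "b absolutely_integrable_on {0<..<1}" unfolding b_def using lam nu
      by (intro beta_kernel_absolutely_integrable) auto
  have k1: "((\<lambda>u. norm (k u)) has_integral B1) {0<..<1}"
    unfolding k_def B1_def using has_integral_norm_beta_kernel[of "of_nat N + 1 - lam" lam] lam
        by simp
  have k2: "((\<lambda>u. u * norm (k u)) has_integral B2) {0<..<1}"
  proof -
    have "((\<lambda>u. norm (beta_kernel (of_nat N + 1 - lam + 1) lam u)) has_integral B2) {0<..<1}"
      unfolding B2_def using has_integral_norm_beta_kernel[of "of_nat N + 1 - lam + 1" lam] lam
          by (simp add: algebra_simps)
    thus ?thesis
      by (rule has_integral_eq[rotated]) (simp only: beta_kernel_plus1_left,
          simp add: norm_mult k_def)
  qed
  have b1: "((\<lambda>t. norm (b t)) has_integral Beta (Re lam + real N) (Re \<nu> + 1)) {0<..<1}"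
    unfolding b_def using has_integral_norm_beta_kernel[of "lam + of_nat N" "\<nu> + 1"] lam nu by simp
  have b2: "((\<lambda>t. t * norm (b t)) has_integral Beta (Re lam + real N + 1) (Re \<nu> + 1)) {0<..<1}"
  proof -
    have "((\<lambda>u. norm (beta_kernel (lam + of_nat N + 1) (\<nu> + 1) u)) has_integral Beta (Re lam +
        real N + 1) (Re \<nu> + 1)) {0<..<1}"
      using has_integral_norm_beta_kernel[of "lam + of_nat N + 1" "\<nu> + 1"] lam nu by simp
    thus ?thesis
      by (rule has_integral_eq[rotated]) (simp only: beta_kernel_plus1_left,
          simp add: norm_mult b_def)
  qed
  have inner: "norm (Q t) \<le> A * B1 + B * t * B2" if t: "t \<in> {0<..<1}" for t
  proof -
    have sti: "((\<lambda>u. 1 / (1 - w_point \<sigma> \<zeta> * of_real t * of_real u) * k u) has_integral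
        stieltjes k (w_point \<sigma> \<zeta> * of_real t)) {0<..<1}" for \<sigma>
      unfolding stieltjes_def using cut_plane_scale(1)[OF w_point_cut_plane[of \<sigma> \<zeta>], of t] t
      by (intro absolutely_integrable_on_has_integral stieltjes_absolutely_integrable k) (auto
          simp: mult.commute)
    have "((\<lambda>u. exp (\<i> * \<delta>) * (1 / (1 - w_point 1 \<zeta> * of_real t * of_real u) * k u) + 
        exp (- (\<i> * \<delta>)) * (1 / (1 - w_point (-1) \<zeta> * of_real t * of_real u) * k u)) has_integral
            Q t) {0<..<1}"
      unfolding Q_def by (intro has_integral_add has_integral_mult_right sti)
    hence q: "((\<lambda>u. phase_kernel \<zeta> \<delta> (t * u) * k u) has_integral Q t) {0<..<1}"
      unfolding phase_kernel_def of_real_mult by (simp only: distrib_right mult.assoc)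
    have h: "((\<lambda>u. A * norm (k u) + B * t * (u * norm (k u))) has_integral (A * B1 + B * t *
        B2)) {0<..<1}"
      by (intro has_integral_add has_integral_mult_right k1 k2)
    have "norm (phase_kernel \<zeta> \<delta> (t * u) * k u) \<le> A * norm (k u) + B * t * (u * norm (k u))"
        if u: "u \<in> {0<..<1}" for u
    proof -
      have "norm (phase_kernel \<zeta> \<delta> (t * u)) \<le> A + B * (t * u)" using t u
          by (intro le) (auto simp: mult_le_one)
      from mult_right_mono[OF this norm_ge_zero[of "k u"]] show ?thesis
          by (simp add: norm_mult algebra_simps)
    qed
    from has_integral_norm_bound_has_integral[OF q h this] show ?thesis .
  qed
  have "(\<lambda>t. stieltjes k (w_point \<sigma> \<zeta> * of_real t) * b t) integrable_on {0<..<1}" for \<sigma>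
    by (intro set_lebesgue_integral_eq_integral(1) cut_plane_ray_absolutely_integrable[where G =
        "stieltjes k"] w_point_cut_plane stieltjes_holomorphic k bi)
  hence "(\<lambda>t. exp (\<i> * \<delta>) * (stieltjes k (w_point 1 \<zeta> * of_real t) * b t) + exp (- (\<i> * \<delta>)) *
      (stieltjes k (w_point (-1) \<zeta> * of_real t) * b t)) integrable_on {0<..<1}"
    by (intro integrable_add integrable_on_mult_right)
  hence Qb: "((\<lambda>t. Q t * b t) has_integral integral {0<..<1} (\<lambda>t. Q t * b t)) {0<..<1}"
    unfolding Q_def distrib_right mult.assoc by (rule integrable_integral)
  have H: "((\<lambda>t. A * B1 * norm (b t) + B * B2 * (t * norm (b t))) has_integral
      (A * B1 * Beta (Re lam + real N) (Re \<nu> + 1) + B * B2 * Beta (Re lam + real N + 1) (Re \<nu> +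
          1))) {0<..<1}"
    by (intro has_integral_add has_integral_mult_right b1 b2)
  have "norm (Q t * b t) \<le> A * B1 * norm (b t) + B * B2 * (t * norm (b t))" if "t \<in> {0<..<1}" for t
    using mult_right_mono[OF inner[OF that] norm_ge_zero[of "b t"]]
        by (simp add: norm_mult algebra_simps)
  from has_integral_norm_bound_has_integral[OF Qb H this] show ?thesis
    unfolding Q_def b_def B1_def B2_def .
qed

text \<open>The two Beta values supply the real Gamma factors of \<open>G_factor\<close>; their
  remaining numerators Gamma(r + k) Gamma(k + 1 - r) form \<open>a_sin_quot\<close>.\<close>

lemma Beta_Beta_a_sin_quot:
  assumes r: "0 < r" "r < real k + 1"
  shows "Beta (real k + 1 - r) r * Beta (r + real k) (v + 1) = pi * 2 ^ k * a_sin_quot k r *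
      (Gamma r * Gamma (v + 1)) / Gamma (v + r + real k + 1)"
proof -
  have "Beta (real k + 1 - r) r = Gamma (real k + 1 - r) * Gamma r / fact k"
    using Gamma_fact[of k, where ?'a = real] by (simp add: Beta_def add_ac)
  moreover have "Beta (r + real k) (v + 1) = Gamma (r + real k) * Gamma (v + 1) / Gamma (v + r +
      real k + 1)"
    by (simp add: Beta_def add_ac)
  ultimately show ?thesis unfolding a_sin_quot_Gamma[OF r] by simp
qed

text \<open>The prefactor contains 1 / 2^(N + 1), while the Beta products for N and N + 1 bring 2^N
  and 2^(N + 1). Hence the asymmetric hypothesis 2 A + B s leaves exactly A and B in the
  conclusion.\<close>

lemma remainder_norm_le:
  fixes \<zeta> A B :: real and N :: nat and lam \<nu> R :: complex
  assumes z: "0 < \<zeta>" "\<zeta> < pi" and lam: "0 < Re lam" "Re lam < real N + 1" and nu: "Re \<nu> > -1"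
    and R_def: "gegenbauer_C \<nu> lam (cos \<zeta>) =
      2 / (Gamma lam * complex_of_real (2 * sin \<zeta>) powr lam) *
      ((\<Sum>n<N. a_coeff n (lam - 1 / 2) *
                (Gamma (\<nu> + 2 * lam) / Gamma (\<nu> + lam + of_nat n + 1)) *
                (cos (phase_delta \<zeta> lam \<nu> n) / complex_of_real (sin \<zeta> ^ n))) + R)"
    and le: "\<And>s. 0 \<le> s \<Longrightarrow> s \<le> 1 \<Longrightarrow> norm (phase_kernel \<zeta> (phase_delta \<zeta> lam \<nu> N) s) \<le> 2 * A + B * s"
  shows "norm R \<le> G_factor lam \<nu> * (a_sin_quot N (Re lam) * (cmod (Gamma (\<nu> + 2 * lam)) /
      Gamma (Re \<nu> + Re lam + real N + 1)) * (A / sin \<zeta> ^ N) +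
     a_sin_quot (N + 1) (Re lam) * (cmod (Gamma (\<nu> + 2 * lam)) / Gamma (Re \<nu> + Re lam + real N +
         2)) * (B / sin \<zeta> ^ N))"
proof -
  have sz: "sin \<zeta> > 0" using z by (intro sin_gt_zero)
  define P where "P = norm (Gamma (\<nu> + 2 * lam)) / 2 * (norm (sin (of_real pi * lam)) / pi) /
      norm (Gamma lam * Gamma (\<nu> + 1)) * (1 / (2 * sin \<zeta>)) ^ N"
  define GG where "GG = Gamma (Re lam) * Gamma (Re \<nu> + 1)"
  have GGpos: "GG > 0" unfolding GG_def using lam nu by (intro mult_pos_pos Gamma_real_pos) auto
  have Gf: "G_factor lam \<nu> = norm (sin (of_real pi * lam)) * GG / norm (Gamma lam * Gamma (\<nu> + 1))"
    unfolding G_factor_def GG_def[symmetric] norm_divide norm_of_real using GGpos by simp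
  have "norm (complex_of_real ((-1 / (2 * sin \<zeta>)) ^ N)) = (1 / (2 * sin \<zeta>)) ^ N"
    using sz by (simp add: norm_power power_abs norm_divide norm_mult)
  hence "norm R = P * norm (integral {0<..<1} (\<lambda>t. (exp (\<i> * phase_delta \<zeta> lam \<nu> N) *
      stieltjes (beta_kernel (of_nat N + 1 - lam) lam) (w_point 1 \<zeta> * of_real t) +
        exp (- (\<i> * phase_delta \<zeta> lam \<nu> N)) * stieltjes (beta_kernel (of_nat N +
            1 - lam) lam) (w_point (-1) \<zeta> * of_real t)) * beta_kernel (lam + of_nat N) (\<nu> + 1) t))"
    by (subst remainder_integral[OF z lam nu R_def]) (simp only: norm_mult norm_divide
        norm_of_real P_def, simp)
  also have "\<dots> \<le> P * (2 * A * Beta (real N + 1 - Re lam) (Re lam) * Beta (Re lam + real N) (Re \<nu> +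
      1) +
    B * Beta (real N + 2 - Re lam) (Re lam) * Beta (Re lam + real N + 1) (Re \<nu> + 1))"
    using sz by (intro mult_left_mono remainder_integral_norm_le lam nu le) (auto simp: P_def)
  also have "2 * A * Beta (real N + 1 - Re lam) (Re lam) * Beta (Re lam + real N) (Re \<nu> + 1) = 
      2 * A * (pi * 2 ^ N * a_sin_quot N (Re lam) * GG / Gamma (Re \<nu> + Re lam + real N + 1))"
    using Beta_Beta_a_sin_quot[OF lam, of "Re \<nu>"] by (simp only: GG_def mult.assoc)
  also have "B * Beta (real N + 2 - Re lam) (Re lam) * Beta (Re lam + real N + 1) (Re \<nu> + 1) = 
      B * (pi * 2 ^ (N + 1) * a_sin_quot (N + 1) (Re lam) * GG / Gamma (Re \<nu> + Re lam + real N +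
          2))"
    using Beta_Beta_a_sin_quot[of "Re lam" "N + 1" "Re \<nu>"] lam
        by (simp add: GG_def add_ac mult.assoc)
  also have "P * (2 * A * (pi * 2 ^ N * a_sin_quot N (Re lam) * GG / Gamma (Re \<nu> + Re lam +
      real N + 1)) + 
       B * (pi * 2 ^ (N + 1) * a_sin_quot (N + 1) (Re lam) * GG / Gamma (Re \<nu> + Re lam + real N +
           2))) =
     G_factor lam \<nu> * (a_sin_quot N (Re lam) * (cmod (Gamma (\<nu> + 2 * lam)) / Gamma (Re \<nu> +
         Re lam + real N + 1)) * (A / sin \<zeta> ^ N) +
     a_sin_quot (N + 1) (Re lam) * (cmod (Gamma (\<nu> + 2 * lam)) / Gamma (Re \<nu> + Re lam + real N +
         2)) * (B / sin \<zeta> ^ N))"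
    unfolding P_def Gf power_divide power_mult_distrib distrib_left by (simp add: mult_ac)
  finally show ?thesis .
qed

theorem corollary5p3:
  fixes \<zeta> :: real and N :: nat and lam \<nu> R :: complex
  assumes "0 < \<zeta>" and "\<zeta> < pi"
    and "0 < Re lam" and "Re lam < real N + 1"
    and "Re \<nu> > -1"
    and "\<nu> + 2 * lam \<notin> \<int>\<^sub>\<le>\<^sub>0"
    and R_def: "gegenbauer_C \<nu> lam (cos \<zeta>) =
      2 / (Gamma lam * complex_of_real (2 * sin \<zeta>) powr lam) *
      ((\<Sum>n<N. a_coeff n (lam - 1 / 2) *
                (Gamma (\<nu> + 2 * lam) / Gamma (\<nu> + lam + of_nat n + 1)) *
                (cos (phase_delta \<zeta> lam \<nu> n) / complex_of_real (sin \<zeta> ^ n))) + R)"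
  shows "cmod R \<le>
           G_factor lam \<nu> * a_sin_quot N (Re lam) *
           (cmod (Gamma (\<nu> + 2 * lam)) / Gamma (Re \<nu> + Re lam + real N + 1)) *
           (cosh (Im (phase_delta \<zeta> lam \<nu> N)) / sin \<zeta> ^ N) * s_factor \<zeta>
       \<and> cmod R \<le>
           G_factor lam \<nu> *
           (a_sin_quot N (Re lam) *
              (cmod (Gamma (\<nu> + 2 * lam)) / Gamma (Re \<nu> + Re lam + real N + 1)) *
              (cmod (cos (phase_delta \<zeta> lam \<nu> N)) / sin \<zeta> ^ N)
            + a_sin_quot (N + 1) (Re lam) *
              (cmod (Gamma (\<nu> + 2 * lam)) / Gamma (Re \<nu> + Re lam + real N + 2)) *
              (cmod (sin (phase_delta \<zeta> lam \<nu> N)) / sin \<zeta> ^ (N + 1))) * s_factor \<zeta>"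
proof
  note z = assms(1,2)
  note bound = remainder_norm_le[OF z assms(3-5) R_def]
  let ?d = "phase_delta \<zeta> lam \<nu> N"
  \<comment> \<open>Here A is cosh times \<open>s_factor\<close> and B = 0, so that the term with
    index N + 1 drops out.\<close>
  have "norm (phase_kernel \<zeta> ?d s) \<le> 2 * (cosh (Im ?d) * s_factor \<zeta>) + 0 * s"
      if "0 \<le> s" "s \<le> 1" for s
    using norm_phase_kernel_le_cosh[OF z that, of ?d] by (simp add: mult_ac)
  from bound[OF this] show "cmod R \<le>
           G_factor lam \<nu> * a_sin_quot N (Re lam) *
           (cmod (Gamma (\<nu> + 2 * lam)) / Gamma (Re \<nu> + Re lam + real N + 1)) *
           (cosh (Im ?d) / sin \<zeta> ^ N) * s_factor \<zeta>"
    by (simp add: mult_ac)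
  \<comment> \<open>The sine in the denominator of B raises its power of sin \<zeta> to N +
    1.\<close>
  have "norm (phase_kernel \<zeta> ?d s) \<le> 2 * (norm (cos ?d) * s_factor \<zeta>) + (norm (sin ?d) / sin \<zeta> *
      s_factor \<zeta>) * s" if "0 \<le> s" "s \<le> 1" for s
    using norm_phase_kernel_le_cos_sin[OF z that, of ?d] by (simp add: mult_ac)
  from bound[OF this] show "cmod R \<le>
           G_factor lam \<nu> *
           (a_sin_quot N (Re lam) *
              (cmod (Gamma (\<nu> + 2 * lam)) / Gamma (Re \<nu> + Re lam + real N + 1)) *
              (cmod (cos ?d) / sin \<zeta> ^ N)
            + a_sin_quot (N + 1) (Re lam) *
              (cmod (Gamma (\<nu> + 2 * lam)) / Gamma (Re \<nu> + Re lam + real N + 2)) *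
              (cmod (sin ?d) / sin \<zeta> ^ (N + 1))) * s_factor \<zeta>"
    by (simp add: distrib_right distrib_left mult_ac)
qed

end
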